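(* Let $(\bar x,\bar u)$ be an asymptotic extremal of Problem (P), and let $\delta>0$ and $\{(x^k,u^k,\zeta^k,p^k,q^k,r^k,\lambda_k)\}$ be an associated AWMP sequence (with parameter $\delta$ and perturbations $(\varepsilon^k,\eta^k)$) such that $x^k\to\bar x$ uniformly and $u^k\to\bar u$ in $L^1_m$. Assume that hypotheses (H1)--(H7) listed in the context hold for this $\delta$ and that: (H8) there exist integrable functions $c_\varepsilon,c_\eta$, depending only on $(\bar x,\bar u)$ and $\delta$, such that $|\varepsilon^k(t)|\le c_\varepsilon(t)$ and $|\eta^k(t)|\le c_\eta(t)$ a.e. in $[t_0,t_1]$ for all $k\in\mathbb N$; (H9) there exists an integrable function $c_\varphi$, depending only on $(\bar x,\bar u)$ and $\delta$, such that for all $k\in\mathbb N$ and a.e. $t\in[t_0,t_1]$ $$\Big|\sum_{i=1}^{m_b}q_i^k(t)\nabla_x b_i(t,x^k(t),u^k(t))+\sum_{j=1}^{m_g}r_j^k(t)\nabla_x g_j(t,x^k(t),u^k(t))\Big|\le c_\varphi(t).$$ If $(\bar x,\bar u)$ is an AWMP-regular process of (P) (with this $\delta$), then $(\bar x,\bar u)$ satisfies the conditions of the classical weak maximum principle, i.e. there exist $\lambda\in[0,+\infty)$, $p\in W^{1,1}_n$, $q\in L^1_{m_b}$, $r\in L^1_{m_g}$, $\zeta\in L^1_m$ such that \begin{align*} &\lambda+\|p\|_{L^\infty_n}\neq 0,\\ &(-\dot p(t),\zeta(t))\in \mathrm{co}\,\partial_{x,u}\mathcal H(t,\bar x(t),p(t),q(t),r(t),\bar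 u(t))\ \text{ a.e. in }[t_0,t_1],\\ &\zeta(t)\in \mathrm{co}\,\mathcal N_{U(t)}(\bar u(t))\ \text{ a.e. in }[t_0,t_1],\\ &r(t)\cdot g(t,\bar x(t),\bar u(t))=0\ \text{ and }\ r(t)\le 0\ \text{ a.e. in }[t_0,t_1],\\ &(p(t_0),-p(t_1))\in\lambda\,\partial\ell(\bar x(t_0),\bar x(t_1))+\mathcal N_C(\bar x(t_0),\bar x(t_1)). \end{align*}
   Context: Notation. $L^p_l:=L^p([t_0,t_1];\mathbb R^l)$, $W^{1,1}_n:=W^{1,1}([t_0,t_1];\mathbb R^n)$; $B$ is the closed unit ball; $|\cdot|$ is the Euclidean norm; $\to$, $\rightharpoonup$ are strong and weak convergence; $\mathrm{co}$ is the convex hull; $\mathcal N_S(x)$ is the limiting (Mordukhovich) normal cone to $S$ at $x\in S$ (and $\mathcal N_S(x)=\varnothing$ if $x\notin S$); $\partial$ is the limiting (Mordukhovich) subdifferential, $\partial_{x,u}$ being taken with respect to $(x,u)$. Vector inequalities are componentwise. Problem (P): minimize $\ell(x(t_0),x(t_1))$ over $(x,u)\in W^{1,1}_n\times L^1_m$ subject to $\dot x(t)=f(t,x(t),u(t))$, $0=b(t,x(t),u(t))$, $0\ge g(t,x(t),u(t))$, $u(t)\in U(t)$ a.e. in $[t_0,t_1]$, and $(x(t_0),x(t_1))\in C$. Here $\ell:\mathbb R^n\times\mathbb R^n\to\mathbb R$, and $f,b,g$ map $[t_0,t_1]\times\mathbb R^n\times\mathbb R^m$ to $\mathbb R^n,\mathbb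 R^{m_b},\mathbb R^{m_g}$ respectively; $U:[t_0,t_1]\rightsquigarrow\mathbb R^m$ is a nonempty set-valued map and $C\subset\mathbb R^n\times\mathbb R^n$. A process is a pair $(x,u)\in W^{1,1}_n\times L^1_m$ satisfying the dynamics; it is feasible if it satisfies all the other constraints. Set $g_j^-(t,x,u):=\max\{-g_j(t,x,u),0\}$ and $\mathcal H(t,x,p,q,r,u):=p\cdot f(t,x,u)+q\cdot b(t,x,u)+r\cdot g(t,x,u)$. For $\delta>0$ and $(\bar x,\bar u)$: $\Omega_\delta(t):=\{(y,z)\in\mathbb R^n\times\mathbb R^m:|(y,z)-(\bar x(t),\bar u(t))|\le\delta\}$, $\Omega_\delta:=\{(x,u)\in W^{1,1}_n\times L^1_m:(x(t),u(t))\in\Omega_\delta(t)\text{ a.e.}\}$, $U_\delta(t):=(\bar u(t)+\delta B)\cap U(t)$, $\mathscr C:=\{\phi\in L^1_1:\phi(t)\le 0\}$. Hypotheses (for a given $\delta>0$): (H1) $f(\cdot,x,u)$ is Lebesgue measurable for each $(x,u)$ and there is an integrable $k_f$ such that, for a.e. $t$, $|f(t,x,u)-f(t,x',u')|\le k_f(t)|(x,u)-(x',u')|$ for all $(x,u),(x',u')\in\Omega_\delta(t)$. (H2) The graph of $U$ is a Borel measurable set and $U_\delta(t)$ is closed and convex for a.e. $t$. (H3) $C$ is closed and $\ell$ is locally Lipschitz in a neighborhood of $(\bar x(t_0),\bar x(t_1))$. (H4) $(b,g)(\cdot,x,u)$ is Lebesgue measurable for each $(x,u)$. (H5) $(b,g)(t,\cdot,\cdot)$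 is continuously differentiable on $(\bar x(t),\bar u(t))+\delta B$ for a.e. $t$ and there is an integrable $k_{bg}$ such that, for a.e. $t$, $|(b,g)(t,x,u)-(b,g)(t,x',u')|\le k_{bg}(t)|(x,u)-(x',u')|$ for all $(x,u),(x',u')\in\Omega_\delta(t)$. (H6) $K_f(t):=|f(t,\bar x(t),\bar u(t))|$ and $K_{bg}(t):=|(b,g)(t,\bar x(t),\bar u(t))|$ are integrable on $[t_0,t_1]$ and $\bar u\in L^\infty_m$. (H7) Let $D:=\{(x,v)\in W^{1,1}_n\times L^2_m:(x(t),v(t))\in\Omega_\delta(t)\text{ a.e. in }[t_0,t_1]\}$. The mapping $\mathcal F:D\to L^\infty_n$, $\mathcal F(x,v)(t):=\int_{t_0}^t f(s,x(s),v(s))\,ds$, is completely continuous, and $\mathcal P:D\to\mathbb R$, $\mathcal P(x,v):=\int_{t_0}^{t_1}\big[\sum_{i=1}^{m_b}(b_i(t,x(t),v(t)))^2+\sum_{j=1}^{m_g}(\max\{g_j(t,x(t),v(t)),0\})^2\big]dt$, is weakly sequentially lower semicontinuous. AWMP sequence. A sequence $\{(x^k,u^k,\zeta^k,p^k,q^k,r^k,\lambda_k)\}\subset W^{1,1}_n\times L^1_m\times L^1_m\times W^{1,1}_n\times L^1_{m_b}\times L^1_{m_g}\times[0,+\infty)$ is an AWMP sequence if there exist $\delta>0$ and sequences $\{(\varepsilon^k,\eta^k)\}\subset L^1_n\times L^1_m$, $\{\theta_j^k\}\subset\mathscr C$ ($j=1,\dots,m_g$), $\{(\vartheta^k,\nu^k)\}\subset\mathbb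 R^n\times\mathbb R^n$ such that for all $k\in\mathbb N$: (i) $\lambda_k+\|p^k\|_{L^\infty_n}=1$; (ii) $(-\dot p^k(t),\zeta^k(t))-(\varepsilon^k(t),\eta^k(t))\in\mathrm{co}\,\partial_{x,u}\mathcal H(t,x^k(t),p^k(t),q^k(t),r^k(t),u^k(t))$ a.e.; (iii) $\zeta^k(t)\in\mathcal N_{U_\delta(t)}(u^k(t))$ a.e.; (iv) $r_j^k(t)g_j^-(t,x^k(t),u^k(t))=\theta_j^k(t)$ and $r_j^k(t)\le0$ a.e., $j=1,\dots,m_g$; (v) $(p^k(t_0),-p^k(t_1))-(\vartheta^k,\nu^k)\in\lambda_k\partial\ell(x^k(t_0),x^k(t_1))+\mathcal N_C(x^k(t_0),x^k(t_1))$; with $(\varepsilon^k,\eta^k)\rightharpoonup(0,0)$ in $L^1_n\times L^1_m$, $\theta_j^k(t)\to0$ a.e. for each $j$, and $(\vartheta^k,\nu^k)\to(0,0)$. A feasible process $(\bar x,\bar u)$ is an asymptotic extremal if there exists an AWMP sequence with $x^k\to\bar x$ uniformly and $u^k\to\bar u$ in $L^1_m$. The set $\mathcal M_\delta$. For $(x,u)\in\Omega_\delta$ and $\theta=(\theta_1,\dots,\theta_{m_g})$ with $\theta_j\in\mathscr C$, $\mathcal M_\delta(x,u,\theta)$ is the set of all $(\varphi,\psi,\gamma,\xi)\in L^1_n\times L^1_m\times\mathbb R^n\times\mathbb R^n$ for which there are $(q,r,\zeta)\in L^1_{m_b}\times L^1_{m_g}\times L^1_m$ such that, a.e. in $[t_0,t_1]$,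 $(\varphi(t),\psi(t))=\sum_{i=1}^{m_b}q_i(t)\nabla_{x,u}b_i(t,x(t),u(t))+\sum_{j=1}^{m_g}r_j(t)\nabla_{x,u}g_j(t,x(t),u(t))+(0,-\zeta(t))$, $\zeta(t)\in\mathcal N_{U_\delta(t)}(u(t))$, $r_j(t)g_j^-(t,x(t),u(t))=\theta_j(t)$, $r_j(t)\le0$ ($j=1,\dots,m_g$), $|\psi(t)|\le k_\psi(t)$ for some integrable $k_\psi:[t_0,t_1]\to\mathbb R$ depending only on $(\bar x,\bar u)$ and $\delta$; and $(\gamma,\xi)\in\mathcal N_C(x(t_0),x(t_1))$. (Since $k_\psi$ does not depend on $(x,u,\theta)$, one and the same $k_\psi$ serves for all $k$ along a sequence as below.) The weak upper limit $\mathrm{w}\text{-}\limsup_{x\to\bar x,u\to\bar u,\theta\to0}\mathcal M_\delta(x,u,\theta)$ is the set of all $(\varphi,\psi,\gamma,\xi)\in L^1_n\times L^1_m\times\mathbb R^n\times\mathbb R^n$ for which there exist $\{(x^k,u^k,\theta^k)\}\subset W^{1,1}_n\times L^1_m\times\mathscr C^{m_g}$ and $(\varphi^k,\psi^k,\gamma^k,\xi^k)\in\mathcal M_\delta(x^k,u^k,\theta^k)$ for all $k$, with $x^k\to\bar x$ uniformly, $u^k\to\bar u$ in $L^1_m$, $\theta^k_j(t)\to0$ a.e. for each $j$, $(\varphi^k,\psi^k)\rightharpoonup(\varphi,\psi)$ in $L^1_n\times L^1_m$, $(\gamma^k,\xi^k)\to(\gamma,\xi)$. A feasible process $(\bar x,\bar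 u)$ is AWMP-regular if $\mathrm{w}\text{-}\limsup_{x\to\bar x,u\to\bar u,\theta\to0}\mathcal M_\delta(x,u,\theta)\subset\mathcal M_\delta(\bar x,\bar u,0)$ for some $\delta>0$; "with this $\delta$" means the inclusion holds for the indicated $\delta$.
   Formalization: The formal statement additionally assumes that, for all large k, (x^k(t),u^k(t)) lies in the interior of Ω_δ(t) for a.e. t; without this the claim fails, since (H1) and (H5) do not control limiting subgradients outside or on the boundary of Ω_δ(t). *)

theory Defs
  imports "HOL-Analysis.Analysis" "HOL-Probability.Essential_Supremum"
begin

section \<open>Limiting normals, limiting subgradients, gradients\<close>

definition frechet_normal :: "'a::euclidean_space set \<Rightarrow> 'a \<Rightarrow> 'a set" where
  "frechet_normal S x =
     {v. x \<in> S \<and> (\<forall>e>0. \<exists>d>0. \<forall>y\<in>S. norm (y - x) < d \<longrightarrow> v \<bullet> (y - x) \<le> e * norm (y - x))}"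

definition limiting_normal :: "'a::euclidean_space set \<Rightarrow> 'a \<Rightarrow> 'a set" where
  "limiting_normal S x =
     {v. x \<in> S \<and> (\<exists>xs vs. (\<forall>i::nat. vs i \<in> frechet_normal S (xs i)) \<and>
                        xs \<longlonglongrightarrow> x \<and> vs \<longlonglongrightarrow> v)}"

definition frechet_subdiff :: "('a::euclidean_space \<Rightarrow> real) \<Rightarrow> 'a \<Rightarrow> 'a set" where
  "frechet_subdiff h x =
     {v. \<forall>e>0. \<exists>d>0. \<forall>y. norm (y - x) < d \<longrightarrow> h y \<ge> h x + v \<bullet> (y - x) - e * norm (y - x)}"

definition limiting_subdiff :: "('a::euclidean_space \<Rightarrow> real) \<Rightarrow> 'a \<Rightarrow> 'a set" where
  "limiting_subdiff h x =
     {v. \<exists>xs vs. (\<forall>i::nat. vs i \<in> frechet_subdiff h (xs i)) \<and>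
                xs \<longlonglongrightarrow> x \<and> (\<lambda>i. h (xs i)) \<longlonglongrightarrow> h x \<and> vs \<longlonglongrightarrow> v}"

definition grad :: "('a::euclidean_space \<Rightarrow> real) \<Rightarrow> 'a \<Rightarrow> 'a" where
  "grad h x = (THE D. GDERIV h x :> D)"

text \<open>Continuous differentiability on a set that need not be open: two-sided differentiability
  at every point of the set, with a gradient that is continuous along the set.\<close>

definition C1_on :: "'a::euclidean_space set \<Rightarrow> ('a \<Rightarrow> real) \<Rightarrow> bool" where
  "C1_on S h \<longleftrightarrow> (\<forall>x\<in>S. h differentiable (at x)) \<and> continuous_on S (grad h)"

section \<open>Function spaces on a compact interval\<close>

text \<open>Elements of the Lebesgue and Sobolev spaces are represented by functions on the reals.\<close>

abbreviation L1 :: "real \<Rightarrow> real \<Rightarrow> (real \<Rightarrow> 'a::euclidean_space) set" where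
  "L1 a b \<equiv> {u. integrable (lebesgue_on {a..b}) u}"

definition L2 :: "real \<Rightarrow> real \<Rightarrow> (real \<Rightarrow> 'a::euclidean_space) set" where
  "L2 a b = {u \<in> borel_measurable (lebesgue_on {a..b}).
               integrable (lebesgue_on {a..b}) (\<lambda>t. (norm (u t))\<^sup>2)}"

definition Linf :: "real \<Rightarrow> real \<Rightarrow> (real \<Rightarrow> 'a::euclidean_space) set" where
  "Linf a b = {u \<in> borel_measurable (lebesgue_on {a..b}).
               \<exists>c. AE t in lebesgue_on {a..b}. norm (u t) \<le> c}"

definition Linf_norm :: "real \<Rightarrow> real \<Rightarrow> (real \<Rightarrow> 'a::euclidean_space) \<Rightarrow> real" where
  "Linf_norm a b u = real_of_ereal (esssup (lebesgue_on {a..b}) (\<lambda>t. ereal (norm (u t))))"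

text \<open>\<open>W11_deriv a b x v\<close>: on \<open>[a,b]\<close>, \<open>x\<close> is the absolutely continuous representative of an
  element of \<open>W\<^sup>1\<^sup>,\<^sup>1\<close>, with derivative \<open>v\<close>. The function \<open>v\<close> is determined up to a null set, so that
  quantifying it existentially next to an almost-everywhere statement is unambiguous.\<close>

definition W11_deriv ::
  "real \<Rightarrow> real \<Rightarrow> (real \<Rightarrow> 'a::euclidean_space) \<Rightarrow> (real \<Rightarrow> 'a) \<Rightarrow> bool" where
  "W11_deriv a b x v \<longleftrightarrow>
     v \<in> L1 a b \<and> (\<forall>t\<in>{a..b}. x t = x a + (LINT s|lebesgue_on {a..t}. v s))"

definition W11 :: "real \<Rightarrow> real \<Rightarrow> (real \<Rightarrow> 'a::euclidean_space) set" where
  "W11 a b = {x. \<exists>v. W11_deriv a b x v}"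

text \<open>Weak convergence is tested against the dual spaces: \<open>L\<^sup>\<infinity>\<close> for \<open>L\<^sup>1\<close>, \<open>L\<^sup>2\<close> for \<open>L\<^sup>2\<close>. Weak
  convergence in \<open>W\<^sup>1\<^sup>,\<^sup>1\<close> is weak \<open>L\<^sup>1\<close>-convergence of the functions and of their derivatives.\<close>

definition weak_L1 ::
  "real \<Rightarrow> real \<Rightarrow> (nat \<Rightarrow> real \<Rightarrow> 'a::euclidean_space) \<Rightarrow> (real \<Rightarrow> 'a) \<Rightarrow> bool" where
  "weak_L1 a b us u \<longleftrightarrow>
     (\<forall>w\<in>Linf a b. (\<lambda>k. LINT t|lebesgue_on {a..b}. w t \<bullet> us k t)
                     \<longlonglongrightarrow> (LINT t|lebesgue_on {a..b}. w t \<bullet> u t))"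

definition weak_L2 ::
  "real \<Rightarrow> real \<Rightarrow> (nat \<Rightarrow> real \<Rightarrow> 'a::euclidean_space) \<Rightarrow> (real \<Rightarrow> 'a) \<Rightarrow> bool" where
  "weak_L2 a b us u \<longleftrightarrow>
     (\<forall>w\<in>L2 a b. (\<lambda>k. LINT t|lebesgue_on {a..b}. w t \<bullet> us k t)
                     \<longlonglongrightarrow> (LINT t|lebesgue_on {a..b}. w t \<bullet> u t))"

definition weak_W11 ::
  "real \<Rightarrow> real \<Rightarrow> (nat \<Rightarrow> real \<Rightarrow> 'a::euclidean_space) \<Rightarrow> (real \<Rightarrow> 'a) \<Rightarrow> bool" where
  "weak_W11 a b xs x \<longleftrightarrow>
     (\<exists>vs v. (\<forall>k. W11_deriv a b (xs k) (vs k)) \<and> W11_deriv a b x v \<and>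
             weak_L1 a b xs x \<and> weak_L1 a b vs v)"

definition strong_L1 ::
  "real \<Rightarrow> real \<Rightarrow> (nat \<Rightarrow> real \<Rightarrow> 'a::euclidean_space) \<Rightarrow> (real \<Rightarrow> 'a) \<Rightarrow> bool" where
  "strong_L1 a b us u \<longleftrightarrow>
     (\<lambda>k. LINT t|lebesgue_on {a..b}. norm (us k t - u t)) \<longlonglongrightarrow> 0"

section \<open>The optimal control problem\<close>

record ('n::finite, 'm::finite, 'b::finite, 'g::finite) ocp =
  t_ini :: real
  t_fin :: real
  cost :: "(real^'n) \<times> (real^'n) \<Rightarrow> real"
  dyn :: "real \<Rightarrow> real^'n \<Rightarrow> real^'m \<Rightarrow> real^'n"
  eqc :: "real \<Rightarrow> real^'n \<Rightarrow> real^'m \<Rightarrow> real^'b"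
  ineqc :: "real \<Rightarrow> real^'n \<Rightarrow> real^'m \<Rightarrow> real^'g"
  ctrl :: "real \<Rightarrow> (real^'m) set"
  endpts :: "((real^'n) \<times> (real^'n)) set"

abbreviation ival :: "('n::finite, 'm::finite, 'b::finite, 'g::finite) ocp \<Rightarrow> real measure" where
  "ival P \<equiv> lebesgue_on {t_ini P..t_fin P}"

definition ocp_data :: "('n::finite, 'm::finite, 'b::finite, 'g::finite) ocp \<Rightarrow> bool" where
  "ocp_data P \<longleftrightarrow> t_ini P < t_fin P \<and> (\<forall>t\<in>{t_ini P..t_fin P}. ctrl P t \<noteq> {})"

definition process ::
  "('n::finite, 'm::finite, 'b::finite, 'g::finite) ocp
     \<Rightarrow> (real \<Rightarrow> real^'n) \<Rightarrow> (real \<Rightarrow> real^'m) \<Rightarrow> bool" where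
  "process P x u \<longleftrightarrow>
     u \<in> L1 (t_ini P) (t_fin P) \<and>
     (\<exists>v. W11_deriv (t_ini P) (t_fin P) x v \<and> (AE t in ival P. v t = dyn P t (x t) (u t)))"

definition feasible ::
  "('n::finite, 'm::finite, 'b::finite, 'g::finite) ocp
     \<Rightarrow> (real \<Rightarrow> real^'n) \<Rightarrow> (real \<Rightarrow> real^'m) \<Rightarrow> bool" where
  "feasible P x u \<longleftrightarrow>
     process P x u \<and>
     (AE t in ival P. eqc P t (x t) (u t) = 0 \<and> (\<forall>j. ineqc P t (x t) (u t) $ j \<le> 0) \<and>
                      u t \<in> ctrl P t) \<and>
     (x (t_ini P), x (t_fin P)) \<in> endpts P"

definition Ham ::
  "('n::finite, 'm::finite, 'b::finite, 'g::finite) ocp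
     \<Rightarrow> real \<Rightarrow> real^'n \<Rightarrow> real^'n \<Rightarrow> real^'b \<Rightarrow> real^'g \<Rightarrow> real^'m \<Rightarrow> real" where
  "Ham P t x p q r u = p \<bullet> dyn P t x u + q \<bullet> eqc P t x u + r \<bullet> ineqc P t x u"

definition subdiff_Ham ::
  "('n::finite, 'm::finite, 'b::finite, 'g::finite) ocp
     \<Rightarrow> real \<Rightarrow> real^'n \<Rightarrow> real^'n \<Rightarrow> real^'b \<Rightarrow> real^'g \<Rightarrow> real^'m \<Rightarrow> ((real^'n) \<times> (real^'m)) set" where
  "subdiff_Ham P t x p q r u = limiting_subdiff (\<lambda>(y, z). Ham P t y p q r z) (x, u)"

definition ineq_minus ::
  "('n::finite, 'm::finite, 'b::finite, 'g::finite) ocp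
     \<Rightarrow> 'g \<Rightarrow> real \<Rightarrow> real^'n \<Rightarrow> real^'m \<Rightarrow> real" where
  "ineq_minus P j t x u = max (- (ineqc P t x u $ j)) 0"

definition Omega_t ::
  "(real \<Rightarrow> real^'n::finite) \<Rightarrow> (real \<Rightarrow> real^'m::finite) \<Rightarrow> real \<Rightarrow> real
     \<Rightarrow> ((real^'n) \<times> (real^'m)) set" where
  "Omega_t xbar ubar \<delta> t = {w. norm (w - (xbar t, ubar t)) \<le> \<delta>}"

text \<open>A Lipschitz or differentiability condition on the closed ball \<open>Omega_t\<close> controls the limiting
  subdifferential of the Hamiltonian only at interior points: at boundary points it also sees
  the unconstrained values outside the ball.\<close>

definition Omega ::
  "('n::finite, 'm::finite, 'b::finite, 'g::finite) ocp
     \<Rightarrow> (real \<Rightarrow> real^'n) \<Rightarrow> (real \<Rightarrow> real^'m) \<Rightarrow> real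
     \<Rightarrow> ((real \<Rightarrow> real^'n) \<times> (real \<Rightarrow> real^'m)) set" where
  "Omega P xbar ubar \<delta> =
     {(x, u). x \<in> W11 (t_ini P) (t_fin P) \<and> u \<in> L1 (t_ini P) (t_fin P) \<and>
              (AE t in ival P. (x t, u t) \<in> Omega_t xbar ubar \<delta> t)}"

definition U_loc ::
  "('n::finite, 'm::finite, 'b::finite, 'g::finite) ocp
     \<Rightarrow> (real \<Rightarrow> real^'m) \<Rightarrow> real \<Rightarrow> real \<Rightarrow> (real^'m) set" where
  "U_loc P ubar \<delta> t = cball (ubar t) \<delta> \<inter> ctrl P t"

definition Ccone :: "('n::finite, 'm::finite, 'b::finite, 'g::finite) ocp \<Rightarrow> (real \<Rightarrow> real) set" where
  "Ccone P = {\<phi> \<in> L1 (t_ini P) (t_fin P). AE t in ival P. \<phi> t \<le> 0}"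

section \<open>Hypotheses\<close>

definition H1 ::
  "('n::finite, 'm::finite, 'b::finite, 'g::finite) ocp
     \<Rightarrow> (real \<Rightarrow> real^'n) \<Rightarrow> (real \<Rightarrow> real^'m) \<Rightarrow> real \<Rightarrow> bool" where
  "H1 P xbar ubar \<delta> \<longleftrightarrow>
     (\<forall>x u. (\<lambda>t. dyn P t x u) \<in> borel_measurable (ival P)) \<and>
     (\<exists>kf. integrable (ival P) kf \<and>
       (AE t in ival P. \<forall>x u x' u'.
          (x, u) \<in> Omega_t xbar ubar \<delta> t \<longrightarrow> (x', u') \<in> Omega_t xbar ubar \<delta> t \<longrightarrow>
          norm (dyn P t x u - dyn P t x' u') \<le> kf t * norm ((x, u) - (x', u'))))"

definition H2 ::
  "('n::finite, 'm::finite, 'b::finite, 'g::finite) ocp \<Rightarrow> (real \<Rightarrow> real^'m) \<Rightarrow> real \<Rightarrow> bool" where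
  "H2 P ubar \<delta> \<longleftrightarrow>
     {(t, v). t \<in> {t_ini P..t_fin P} \<and> v \<in> ctrl P t} \<in> sets borel \<and>
     (AE t in ival P. closed (U_loc P ubar \<delta> t) \<and> convex (U_loc P ubar \<delta> t))"

definition H3 ::
  "('n::finite, 'm::finite, 'b::finite, 'g::finite) ocp \<Rightarrow> (real \<Rightarrow> real^'n) \<Rightarrow> bool" where
  "H3 P xbar \<longleftrightarrow>
     closed (endpts P) \<and>
     (\<exists>\<rho>>0. \<exists>K. K-lipschitz_on (ball (xbar (t_ini P), xbar (t_fin P)) \<rho>) (cost P))"

definition H4 :: "('n::finite, 'm::finite, 'b::finite, 'g::finite) ocp \<Rightarrow> bool" where
  "H4 P \<longleftrightarrow> (\<forall>x u. (\<lambda>t. (eqc P t x u, ineqc P t x u)) \<in> borel_measurable (ival P))"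

definition H5 ::
  "('n::finite, 'm::finite, 'b::finite, 'g::finite) ocp
     \<Rightarrow> (real \<Rightarrow> real^'n) \<Rightarrow> (real \<Rightarrow> real^'m) \<Rightarrow> real \<Rightarrow> bool" where
  "H5 P xbar ubar \<delta> \<longleftrightarrow>
     (AE t in ival P.
        (\<forall>i. C1_on (Omega_t xbar ubar \<delta> t) (\<lambda>(x, u). eqc P t x u $ i)) \<and>
        (\<forall>j. C1_on (Omega_t xbar ubar \<delta> t) (\<lambda>(x, u). ineqc P t x u $ j))) \<and>
     (\<exists>kbg. integrable (ival P) kbg \<and>
       (AE t in ival P. \<forall>x u x' u'.
          (x, u) \<in> Omega_t xbar ubar \<delta> t \<longrightarrow> (x', u') \<in> Omega_t xbar ubar \<delta> t \<longrightarrow>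
          norm ((eqc P t x u, ineqc P t x u) - (eqc P t x' u', ineqc P t x' u'))
            \<le> kbg t * norm ((x, u) - (x', u'))))"

definition H6 ::
  "('n::finite, 'm::finite, 'b::finite, 'g::finite) ocp
     \<Rightarrow> (real \<Rightarrow> real^'n) \<Rightarrow> (real \<Rightarrow> real^'m) \<Rightarrow> bool" where
  "H6 P xbar ubar \<longleftrightarrow>
     integrable (ival P) (\<lambda>t. norm (dyn P t (xbar t) (ubar t))) \<and>
     integrable (ival P) (\<lambda>t. norm (eqc P t (xbar t) (ubar t), ineqc P t (xbar t) (ubar t))) \<and>
     ubar \<in> Linf (t_ini P) (t_fin P)"

definition Dset ::
  "('n::finite, 'm::finite, 'b::finite, 'g::finite) ocp
     \<Rightarrow> (real \<Rightarrow> real^'n) \<Rightarrow> (real \<Rightarrow> real^'m) \<Rightarrow> real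
     \<Rightarrow> ((real \<Rightarrow> real^'n) \<times> (real \<Rightarrow> real^'m)) set" where
  "Dset P xbar ubar \<delta> =
     {(x, v). x \<in> W11 (t_ini P) (t_fin P) \<and> v \<in> L2 (t_ini P) (t_fin P) \<and>
              (AE t in ival P. (x t, v t) \<in> Omega_t xbar ubar \<delta> t)}"

definition Fmap ::
  "('n::finite, 'm::finite, 'b::finite, 'g::finite) ocp
     \<Rightarrow> (real \<Rightarrow> real^'n) \<Rightarrow> (real \<Rightarrow> real^'m) \<Rightarrow> real \<Rightarrow> real^'n" where
  "Fmap P x v t = (LINT s|lebesgue_on {t_ini P..t}. dyn P s (x s) (v s))"

definition penalty ::
  "('n::finite, 'm::finite, 'b::finite, 'g::finite) ocp
     \<Rightarrow> (real \<Rightarrow> real^'n) \<Rightarrow> (real \<Rightarrow> real^'m) \<Rightarrow> real \<Rightarrow> real" where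
  "penalty P x v t =
     (\<Sum>i\<in>UNIV. (eqc P t (x t) (v t) $ i)\<^sup>2) + (\<Sum>j\<in>UNIV. (max (ineqc P t (x t) (v t) $ j) 0)\<^sup>2)"

definition Pmap ::
  "('n::finite, 'm::finite, 'b::finite, 'g::finite) ocp
     \<Rightarrow> (real \<Rightarrow> real^'n) \<Rightarrow> (real \<Rightarrow> real^'m) \<Rightarrow> real" where
  "Pmap P x v = (LINT t|ival P. penalty P x v t)"

text \<open>Complete continuity (of a nonlinear map): weakly convergent sequences of \<open>W\<^sup>1\<^sup>,\<^sup>1 \<times> L\<^sup>2\<close> with
  terms and limit in the domain are mapped to norm convergent ones. Integrability of the penalty
  expresses that the second functional is real valued; the Bochner integral alone would return
  the value 0 for an infinite integral.\<close>

definition H7 ::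
  "('n::finite, 'm::finite, 'b::finite, 'g::finite) ocp
     \<Rightarrow> (real \<Rightarrow> real^'n) \<Rightarrow> (real \<Rightarrow> real^'m) \<Rightarrow> real \<Rightarrow> bool" where
  "H7 P xbar ubar \<delta> \<longleftrightarrow>
     (\<forall>(x, v) \<in> Dset P xbar ubar \<delta>. integrable (ival P) (penalty P x v)) \<and>
     (\<forall>xs vs x v.
        (\<forall>k. (xs k, vs k) \<in> Dset P xbar ubar \<delta>) \<longrightarrow> (x, v) \<in> Dset P xbar ubar \<delta> \<longrightarrow>
        weak_W11 (t_ini P) (t_fin P) xs x \<longrightarrow> weak_L2 (t_ini P) (t_fin P) vs v \<longrightarrow>
        (\<lambda>k. Linf_norm (t_ini P) (t_fin P) (\<lambda>t. Fmap P (xs k) (vs k) t - Fmap P x v t)) \<longlonglongrightarrow> 0 \<and>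
        ereal (Pmap P x v) \<le> liminf (\<lambda>k. ereal (Pmap P (xs k) (vs k))))"

section \<open>Asymptotic extremals and regularity\<close>

definition AWMP_seq ::
  "('n::finite, 'm::finite, 'b::finite, 'g::finite) ocp
     \<Rightarrow> (real \<Rightarrow> real^'m) \<Rightarrow> real
     \<Rightarrow> (nat \<Rightarrow> real \<Rightarrow> real^'n) \<Rightarrow> (nat \<Rightarrow> real \<Rightarrow> real^'m) \<Rightarrow> (nat \<Rightarrow> real \<Rightarrow> real^'m)
     \<Rightarrow> (nat \<Rightarrow> real \<Rightarrow> real^'n) \<Rightarrow> (nat \<Rightarrow> real \<Rightarrow> real^'b) \<Rightarrow> (nat \<Rightarrow> real \<Rightarrow> real^'g)
     \<Rightarrow> (nat \<Rightarrow> real)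
     \<Rightarrow> (nat \<Rightarrow> real \<Rightarrow> real^'n) \<Rightarrow> (nat \<Rightarrow> real \<Rightarrow> real^'m) \<Rightarrow> (nat \<Rightarrow> 'g \<Rightarrow> real \<Rightarrow> real)
     \<Rightarrow> (nat \<Rightarrow> real^'n) \<Rightarrow> (nat \<Rightarrow> real^'n) \<Rightarrow> bool" where
  "AWMP_seq P ubar \<delta> x u \<zeta> p q r lam eps eta \<theta> vt nu \<longleftrightarrow>
     \<delta> > 0 \<and>
     (\<forall>k. x k \<in> W11 (t_ini P) (t_fin P) \<and> u k \<in> L1 (t_ini P) (t_fin P) \<and>
          \<zeta> k \<in> L1 (t_ini P) (t_fin P) \<and> p k \<in> W11 (t_ini P) (t_fin P) \<and>
          q k \<in> L1 (t_ini P) (t_fin P) \<and> r k \<in> L1 (t_ini P) (t_fin P) \<and> lam k \<ge> 0 \<and>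
          eps k \<in> L1 (t_ini P) (t_fin P) \<and> eta k \<in> L1 (t_ini P) (t_fin P) \<and>
          (\<forall>j. \<theta> k j \<in> Ccone P)) \<and>
     (\<forall>k. lam k + Linf_norm (t_ini P) (t_fin P) (p k) = 1) \<and>
     (\<forall>k. \<exists>dp. W11_deriv (t_ini P) (t_fin P) (p k) dp \<and>
          (AE t in ival P. (- dp t, \<zeta> k t) - (eps k t, eta k t)
             \<in> convex hull (subdiff_Ham P t (x k t) (p k t) (q k t) (r k t) (u k t)))) \<and>
     (\<forall>k. AE t in ival P. \<zeta> k t \<in> limiting_normal (U_loc P ubar \<delta> t) (u k t)) \<and>
     (\<forall>k. AE t in ival P. \<forall>j.
          r k t $ j * ineq_minus P j t (x k t) (u k t) = \<theta> k j t \<and> r k t $ j \<le> 0) \<and>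
     (\<forall>k. \<exists>s \<in> limiting_subdiff (cost P) (x k (t_ini P), x k (t_fin P)).
          \<exists>n \<in> limiting_normal (endpts P) (x k (t_ini P), x k (t_fin P)).
            (p k (t_ini P), - p k (t_fin P)) - (vt k, nu k) = lam k *\<^sub>R s + n) \<and>
     weak_L1 (t_ini P) (t_fin P) (\<lambda>k t. (eps k t, eta k t)) (\<lambda>t. (0, 0)) \<and>
     (\<forall>j. AE t in ival P. (\<lambda>k. \<theta> k j t) \<longlonglongrightarrow> 0) \<and>
     (\<lambda>k. (vt k, nu k)) \<longlonglongrightarrow> (0, 0)"

definition asymptotic_extremal ::
  "('n::finite, 'm::finite, 'b::finite, 'g::finite) ocp
     \<Rightarrow> (real \<Rightarrow> real^'n) \<Rightarrow> (real \<Rightarrow> real^'m) \<Rightarrow> bool" where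
  "asymptotic_extremal P xbar ubar \<longleftrightarrow>
     feasible P xbar ubar \<and>
     (\<exists>\<delta> x u \<zeta> p q r lam eps eta \<theta> vt nu.
        AWMP_seq P ubar \<delta> x u \<zeta> p q r lam eps eta \<theta> vt nu \<and>
        uniform_limit {t_ini P..t_fin P} x xbar sequentially \<and>
        strong_L1 (t_ini P) (t_fin P) u ubar)"

text \<open>\<open>M_bd P xbar ubar \<delta> kpsi x u \<theta>\<close> is the set \<open>\<M>\<^sub>\<delta>(x,u,\<theta>)\<close> with the bounding function
  \<open>k\<^sub>\<psi>\<close> made explicit.\<close>

definition M_bd ::
  "('n::finite, 'm::finite, 'b::finite, 'g::finite) ocp
     \<Rightarrow> (real \<Rightarrow> real^'n) \<Rightarrow> (real \<Rightarrow> real^'m) \<Rightarrow> real \<Rightarrow> (real \<Rightarrow> real)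
     \<Rightarrow> (real \<Rightarrow> real^'n) \<Rightarrow> (real \<Rightarrow> real^'m) \<Rightarrow> ('g \<Rightarrow> real \<Rightarrow> real)
     \<Rightarrow> ((real \<Rightarrow> real^'n) \<times> (real \<Rightarrow> real^'m) \<times> (real^'n) \<times> (real^'n)) set" where
  "M_bd P xbar ubar \<delta> kpsi x u \<theta> =
     {(\<phi>, \<psi>, \<gamma>, \<xi>).
        (x, u) \<in> Omega P xbar ubar \<delta> \<and> (\<forall>j. \<theta> j \<in> Ccone P) \<and>
        \<phi> \<in> L1 (t_ini P) (t_fin P) \<and> \<psi> \<in> L1 (t_ini P) (t_fin P) \<and>
        (\<exists>q r \<zeta>. q \<in> L1 (t_ini P) (t_fin P) \<and> r \<in> L1 (t_ini P) (t_fin P) \<and>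
           \<zeta> \<in> L1 (t_ini P) (t_fin P) \<and>
           (AE t in ival P.
              (\<phi> t, \<psi> t) =
                (\<Sum>i\<in>UNIV. q t $ i *\<^sub>R grad (\<lambda>(y, z). eqc P t y z $ i) (x t, u t)) +
                (\<Sum>j\<in>UNIV. r t $ j *\<^sub>R grad (\<lambda>(y, z). ineqc P t y z $ j) (x t, u t)) +
                (0, - \<zeta> t) \<and>
              \<zeta> t \<in> limiting_normal (U_loc P ubar \<delta> t) (u t) \<and>
              (\<forall>j. r t $ j * ineq_minus P j t (x t) (u t) = \<theta> j t \<and> r t $ j \<le> 0) \<and>
              norm (\<psi> t) \<le> kpsi t)) \<and>
        (\<gamma>, \<xi>) \<in> limiting_normal (endpts P) (x (t_ini P), x (t_fin P))}"

definition M_set ::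
  "('n::finite, 'm::finite, 'b::finite, 'g::finite) ocp
     \<Rightarrow> (real \<Rightarrow> real^'n) \<Rightarrow> (real \<Rightarrow> real^'m) \<Rightarrow> real
     \<Rightarrow> (real \<Rightarrow> real^'n) \<Rightarrow> (real \<Rightarrow> real^'m) \<Rightarrow> ('g \<Rightarrow> real \<Rightarrow> real)
     \<Rightarrow> ((real \<Rightarrow> real^'n) \<times> (real \<Rightarrow> real^'m) \<times> (real^'n) \<times> (real^'n)) set" where
  "M_set P xbar ubar \<delta> x u \<theta> =
     (\<Union>kpsi \<in> L1 (t_ini P) (t_fin P). M_bd P xbar ubar \<delta> kpsi x u \<theta>)"

text \<open>The bound \<open>k\<^sub>\<psi>\<close> is chosen before the sequence index: it depends only on the reference
  process and \<open>\<delta>\<close>, so one function serves all terms of a sequence.\<close>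

definition wlimsup_M ::
  "('n::finite, 'm::finite, 'b::finite, 'g::finite) ocp
     \<Rightarrow> (real \<Rightarrow> real^'n) \<Rightarrow> (real \<Rightarrow> real^'m) \<Rightarrow> real
     \<Rightarrow> ((real \<Rightarrow> real^'n) \<times> (real \<Rightarrow> real^'m) \<times> (real^'n) \<times> (real^'n)) set" where
  "wlimsup_M P xbar ubar \<delta> =
     {(\<phi>, \<psi>, \<gamma>, \<xi>).
        \<phi> \<in> L1 (t_ini P) (t_fin P) \<and> \<psi> \<in> L1 (t_ini P) (t_fin P) \<and>
        (\<exists>kpsi \<in> L1 (t_ini P) (t_fin P). \<exists>x u \<theta> \<phi>s \<psi>s \<gamma>s \<xi>s.
           (\<forall>k. x k \<in> W11 (t_ini P) (t_fin P) \<and> u k \<in> L1 (t_ini P) (t_fin P) \<and>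
                (\<forall>j. \<theta> k j \<in> Ccone P) \<and>
                (\<phi>s k, \<psi>s k, \<gamma>s k, \<xi>s k) \<in> M_bd P xbar ubar \<delta> kpsi (x k) (u k) (\<theta> k)) \<and>
           uniform_limit {t_ini P..t_fin P} x xbar sequentially \<and>
           strong_L1 (t_ini P) (t_fin P) u ubar \<and>
           (\<forall>j. AE t in ival P. (\<lambda>k. \<theta> k j t) \<longlonglongrightarrow> 0) \<and>
           weak_L1 (t_ini P) (t_fin P) (\<lambda>k t. (\<phi>s k t, \<psi>s k t)) (\<lambda>t. (\<phi> t, \<psi> t)) \<and>
           (\<lambda>k. (\<gamma>s k, \<xi>s k)) \<longlonglongrightarrow> (\<gamma>, \<xi>))}"

definition AWMP_regular_with ::
  "('n::finite, 'm::finite, 'b::finite, 'g::finite) ocp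
     \<Rightarrow> (real \<Rightarrow> real^'n) \<Rightarrow> (real \<Rightarrow> real^'m) \<Rightarrow> real \<Rightarrow> bool" where
  "AWMP_regular_with P xbar ubar \<delta> \<longleftrightarrow>
     feasible P xbar ubar \<and> wlimsup_M P xbar ubar \<delta> \<subseteq> M_set P xbar ubar \<delta> xbar ubar (\<lambda>j t. 0)"

end

theory Submission
  imports Defs "HOL-Complex_Analysis.Great_Picard"
begin

text \<open>Along the given sequence the multipliers \<open>q k\<close>, \<open>r k\<close> and \<open>\<zeta> k\<close> have no bounds of their own, and no limit of
them is taken. What is bounded are two combinations of them. Near the reference process the constraints are continuously
differentiable, so the subdifferential of the Hamiltonian is the subdifferential of \<open>p \<bullet> dyn\<close> translated by
the gradient of the constraint terms (\<open>subdiff_Ham_eq_translate\<close>). Write \<open>(\<phi> k, \<psi> k)\<close> for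
that gradient minus \<open>(0, \<zeta> k)\<close>. The adjoint inclusion then says that
\<open>\<alpha> k = (- dp k - eps k - \<phi> k, - eta k - \<psi> k)\<close> lies in the convex hull of the subdifferential of
\<open>p k \<bullet> dyn\<close> at \<open>(x k, u k)\<close>, and its norm is bounded by the Lipschitz function of the dynamics. Together
with the assumed bounds this dominates \<open>dp k\<close>, \<open>\<phi> k\<close> and \<open>\<psi> k\<close> by one integrable function
(\<open>awmp_term_decomposition\<close>).

Dominated sequences are weakly relatively compact in \<open>L\<^sup>1\<close>, with uniformly convergent primitives
(\<open>dominated_weakly_sequentially_compact\<close>). So along a subsequence \<open>p k\<close> converges uniformly to some \<open>pp\<close>, and
\<open>\<phi> k\<close>, \<open>\<psi> k\<close> converge weakly. The endpoint normals converge as well, because all other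
terms of the transversality condition do. The limit is an element of the weak upper limit of the sets
\<open>M_bd\<close>, and regularity supplies new multipliers \<open>qq\<close>, \<open>rr\<close>, \<open>z\<close> at the reference process that represent the
same limit of \<open>\<phi> k\<close> and \<open>\<psi> k\<close>.

It remains to identify the weak limit of \<open>\<alpha> k\<close>. At almost every time it lies in the closed convex hull of
each tail of the sequence (\<open>weak_L1_AE_in_closed_hull\<close>), and the sets from which the terms are taken
converge, in the sense of a closed graph, to the subdifferential of \<open>pp \<bullet> dyn\<close> at the reference process
(\<open>hull_subdiff_limit\<close>). Translating back by the gradient with the new multipliers gives the adjoint inclusion.
Uniform convergence of \<open>p k\<close> preserves the normalization of the multipliers, so the limit is not trivial.\<close>

section \<open>Limiting subgradients and normals\<close>

lemma limiting_subdiffI_eventually: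
  assumes ev: "\<forall>\<^sub>F i in sequentially. vs i \<in> frechet_subdiff h (xs i)"
    and xs: "xs \<longlonglongrightarrow> x" and hx: "(\<lambda>i. h (xs i)) \<longlonglongrightarrow> h x" and vs: "vs \<longlonglongrightarrow> v"
  shows "v \<in> limiting_subdiff h x"
proof -
  obtain N where N: "\<And>i. i \<ge> N \<Longrightarrow> vs i \<in> frechet_subdiff h (xs i)"
    using ev by (auto simp: eventually_sequentially)
  have "\<forall>i. vs (i + N) \<in> frechet_subdiff h (xs (i + N))" using N by simp
  moreover have "(\<lambda>i. xs (i + N)) \<longlonglongrightarrow> x" "(\<lambda>i. h (xs (i + N))) \<longlonglongrightarrow> h x" "(\<lambda>i. vs (i + N)) \<longlonglongrightarrow> v"
    using LIMSEQ_ignore_initial_segment[OF xs] LIMSEQ_ignore_initial_segment[OF hx]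
      LIMSEQ_ignore_initial_segment[OF vs] by auto
  ultimately show ?thesis unfolding limiting_subdiff_def
    by (intro CollectI exI[of _ "\<lambda>i. xs (i + N)"] exI[of _ "\<lambda>i. vs (i + N)"]) simp
qed

lemma GDERIV_eps:
  assumes "GDERIV g z :> D" "e > 0"
  obtains d where "d > 0" "\<And>y. norm (y - z) < d \<Longrightarrow> \<bar>g y - g z - D \<bullet> (y - z)\<bar> \<le> e * norm (y - z)"
proof -
  obtain d where "d > 0" "\<And>y. norm (y - z) < d \<Longrightarrow> norm (g y - g z - (y - z) \<bullet> D) \<le> e * norm (y - z)"
    using assms unfolding gderiv_def has_derivative_at_alt by blast
  then show thesis by (intro that[of d]) (auto simp: inner_commute)
qed

text \<open>A smooth function \<open>g\<close> that touches \<open>h\<close> from below transfers its first-order expansion to \<open>h\<close>. This is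
how Frechet subgradients are produced from minimum points.\<close>

lemma frechet_subdiff_touching:
  assumes r: "r > 0" and min: "\<And>y. y \<in> ball z r \<Longrightarrow> h z - g z \<le> h y - g y"
    and g: "GDERIV g z :> D"
  shows "D \<in> frechet_subdiff h z"
  unfolding frechet_subdiff_def
proof (clarify)
  fix e :: real assume "e > 0"
  then obtain d where d: "d > 0" "\<And>y. norm (y - z) < d \<Longrightarrow> \<bar>g y - g z - D \<bullet> (y - z)\<bar> \<le> e * norm (y - z)"
    using GDERIV_eps[OF g] by metis
  show "\<exists>d>0. \<forall>y. norm (y - z) < d \<longrightarrow> h z + D \<bullet> (y - z) - e * norm (y - z) \<le> h y"
  proof (intro exI[of _ "min r d"] conjI allI impI)
    fix y assume y: "norm (y - z) < min r d"
    then have "h z - g z \<le> h y - g y" by (intro min) (auto simp: dist_norm norm_minus_commute)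
    with d(2)[of y] y show "h z + D \<bullet> (y - z) - e * norm (y - z) \<le> h y" by linarith
  qed (use r d in auto)
qed

text \<open>The smoothed norm lies above the norm and its gradient has norm at most 1, so it can replace
a cone \<open>norm (z - y)\<close> in an argument that needs a differentiable function.\<close>

lemma GDERIV_smoothed_norm:
  fixes y z :: "'a::euclidean_space"
  assumes "s > 0"
  shows "GDERIV (\<lambda>z. sqrt ((z - y) \<bullet> (z - y) + s\<^sup>2)) z :> (z - y) /\<^sub>R sqrt ((z - y) \<bullet> (z - y) + s\<^sup>2)"
proof -
  have pos: "(z - y) \<bullet> (z - y) + s\<^sup>2 > 0" using assms
    by (simp add: add_nonneg_pos)
  have "((\<lambda>z. (z - y) \<bullet> (z - y) + s\<^sup>2) has_derivative (\<lambda>h. 2 * (h \<bullet> (z - y)))) (at z)"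
  proof -
    have "((\<lambda>z. z - y) has_derivative (\<lambda>h. h)) (at z)"
      using has_derivative_diff[OF has_derivative_ident has_derivative_const[of y]] by simp
    from has_derivative_add[OF has_derivative_inner[OF this this] has_derivative_const[of "s\<^sup>2"]]
    show ?thesis by (rule has_derivative_eq_rhs) (simp add: fun_eq_iff inner_commute)
  qed
  from DERIV_compose_FDERIV[OF DERIV_real_sqrt[OF pos] this] show ?thesis
    unfolding gderiv_def
    by (rule has_derivative_eq_rhs) (simp add: fun_eq_iff)
qed

text \<open>A substitute for a fuzzy sum rule. If \<open>h' - h\<close> is \<open>L\<close>-Lipschitz around \<open>y\<close>, then \<open>h'\<close> lies near \<open>y\<close> above the
affine function with slope \<open>v\<close> minus a cone of slope slightly larger than \<open>L\<close>. Adding a smoothed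
cone of the still larger slope \<open>c\<close> to \<open>h'\<close> minus that affine function yields a function whose minimum over a small
ball is interior; there the smooth part touches \<open>h'\<close> from below, and its gradient differs
from \<open>v\<close> by a vector of norm at most \<open>c\<close>.\<close>

lemma frechet_subdiff_perturbed:
  fixes h h' :: "'a::euclidean_space \<Rightarrow> real"
  assumes v: "v \<in> frechet_subdiff h y" and L: "0 \<le> L" "L < c" and \<rho>: "\<rho> > 0"
    and cont: "continuous_on (cball y \<rho>) h'"
    and lip: "\<And>z. z \<in> cball y \<rho> \<Longrightarrow> \<bar>(h' z - h z) - (h' y - h y)\<bar> \<le> L * norm (z - y)"
  obtains z w where "z \<in> ball y \<rho>" "w \<in> frechet_subdiff h' z" "norm (w - v) \<le> c"
proof -
  define e where "e = (c - L) / 2"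
  have e: "e > 0" "c = L + 2 * e" using L by (auto simp: e_def field_simps)
  obtain d where d: "d > 0"
    "\<And>z. norm (z - y) < d \<Longrightarrow> h z \<ge> h y + v \<bullet> (z - y) - e * norm (z - y)"
    using v e unfolding frechet_subdiff_def by blast
  define r where "r = min \<rho> d / 2"
  have r: "0 < r" "r < \<rho>" "r < d" using \<rho> d by (auto simp: r_def)
  \<comment> \<open>The smoothing parameter is so small that \<open>\<Phi> y\<close> is less than every value of \<open>\<Phi>\<close> on the sphere of radius \<open>r\<close>.\<close>
  define s where "s = e * r / (2 * c)"
  have c: "c > 0" using L by simp
  have s: "s > 0" "c * s < e * r"
  proof -
    show "s > 0" using e(1) r c by (simp add: s_def)
    have "c * s = e * r / 2" using c by (simp add: s_def)
    then show "c * s < e * r" using mult_pos_pos[OF e(1) r(1)] by linarith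
  qed
  define S where "S z = sqrt ((z - y) \<bullet> (z - y) + s\<^sup>2)" for z
  define \<Phi> where "\<Phi> z = h' z - (v \<bullet> (z - y) - c * S z)" for z
  have "continuous_on (cball y r) \<Phi>"
    unfolding \<Phi>_def S_def using r by (intro continuous_intros continuous_on_subset[OF cont]) auto
  then obtain z where z: "z \<in> cball y r" "\<And>x. x \<in> cball y r \<Longrightarrow> \<Phi> z \<le> \<Phi> x"
    using continuous_attains_inf[OF compact_cball, of y r \<Phi>] r by auto
  have below: "h' x \<ge> h' y + v \<bullet> (x - y) - (L + e) * norm (x - y)" if "x \<in> cball y r" for x
  proof -
    have n: "norm (x - y) \<le> r" using that by (simp add: dist_norm norm_minus_commute)
    then have "h x \<ge> h y + v \<bullet> (x - y) - e * norm (x - y)" using d r by auto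
    moreover have "\<bar>(h' x - h x) - (h' y - h y)\<bar> \<le> L * norm (x - y)"
      using n r by (intro lip) (auto simp: dist_norm norm_minus_commute)
    ultimately show ?thesis by (simp add: algebra_simps)
  qed
  have S: "norm (x - y) \<le> S x" for x
    unfolding S_def norm_eq_sqrt_inner by simp
  have zin: "norm (z - y) < r"
  proof (rule ccontr)
    assume "\<not> norm (z - y) < r"
    then have zr: "norm (z - y) = r" using z by (simp add: dist_norm norm_minus_commute)
    have "\<Phi> z \<le> \<Phi> y" using z r by auto
    also have "\<Phi> y = h' y + c * s" using s by (simp add: \<Phi>_def S_def)
    also have "\<dots> < h' y + e * r" using s by simp
    finally have "h' z - v \<bullet> (z - y) + c * S z < h' y + e * r" by (simp add: \<Phi>_def)
    moreover have "c * S z \<ge> c * r" using S[of z] c zr by simp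
    moreover have "h' z \<ge> h' y + v \<bullet> (z - y) - (L + e) * r" using below[OF z(1)] zr by simp
    ultimately show False using e by (simp add: algebra_simps)
  qed
  define w where "w = v - c *\<^sub>R ((z - y) /\<^sub>R S z)"
  have "GDERIV (\<lambda>z. v \<bullet> (z - y) - c * S z) z :> w"
  proof -
    have "GDERIV (\<lambda>z. v \<bullet> (z - y)) z :> v" unfolding gderiv_def
      by (rule derivative_eq_intros refl | simp add: inner_commute)+
    moreover have "GDERIV (\<lambda>z. c * S z) z :> c *\<^sub>R ((z - y) /\<^sub>R S z) + S z *\<^sub>R 0"
      unfolding S_def using GDERIV_mult[OF GDERIV_const[of c z] GDERIV_smoothed_norm[OF s(1), of y z]] 
      by (simp add: add.commute)
    ultimately show ?thesis unfolding w_def using GDERIV_diff by fastforce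
  qed
  then have "w \<in> frechet_subdiff h' z"
  proof (rule frechet_subdiff_touching[where r = "r - norm (z - y)", rotated 2])
    fix x assume "x \<in> ball z (r - norm (z - y))"
    then have "x \<in> cball y r"
      using dist_triangle[of y x z] by (auto simp: dist_norm norm_minus_commute)
    then show "h' z - (v \<bullet> (z - y) - c * S z) \<le> h' x - (v \<bullet> (x - y) - c * S x)"
      using z(2) unfolding \<Phi>_def by auto
  qed (use zin in auto)
  moreover have "norm (w - v) \<le> c"
  proof -
    have "S z > 0" using s by (simp add: S_def add_nonneg_pos)
    moreover have "norm (w - v) = c * (norm (z - y) / S z)"
      using c \<open>S z > 0\<close> by (simp add: w_def divide_inverse mult.commute)
    ultimately show ?thesis using S[of z] c by (simp add: divide_le_eq)
  qed
  moreover have "z \<in> ball y \<rho>" using zin r by (simp add: dist_norm norm_minus_commute)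
  ultimately show thesis by (rule that[rotated])
qed

lemma limiting_subdiff_approx:
  assumes "v \<in> limiting_subdiff h y" "e > 0"
  obtains y' v' where "v' \<in> frechet_subdiff h y'" "norm (y' - y) < e" "norm (v' - v) < e"
proof -
  obtain xs vs where *: "\<And>i::nat. vs i \<in> frechet_subdiff h (xs i)" "xs \<longlonglongrightarrow> y" "vs \<longlonglongrightarrow> v"
    using assms unfolding limiting_subdiff_def by blast
  have "\<forall>\<^sub>F i in sequentially. norm (xs i - y) < e" "\<forall>\<^sub>F i in sequentially. norm (vs i - v) < e"
    using tendstoD[OF *(2) \<open>e > 0\<close>] tendstoD[OF *(3) \<open>e > 0\<close>] by (auto simp: dist_norm)
  then have "\<forall>\<^sub>F i in sequentially. norm (xs i - y) < e \<and> norm (vs i - v) < e"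
    by (rule eventually_conj)
  then obtain i where "norm (xs i - y) < e" "norm (vs i - v) < e"
    using eventually_happens'[OF sequentially_bot] by blast
  then show thesis using *(1) that by blast
qed

text \<open>The limiting subdifferential is closed not only in the base point but also in the function, when the Lipschitz
constants \<open>L k\<close> of the differences tend to 0. A limiting subgradient of \<open>hs k\<close> is first replaced by a
Frechet subgradient nearby, and that one by a Frechet subgradient of \<open>h\<close> at a distance of order \<open>L k\<close>.\<close>

lemma limiting_subdiff_closed_graph:
  fixes h :: "'a::euclidean_space \<Rightarrow> real"
  assumes v: "\<And>k. vs k \<in> limiting_subdiff (hs k) (ys k)"
    and ys: "ys \<longlonglongrightarrow> y" and vs: "vs \<longlonglongrightarrow> v"
    and \<rho>: "\<rho> > 0" and cont: "continuous_on (ball y \<rho>) h"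
    and lip: "\<And>k z z'. z \<in> ball y \<rho> \<Longrightarrow> z' \<in> ball y \<rho> \<Longrightarrow>
                \<bar>(h z - hs k z) - (h z' - hs k z')\<bar> \<le> L k * norm (z - z')"
    and L: "L \<longlonglongrightarrow> 0"
  shows "v \<in> limiting_subdiff h y"
proof -
  define \<epsilon> where "\<epsilon> k = inverse (real (Suc k))" for k
  have \<epsilon>: "\<epsilon> k > 0" for k by (simp add: \<epsilon>_def)
  have \<epsilon>0: "\<epsilon> \<longlonglongrightarrow> 0" unfolding \<epsilon>_def by (rule LIMSEQ_inverse_real_of_nat)
  \<comment> \<open>The terms whose base point is so close to \<open>y\<close> that both shifts by \<open>\<epsilon> k\<close> stay in the ball.\<close>
  define good where "good k \<longleftrightarrow> norm (ys k - y) + 2 * \<epsilon> k < \<rho>" for k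
  have "(\<lambda>k. norm (ys k - y) + 2 * \<epsilon> k) \<longlonglongrightarrow> norm (y - y) + 2 * 0"
    by (intro tendsto_intros ys \<epsilon>0)
  then have good: "\<forall>\<^sub>F k in sequentially. good k"
    unfolding good_def by (rule order_tendstoD) (use \<rho> in simp)
  have ex: "\<exists>z w. good k \<longrightarrow> w \<in> frechet_subdiff h z \<and> norm (z - ys k) \<le> 2 * \<epsilon> k \<and>
               norm (w - vs k) \<le> \<bar>L k\<bar> + 2 * \<epsilon> k" for k
  proof (cases "good k")
    case True
    obtain y' v' where y': "v' \<in> frechet_subdiff (hs k) y'" "norm (y' - ys k) < \<epsilon> k" "norm (v' - vs k) < \<epsilon> k"
      using limiting_subdiff_approx[OF v \<epsilon>] by metis
    have sub: "cball y' (\<epsilon> k) \<subseteq> ball y \<rho>"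
    proof
      fix x assume "x \<in> cball y' (\<epsilon> k)"
      then have "norm (x - y') \<le> \<epsilon> k" by (simp add: dist_norm norm_minus_commute)
      moreover have "norm (x - y) \<le> norm (x - y') + norm (y' - ys k) + norm (ys k - y)"
        by norm
      ultimately show "x \<in> ball y \<rho>" using y' True by (simp add: dist_norm norm_minus_commute good_def)
    qed
    obtain z w where zw: "z \<in> ball y' (\<epsilon> k)" "w \<in> frechet_subdiff h z" "norm (w - v') \<le> \<bar>L k\<bar> + \<epsilon> k"
    proof (rule frechet_subdiff_perturbed[OF y'(1), of "\<bar>L k\<bar>" "\<bar>L k\<bar> + \<epsilon> k" "\<epsilon> k" h])
      show "continuous_on (cball y' (\<epsilon> k)) h" by (rule continuous_on_subset[OF cont sub])
      fix z assume "z \<in> cball y' (\<epsilon> k)"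
      moreover have "y' \<in> cball y' (\<epsilon> k)" using \<epsilon>[of k] by simp
      ultimately have "z \<in> ball y \<rho>" "y' \<in> ball y \<rho>" using sub by blast+
      from lip[OF this, of k] show "\<bar>h z - hs k z - (h y' - hs k y')\<bar> \<le> \<bar>L k\<bar> * norm (z - y')"
        by (meson abs_ge_self mult_right_mono norm_ge_zero order_trans)
    qed (use \<epsilon>[of k] in auto)
    have "norm (z - ys k) \<le> norm (z - y') + norm (y' - ys k)" "norm (w - vs k) \<le> norm (w - v') + norm (v' - vs k)"
      by norm+
    then show ?thesis using zw y' by (intro exI[of _ z] exI[of _ w]) (auto simp: dist_norm norm_minus_commute)
  qed auto
  then obtain z w where zw: "\<And>k. good k \<Longrightarrow> w k \<in> frechet_subdiff h (z k)"
     "\<And>k. good k \<Longrightarrow> norm (z k - ys k) \<le> 2 * \<epsilon> k"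
     "\<And>k. good k \<Longrightarrow> norm (w k - vs k) \<le> \<bar>L k\<bar> + 2 * \<epsilon> k" by metis
  have "(\<lambda>k. z k - ys k) \<longlonglongrightarrow> 0"
    by (rule tendsto_0_le[where K = 2, OF \<epsilon>0]) (use good zw(2) \<epsilon> in \<open>auto elim!: eventually_mono simp: mult.commute less_imp_le\<close>)
  from tendsto_add[OF this ys] have z: "z \<longlonglongrightarrow> y" by simp
  have "(\<lambda>k. \<bar>L k\<bar> + 2 * \<epsilon> k) \<longlonglongrightarrow> \<bar>0\<bar> + 2 * 0" by (intro tendsto_intros L \<epsilon>0)
  then have "(\<lambda>k. \<bar>L k\<bar> + 2 * \<epsilon> k) \<longlonglongrightarrow> 0" by simp
  then have "(\<lambda>k. w k - vs k) \<longlonglongrightarrow> 0"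
    by (rule tendsto_0_le[where K = 1]) (use good zw(3) \<epsilon> in \<open>auto elim!: eventually_mono simp: less_imp_le\<close>)
  from tendsto_add[OF this vs] have w: "w \<longlonglongrightarrow> v" by simp
  have "isCont h y"
    using cont \<rho> by (simp add: continuous_on_eq_continuous_at)
  then have hz: "(\<lambda>k. h (z k)) \<longlonglongrightarrow> h y" using z by (rule isCont_tendsto_compose)
  show ?thesis
    by (rule limiting_subdiffI_eventually[OF _ z hz w]) (use good zw(1) in \<open>auto elim: eventually_mono\<close>)
qed

text \<open>The subgradient inequality is tested in the direction \<open>v\<close> itself, where its linear term is \<open>norm v\<close> times the step
length.\<close>

lemma norm_frechet_subdiff_le:
  assumes v: "v \<in> frechet_subdiff h y" and K: "K \<ge> 0" and \<rho>: "\<rho> > 0"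
    and lip: "\<And>z. z \<in> ball y \<rho> \<Longrightarrow> \<bar>h z - h y\<bar> \<le> K * norm (z - y)"
  shows "norm v \<le> K"
proof (rule field_le_epsilon)
  fix e :: real assume "e > 0"
  show "norm v \<le> K + e"
  proof (cases "v = 0")
    case False
    obtain d where d: "d > 0" "\<And>z. norm (z - y) < d \<Longrightarrow> h z \<ge> h y + v \<bullet> (z - y) - e * norm (z - y)"
      using v \<open>e > 0\<close> unfolding frechet_subdiff_def by blast
    \<comment> \<open>The step length that makes \<open>norm (z - y)\<close> half the smaller radius.\<close>
    define s where "s = min \<rho> d / (2 * norm v)"
    define z where "z = y + s *\<^sub>R v"
    have s: "s > 0" using d \<rho> False by (simp add: s_def)
    have nz1: "norm (z - y) = s * norm v" using s by (simp add: z_def)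
    moreover have "s * norm v = min \<rho> d / 2" using False by (simp add: s_def)
    ultimately have nz: "norm (z - y) = s * norm v" "norm (z - y) = min \<rho> d / 2" by simp_all
    have "min \<rho> d / 2 < \<rho>" "min \<rho> d / 2 < d" using d \<rho> by auto
    then have "\<bar>h z - h y\<bar> \<le> K * (s * norm v)" "h z \<ge> h y + v \<bullet> (z - y) - e * (s * norm v)"
      using lip[of z] d(2)[of z] nz by (auto simp: dist_norm norm_minus_commute)
    moreover have "v \<bullet> (z - y) = norm v * (s * norm v)"
      by (simp add: z_def power2_norm_eq_inner[symmetric] power2_eq_square)
    ultimately have "norm v * (s * norm v) \<le> (K + e) * (s * norm v)" by (simp add: algebra_simps)
    then show ?thesis using s False by simp
  qed (use K \<open>e > 0\<close> in simp)
qed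

lemma norm_limiting_subdiff_le:
  assumes v: "v \<in> limiting_subdiff h x" and S: "open S" "x \<in> S" and lip: "K-lipschitz_on S h"
  shows "norm v \<le> K"
proof -
  obtain xs vs where *: "\<And>i::nat. vs i \<in> frechet_subdiff h (xs i)" "xs \<longlonglongrightarrow> x" "vs \<longlonglongrightarrow> v"
    using v unfolding limiting_subdiff_def by blast
  have "\<forall>\<^sub>F i in sequentially. xs i \<in> S" using topological_tendstoD[OF *(2) S] .
  then have "\<forall>\<^sub>F i in sequentially. norm (vs i) \<le> K"
  proof (rule eventually_mono)
    fix i assume i: "xs i \<in> S"
    then obtain \<rho> where \<rho>: "\<rho> > 0" "ball (xs i) \<rho> \<subseteq> S" using openE[OF S(1)] by auto
    show "norm (vs i) \<le> K"
    proof (rule norm_frechet_subdiff_le[OF *(1) _ \<rho>(1)])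
      fix z assume "z \<in> ball (xs i) \<rho>"
      then have "z \<in> S" using \<rho> by blast
      then show "\<bar>h z - h (xs i)\<bar> \<le> K * norm (z - xs i)"
        using lipschitz_onD[OF lip _ i] by (simp add: dist_norm)
    qed (rule lipschitz_on_nonneg[OF lip])
  qed
  then show ?thesis using tendsto_upperbound[OF tendsto_norm[OF *(3)]] by simp
qed

lemma frechet_subdiff_add_smooth:
  assumes v: "v \<in> frechet_subdiff h y" and g: "GDERIV g y :> D"
  shows "v + D \<in> frechet_subdiff (\<lambda>z. h z + g z) y"
  unfolding frechet_subdiff_def
proof clarify
  fix e :: real assume "e > 0"
  then have e2: "e/2 > 0" by simp
  obtain d where d: "d > 0" "\<And>z. norm (z - y) < d \<Longrightarrow> h z \<ge> h y + v \<bullet> (z - y) - e/2 * norm (z - y)"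
    using v e2 unfolding frechet_subdiff_def by blast
  obtain d' where d': "d' > 0" "\<And>z. norm (z - y) < d' \<Longrightarrow> \<bar>g z - g y - D \<bullet> (z - y)\<bar> \<le> e/2 * norm (z - y)"
    using GDERIV_eps[OF g e2] by metis
  show "\<exists>d>0. \<forall>z. norm (z - y) < d \<longrightarrow> h y + g y + (v + D) \<bullet> (z - y) - e * norm (z - y) \<le> h z + g z"
  proof (intro exI[of _ "min d d'"] conjI allI impI)
    fix z assume "norm (z - y) < min d d'"
    then have "h z \<ge> h y + v \<bullet> (z - y) - e/2 * norm (z - y)" "\<bar>g z - g y - D \<bullet> (z - y)\<bar> \<le> e/2 * norm (z - y)"
      using d d' by auto
    then show "h y + g y + (v + D) \<bullet> (z - y) - e * norm (z - y) \<le> h z + g z"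
      unfolding inner_add_left by linarith
  qed (use d d' in auto)
qed

text \<open>Continuity of the gradient carries the translation of Frechet subgradients, which happens at the
approximating points, over to the limit.\<close>

lemma limiting_subdiff_add_smooth_mem:
  assumes v: "v \<in> limiting_subdiff h x" and S: "open S" "x \<in> S"
    and g: "\<And>z. z \<in> S \<Longrightarrow> GDERIV g z :> g' z" and g': "isCont g' x"
  shows "v + g' x \<in> limiting_subdiff (\<lambda>z. h z + g z) x"
proof -
  obtain xs vs where *: "\<And>i::nat. vs i \<in> frechet_subdiff h (xs i)" "xs \<longlonglongrightarrow> x"
    "(\<lambda>i. h (xs i)) \<longlonglongrightarrow> h x" "vs \<longlonglongrightarrow> v"
    using v unfolding limiting_subdiff_def by blast
  have "isCont g x" using g[OF S(2)] unfolding gderiv_def by (rule has_derivative_continuous)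
  then have "(\<lambda>i. g (xs i)) \<longlonglongrightarrow> g x" using *(2) by (rule isCont_tendsto_compose)
  moreover have "(\<lambda>i. g' (xs i)) \<longlonglongrightarrow> g' x" using g' *(2) by (rule isCont_tendsto_compose)
  moreover have "\<forall>\<^sub>F i in sequentially. xs i \<in> S" using topological_tendstoD[OF *(2) S] .
  ultimately show ?thesis
    by (intro limiting_subdiffI_eventually[where xs = xs and vs = "\<lambda>i. vs i + g' (xs i)"])
      (auto elim!: eventually_mono intro!: tendsto_add * frechet_subdiff_add_smooth g)
qed

text \<open>Equality holds because the inclusion just proved also applies to the function \<open>- g\<close>.\<close>

lemma limiting_subdiff_add_smooth:
  assumes S: "open S" "x \<in> S"
    and g: "\<And>z. z \<in> S \<Longrightarrow> GDERIV g z :> g' z" and g': "isCont g' x"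
  shows "limiting_subdiff (\<lambda>z. h z + g z) x = (\<lambda>v. g' x + v) ` limiting_subdiff h x"
proof
  show "(\<lambda>v. g' x + v) ` limiting_subdiff h x \<subseteq> limiting_subdiff (\<lambda>z. h z + g z) x"
    using limiting_subdiff_add_smooth_mem[OF _ S g g'] by (auto simp: add.commute[of "g' x"])
  show "limiting_subdiff (\<lambda>z. h z + g z) x \<subseteq> (\<lambda>v. g' x + v) ` limiting_subdiff h x"
  proof
    fix v assume v: "v \<in> limiting_subdiff (\<lambda>z. h z + g z) x"
    have "v + - g' x \<in> limiting_subdiff (\<lambda>z. (h z + g z) + - g z) x"
      by (rule limiting_subdiff_add_smooth_mem[OF v S]) (auto intro: GDERIV_minus g isCont_minus g')
    then show "v \<in> (\<lambda>v. g' x + v) ` limiting_subdiff h x"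
      by (intro image_eqI[of _ _ "v + - g' x"]) auto
  qed
qed

text \<open>Frechet normals depend only on the set near the point. Consequently the truncated control set
\<open>U_loc\<close> and the full control set have the same normals at the reference control.\<close>

lemma limiting_normal_local:
  assumes T: "open T" "x \<in> T" and eq: "A \<inter> T = B \<inter> T"
  shows "limiting_normal A x \<subseteq> limiting_normal B x"
proof
  fix v assume v: "v \<in> limiting_normal A x"
  then obtain xs vs where *: "\<And>i::nat. vs i \<in> frechet_normal A (xs i)" "xs \<longlonglongrightarrow> x" "vs \<longlonglongrightarrow> v" "x \<in> A"
    unfolding limiting_normal_def by blast
  have "\<forall>\<^sub>F i in sequentially. xs i \<in> T"
    by (rule topological_tendstoD[OF *(2) T])
  then have "\<exists>N. \<forall>i\<ge>N. xs i \<in> T" by (simp only: eventually_sequentially)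
  then obtain N where N: "\<And>i. i \<ge> N \<Longrightarrow> xs i \<in> T" by auto
  have fre: "frechet_normal A y \<subseteq> frechet_normal B y" if "y \<in> T" for y
  proof
    fix w assume w: "w \<in> frechet_normal A y"
    obtain r where r: "r > 0" "ball y r \<subseteq> T" using openE[OF T(1) \<open>y \<in> T\<close>] .
    show "w \<in> frechet_normal B y"
      unfolding frechet_normal_def
    proof (intro CollectI conjI allI impI)
      show "y \<in> B" using w eq that by (auto simp: frechet_normal_def)
      fix e :: real assume "e > 0"
      then obtain d where d: "d > 0" "\<And>z. z \<in> A \<Longrightarrow> norm (z - y) < d \<Longrightarrow> w \<bullet> (z - y) \<le> e * norm (z - y)"
        using w unfolding frechet_normal_def by blast
      show "\<exists>d>0. \<forall>z\<in>B. norm (z - y) < d \<longrightarrow> w \<bullet> (z - y) \<le> e * norm (z - y)"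
      proof (intro exI[of _ "min d r"] conjI ballI impI)
        fix z assume z: "z \<in> B" "norm (z - y) < min d r"
        then have "z \<in> ball y r" by (simp add: dist_norm norm_minus_commute)
        then have "z \<in> A" using z r eq by blast
        then show "w \<bullet> (z - y) \<le> e * norm (z - y)" using d z by auto
      qed (use d r in auto)
    qed
  qed
  have "\<forall>i. vs (i + N) \<in> frechet_normal B (xs (i + N))" using subsetD[OF fre[OF N] *(1)] by simp
  moreover have "x \<in> B" using * T eq by blast
  ultimately show "v \<in> limiting_normal B x" unfolding limiting_normal_def
    using LIMSEQ_ignore_initial_segment[OF *(2), of N] LIMSEQ_ignore_initial_segment[OF *(3), of N]
    by (intro CollectI conjI exI[of _ "\<lambda>i. xs (i + N)"] exI[of _ "\<lambda>i. vs (i + N)"]) auto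
qed

lemma GDERIV_unique:
  fixes x :: "'a::euclidean_space"
  shows "GDERIV h x :> D \<Longrightarrow> GDERIV h x :> D' \<Longrightarrow> D = D'"
  unfolding gderiv_def
proof -
  assume "(h has_derivative (\<lambda>z. z \<bullet> D)) (at x)" "(h has_derivative (\<lambda>z. z \<bullet> D')) (at x)"
  then have "(\<lambda>z. z \<bullet> D) = (\<lambda>z. z \<bullet> D')" by (rule has_derivative_unique)
  then have "z \<bullet> D = z \<bullet> D'" for z by (rule fun_cong)
  then show "D = D'" using vector_eq_ldot[of D D'] by blast
qed

lemma grad_eqI: "GDERIV h x :> D \<Longrightarrow> grad h x = D"
  unfolding grad_def by (rule the_equality) (auto intro: GDERIV_unique)

lemma GDERIV_grad:
  fixes h :: "'a::euclidean_space \<Rightarrow> real"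
  assumes "h differentiable (at x)"
  shows "GDERIV h x :> grad h x"
proof -
  obtain D where D: "(h has_derivative D) (at x)" using assms unfolding differentiable_def by blast
  have "GDERIV h x :> adjoint D 1"
    unfolding gderiv_def using D
    by (rule has_derivative_eq_rhs)
      (use adjoint_works[OF has_derivative_linear[OF D], of _ 1] in \<open>auto simp: fun_eq_iff inner_commute\<close>)
  with grad_eqI[OF this] show ?thesis by simp
qed

section \<open>Weak compactness of dominated sequences\<close>

lemma tendsto_uniform_approx:
  fixes S :: "nat \<Rightarrow> real"
  assumes s: "\<And>n. (\<lambda>k. s n k) \<longlonglongrightarrow> l n"
    and S: "\<And>n k. \<bar>S k - s n k\<bar> \<le> \<epsilon> n" and L: "\<And>n. \<bar>L - l n\<bar> \<le> \<epsilon> n" and \<epsilon>: "\<epsilon> \<longlonglongrightarrow> 0"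
  shows "S \<longlonglongrightarrow> L"
proof (rule LIMSEQ_I)
  fix e :: real assume "e > 0"
  then have "\<forall>\<^sub>F n in sequentially. \<epsilon> n < e/3" by (intro order_tendstoD(2)[OF \<epsilon>]) simp
  then obtain n where n: "\<epsilon> n < e/3" using eventually_happens'[OF sequentially_bot] by blast
  obtain K where K: "\<And>k. k \<ge> K \<Longrightarrow> norm (s n k - l n) < e/3"
    using LIMSEQ_D[OF s[of n], of "e/3"] \<open>e > 0\<close> by auto
  show "\<exists>K. \<forall>k\<ge>K. norm (S k - L) < e"
  proof (intro exI[of _ K] allI impI)
    fix k assume "k \<ge> K"
    from K[OF this] S[of k n] L[of n] n show "norm (S k - L) < e"
      unfolding real_norm_def by linarith
  qed
qed

lemma convergent_uniform_approx:
  fixes S :: "nat \<Rightarrow> real"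
  assumes s: "\<And>n. convergent (s n)" and S: "\<And>n k. \<bar>S k - s n k\<bar> \<le> \<epsilon> n" and \<epsilon>: "\<epsilon> \<longlonglongrightarrow> 0"
  shows "convergent S"
  unfolding Cauchy_convergent_iff[symmetric]
proof (rule CauchyI)
  fix e :: real assume "e > 0"
  then have "\<forall>\<^sub>F n in sequentially. \<epsilon> n < e/3" by (intro order_tendstoD(2)[OF \<epsilon>]) simp
  then obtain n where n: "\<epsilon> n < e/3" using eventually_happens'[OF sequentially_bot] by blast
  have "Cauchy (s n)" using s[of n] by (simp add: Cauchy_convergent_iff)
  then obtain K where K: "\<And>k m. k \<ge> K \<Longrightarrow> m \<ge> K \<Longrightarrow> norm (s n k - s n m) < e/3"
    using CauchyD[of "s n" "e/3"] \<open>e > 0\<close> by auto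
  show "\<exists>K. \<forall>k\<ge>K. \<forall>m\<ge>K. norm (S k - S m) < e"
  proof (intro exI[of _ K] allI impI)
    fix k m assume "k \<ge> K" "m \<ge> K"
    from K[OF this] S[of k n] S[of m n] n show "norm (S k - S m) < e"
      unfolding real_norm_def by linarith
  qed
qed

lemma set_integrable_of_integrable:
  fixes f :: "'a \<Rightarrow> 'b::{banach, second_countable_topology}"
  shows "integrable M f \<Longrightarrow> E \<in> sets M \<Longrightarrow> set_integrable M E f"
  unfolding set_integrable_def by (rule integrable_mult_indicator)

lemma norm_integral_le_AE:
  fixes f :: "'a \<Rightarrow> 'b::{banach, second_countable_topology}"
  assumes "integrable M f" "integrable M g" "AE x in M. norm (f x) \<le> g x"
  shows "norm (LINT x|M. f x) \<le> (LINT x|M. g x)"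
  by (rule order_trans[OF Bochner_Integration.integral_norm_bound
        integral_mono_AE[OF integrable_norm[OF assms(1)] assms(2,3)]])

lemma abs_set_integral_le:
  fixes f g :: "'a \<Rightarrow> real"
  assumes "integrable M f" "integrable M g" "AE x in M. \<bar>f x\<bar> \<le> g x" "E \<in> sets M"
  shows "\<bar>LINT x:E|M. f x\<bar> \<le> (LINT x:E|M. g x)"
proof -
  have "norm (LINT x|M. indicator E x *\<^sub>R f x) \<le> (LINT x|M. indicator E x *\<^sub>R g x)"
    using assms by (intro norm_integral_le_AE integrable_mult_indicator)
      (auto elim!: eventually_mono split: split_indicator)
  then show ?thesis by (simp add: set_lebesgue_integral_def)
qed

lemma tail_integral_tendsto_0:
  fixes g :: "'a \<Rightarrow> real"
  assumes g: "integrable M g" and A: "range A \<subseteq> sets M"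
  shows "(\<lambda>n. LINT x:((\<Union>i. A i) - (\<Union>i<n. A i))|M. g x) \<longlonglongrightarrow> 0"
proof -
  let ?R = "\<lambda>n. (\<Union>i. A i) - (\<Union>i<n. A i)"
  have R: "?R n \<in> sets M" for n using A by auto
  have "(\<lambda>n. LINT x|M. indicator (?R n) x *\<^sub>R g x) \<longlonglongrightarrow> (LINT x|M. 0)"
  proof (rule integral_dominated_convergence[where w = "\<lambda>x. norm (g x)"])
    show "(\<lambda>x. indicator (?R n) x *\<^sub>R g x) \<in> borel_measurable M" for n using g R by measurable
    show "AE x in M. norm (indicator (?R n) x *\<^sub>R g x) \<le> norm (g x)" for n
      by (auto split: split_indicator)
    show "AE x in M. (\<lambda>n. indicator (?R n) x *\<^sub>R g x) \<longlonglongrightarrow> 0"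
    proof (rule AE_I2)
      fix x
      have "\<exists>m. \<forall>n\<ge>m. x \<notin> ?R n"
      proof (cases "x \<in> (\<Union>i. A i)")
        case True
        then obtain i where "x \<in> A i" by blast
        then show ?thesis by (intro exI[of _ "Suc i"]) (auto intro: bexI[of _ i])
      qed auto
      then obtain m where "\<And>n. n \<ge> m \<Longrightarrow> x \<notin> ?R n" by blast
      then show "(\<lambda>n. indicator (?R n) x *\<^sub>R g x) \<longlonglongrightarrow> 0"
        by (intro tendsto_eventually eventually_sequentiallyI[of m]) (simp add: indicator_def)
    qed
  qed (use g in auto)
  then show ?thesis by (simp add: set_lebesgue_integral_def)
qed

lemma set_integral_UN_tail:
  fixes f :: "'a \<Rightarrow> real" and A :: "nat \<Rightarrow> 'a set"
  assumes f: "integrable M f" and A: "range A \<subseteq> sets M" and disj: "disjoint_family A"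
  shows "(LINT x:(\<Union>i. A i)|M. f x) =
    (\<Sum>i<n. LINT x:A i|M. f x) + (LINT x:((\<Union>i. A i) - (\<Union>i<n. A i))|M. f x)"
proof -
  have *: "(LINT x:(\<Union>i<n. A i)|M. f x) = (\<Sum>i<n. LINT x:A i|M. f x)"
  proof (rule set_integral_finite_Union)
    show "disjoint_family_on A {..<n}" by (rule disjoint_family_on_mono[OF subset_UNIV disj])
    show "A i \<in> sets M" for i using A by blast
    then show "set_integrable M (A i) f" for i by (rule set_integrable_of_integrable[OF f])
  qed simp
  have [measurable]: "A i \<in> sets M" for i using A by blast
  have [measurable]: "(\<Union>i. A i) \<in> sets M" "(\<Union>i<n. A i) \<in> sets M" by measurable
  have "(\<Union>i. A i) = (\<Union>i<n. A i) \<union> ((\<Union>i. A i) - (\<Union>i<n. A i))" by blast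
  then have "(LINT x:(\<Union>i. A i)|M. f x) =
    (LINT x:((\<Union>i<n. A i) \<union> ((\<Union>i. A i) - (\<Union>i<n. A i)))|M. f x)"
    by (rule arg_cong[where f = "\<lambda>E. LINT x:E|M. f x"])
  also have "\<dots> = (LINT x:(\<Union>i<n. A i)|M. f x) + (LINT x:((\<Union>i. A i) - (\<Union>i<n. A i))|M. f x)"
  proof (rule set_integral_Un)
    show "set_integrable M (\<Union>i<n. A i) f" "set_integrable M ((\<Union>i. A i) - (\<Union>i<n. A i)) f"
      by (rule set_integrable_of_integrable[OF f], measurable)+
  qed blast
  finally show ?thesis using * by simp
qed

text \<open>The set function \<open>E \<mapsto> lim (\<integral>\<^sub>E f k) + \<integral>\<^sub>E g\<close> takes values between 0 and \<open>2 * \<integral>\<^sub>E g\<close>. The upper bound makes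
the mass of the tail of a disjoint union small, whence countable additivity, and it gives absolute
continuity; the Radon-Nikodym derivative minus \<open>g\<close> is the density of the limit.\<close>

lemma dominated_set_limit_has_density:
  fixes f :: "nat \<Rightarrow> 'a \<Rightarrow> real"
  assumes M: "finite_measure M" and g: "integrable M g"
    and f: "\<And>k. integrable M (f k)" and dom: "\<And>k. AE x in M. \<bar>f k x\<bar> \<le> g x"
    and conv: "\<And>E. E \<in> sets M \<Longrightarrow> convergent (\<lambda>k. LINT x:E|M. f k x)"
  obtains h where "integrable M h"
    "\<And>E. E \<in> sets M \<Longrightarrow> (\<lambda>k. LINT x:E|M. f k x) \<longlonglongrightarrow> (LINT x:E|M. h x)"
proof -
  interpret finite_measure M by fact
  define \<nu> where "\<nu> E = lim (\<lambda>k. LINT x:E|M. f k x) + (LINT x:E|M. g x)" for E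
  have lim: "(\<lambda>k. LINT x:E|M. f k x) \<longlonglongrightarrow> \<nu> E - (LINT x:E|M. g x)" if "E \<in> sets M" for E
    using conv[OF that] by (simp add: \<nu>_def convergent_LIMSEQ_iff)
  have bound: "\<bar>\<nu> E - (LINT x:E|M. g x)\<bar> \<le> (LINT x:E|M. g x)" if "E \<in> sets M" for E
    by (rule tendsto_upperbound[OF tendsto_rabs[OF lim[OF that]]])
      (use abs_set_integral_le[OF f g dom that] in auto)
  have nonneg: "0 \<le> \<nu> E" if "E \<in> sets M" for E using bound[OF that] by linarith
  have sums: "(\<lambda>i. \<nu> (A i)) sums \<nu> (\<Union>i. A i)" if A: "range A \<subseteq> sets M" "disjoint_family A" for A
  proof -
    let ?R = "\<lambda>n. (\<Union>i. A i) - (\<Union>i<n. A i)"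
    have R: "?R n \<in> sets M" "(\<Union>i. A i) \<in> sets M" "A n \<in> sets M" for n using A by auto
    have split: "\<nu> (\<Union>i. A i) = (\<Sum>i<n. \<nu> (A i)) + \<nu> (?R n)" for n
    proof -
      have "(\<lambda>k. (\<Sum>i<n. LINT x:A i|M. f k x) + (LINT x:?R n|M. f k x)) \<longlonglongrightarrow>
        (\<Sum>i<n. \<nu> (A i) - (LINT x:A i|M. g x)) + (\<nu> (?R n) - (LINT x:?R n|M. g x))"
        by (intro tendsto_add tendsto_sum lim R)
      then have "(\<lambda>k. LINT x:(\<Union>i. A i)|M. f k x) \<longlonglongrightarrow>
        (\<Sum>i<n. \<nu> (A i) - (LINT x:A i|M. g x)) + (\<nu> (?R n) - (LINT x:?R n|M. g x))"
        by (simp add: set_integral_UN_tail[OF f A, of _ n])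
      from LIMSEQ_unique[OF this lim[OF R(2)]] show ?thesis
        using set_integral_UN_tail[OF g A, of n] by (simp add: sum_subtractf)
    qed
    have "(\<lambda>n. \<nu> (?R n)) \<longlonglongrightarrow> 0"
    proof (rule tendsto_sandwich[where f = "\<lambda>_. 0"])
      show "(\<lambda>n. 2 * (LINT x:?R n|M. g x)) \<longlonglongrightarrow> 0"
        using tendsto_mult_left[OF tail_integral_tendsto_0[OF g A(1)], of 2] by simp
      show "\<forall>\<^sub>F n in sequentially. \<nu> (?R n) \<le> 2 * (LINT x:?R n|M. g x)"
      proof (rule always_eventually, rule allI)
        fix n show "\<nu> (?R n) \<le> 2 * (LINT x:?R n|M. g x)" using bound[OF R(1)[of n]] by linarith
      qed
    qed (use nonneg R in auto)
    from tendsto_diff[OF tendsto_const this] have "(\<lambda>n. \<nu> (\<Union>i. A i) - \<nu> (?R n)) \<longlonglongrightarrow> \<nu> (\<Union>i. A i)"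
      by simp
    moreover have "\<nu> (\<Union>i. A i) - \<nu> (?R n) = (\<Sum>i<n. \<nu> (A i))" for n using split[of n] by simp
    ultimately show ?thesis by (simp add: sums_def)
  qed
  define N where "N = measure_of (space M) (sets M) (\<lambda>E. ennreal (\<nu> E))"
  have sets_N: "sets N = sets M" by (simp add: N_def)
  have "\<nu> {} = 0" using bound[of "{}"] by (simp add: set_lebesgue_integral_def)
  then have em: "emeasure N E = ennreal (\<nu> E)" if "E \<in> sets M" for E
    using that
  proof (intro emeasure_measure_of[OF N_def])
    show "countably_additive (sets N) (\<lambda>E. ennreal (\<nu> E))"
    proof (rule countably_additiveI)
      fix A :: "nat \<Rightarrow> 'a set" assume A: "range A \<subseteq> sets N" "disjoint_family A"
      then have A': "range A \<subseteq> sets M" by (simp add: sets_N)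
      then have "0 \<le> \<nu> (A i)" for i by (intro nonneg) auto
      with sums[OF A' A(2)] show "(\<Sum>i. ennreal (\<nu> (A i))) = ennreal (\<nu> (\<Union>i. A i))"
        by (simp add: suminf_ennreal2 sums_iff)
    qed
  qed (auto simp: positive_def sets_N dest: sets.sets_into_space)
  have "absolutely_continuous M N"
    unfolding absolutely_continuous_def
  proof
    fix E assume E: "E \<in> null_sets M"
    then have "AE x in M. x \<notin> E" by (rule AE_not_in)
    then have "(LINT x:E|M. g x) = (LINT x|M. 0)"
      unfolding set_lebesgue_integral_def using g E
      by (intro integral_cong_AE) (auto elim!: eventually_mono)
    then have "\<nu> E = 0" using bound[of E] E by auto
    then show "E \<in> null_sets N" using em[of E] E by (auto simp: null_sets_def sets_N)
  qed
  then obtain d where d[measurable]: "d \<in> borel_measurable M" and dN: "density M d = N"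
    using Radon_Nikodym[OF _ sets_N] by blast
  have dE: "(\<integral>\<^sup>+x\<in>E. d x \<partial>M) = ennreal (\<nu> E)" if "E \<in> sets M" for E
    using emeasure_density[OF d that] em[OF that] dN by simp
  have fin: "integral\<^sup>N M d \<noteq> \<infinity>"
  proof -
    have "integral\<^sup>N M d = (\<integral>\<^sup>+x\<in>space M. d x \<partial>M)" by (rule nn_integral_cong) auto
    also have "\<dots> = ennreal (\<nu> (space M))" by (rule dE) simp
    finally show ?thesis by simp
  qed
  then have AEd: "AE x in M. d x \<noteq> \<infinity>" using nn_integral_PInf_AE[OF d] by simp
  define h where "h x = enn2real (d x)" for x
  have h: "integrable M h"
  proof (rule integrableI_nonneg)
    have "(\<integral>\<^sup>+x. ennreal (h x) \<partial>M) = integral\<^sup>N M d"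
      using AEd by (intro nn_integral_cong_AE) (auto simp: h_def less_top elim!: eventually_mono)
    then show "(\<integral>\<^sup>+x. ennreal (h x) \<partial>M) < \<infinity>" using fin by (simp add: less_top)
    have "(\<lambda>x. enn2real (d x)) \<in> borel_measurable M" by measurable
    then show "h \<in> borel_measurable M" by (simp add: h_def[abs_def])
  qed (auto simp: h_def)
  have hE: "(LINT x:E|M. h x) = \<nu> E" if E[measurable]: "E \<in> sets M" for E
  proof -
    have "ennreal (LINT x:E|M. h x) = (\<integral>\<^sup>+x. ennreal (indicator E x *\<^sub>R h x) \<partial>M)"
      unfolding set_lebesgue_integral_def
      by (rule nn_integral_eq_integral[symmetric]) (use integrable_mult_indicator[OF E h] in \<open>auto simp: h_def\<close>)
    also have "\<dots> = (\<integral>\<^sup>+x\<in>E. d x \<partial>M)"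
      using AEd by (intro nn_integral_cong_AE) (auto simp: h_def less_top elim!: eventually_mono split: split_indicator)
    also have "\<dots> = ennreal (\<nu> E)" by (rule dE[OF E])
    finally show ?thesis using nonneg[OF E]
      by (subst (asm) ennreal_inj) (auto simp: h_def set_lebesgue_integral_def intro!: integral_nonneg_AE)
  qed
  show thesis
  proof (rule that)
    show "integrable M (\<lambda>x. h x - g x)" using h g by simp
    fix E assume E: "E \<in> sets M"
    have "(LINT x:E|M. h x - g x) = \<nu> E - (LINT x:E|M. g x)"
      using hE[OF E] set_integral_diff(2)[OF set_integrable_of_integrable[OF h E] set_integrable_of_integrable[OF g E]] by simp
    then show "(\<lambda>k. LINT x:E|M. f k x) \<longlonglongrightarrow> (LINT x:E|M. h x - g x)" using lim[OF E] by simp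
  qed
qed

text \<open>Convergence on sets is convergence against simple functions. A bounded test function is a limit of
simple ones, and the common bound \<open>g\<close> makes the error of this approximation uniform in \<open>k\<close>.\<close>

lemma set_limit_imp_bounded_test:
  fixes f :: "nat \<Rightarrow> 'a \<Rightarrow> real"
  assumes g: "integrable M g" and f: "\<And>k. integrable M (f k)" and h: "integrable M h"
    and dom: "\<And>k. AE x in M. \<bar>f k x\<bar> \<le> g x"
    and conv: "\<And>E. E \<in> sets M \<Longrightarrow> (\<lambda>k. LINT x:E|M. f k x) \<longlonglongrightarrow> (LINT x:E|M. h x)"
    and w: "w \<in> borel_measurable M" and bw: "AE x in M. \<bar>w x\<bar> \<le> c"
  shows "(\<lambda>k. LINT x|M. w x * f k x) \<longlonglongrightarrow> (LINT x|M. w x * h x)"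
proof -
  obtain s where s: "\<And>i. simple_function M (s i)" "\<And>x. x \<in> space M \<Longrightarrow> (\<lambda>i. s i x) \<longlonglongrightarrow> w x"
    "\<And>i x. x \<in> space M \<Longrightarrow> \<bar>s i x\<bar> \<le> 2 * \<bar>w x\<bar>"
  proof -
    obtain s where s: "\<forall>i. simple_function M (s i)" "\<forall>x\<in>space M. (\<lambda>i. s i x) \<longlonglongrightarrow> w x"
      "\<forall>i. \<forall>x\<in>space M. dist (s i x) 0 \<le> 2 * dist (w x) 0"
      using borel_measurable_implies_sequence_metric[OF w, of 0] by blast
    show thesis by (rule that[of s]) (use s in \<open>simp_all add: dist_real_def\<close>)
  qed
  have sm[measurable]: "s i \<in> borel_measurable M" for i
    using borel_measurable_simple_function[OF s(1)] .
  note [measurable] = w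
  have bs: "AE x in M. \<bar>s i x\<bar> \<le> 2 * c" for i
    using bw AE_space[of M]
  proof eventually_elim
    case (elim x) then show ?case using s(3)[of x i] by linarith
  qed
  have int_bdd: "integrable M (\<lambda>x. v x * F x)"
    if "v \<in> borel_measurable M" "AE x in M. \<bar>v x\<bar> \<le> C" "integrable M F" for v C and F :: "'a \<Rightarrow> real"
  proof (rule Bochner_Integration.integrable_bound[of M "\<lambda>x. C * F x"])
    show "AE x in M. norm (v x * F x) \<le> norm (C * F x)"
      using that(2)
    proof eventually_elim
      case (elim x)
      then have "\<bar>v x\<bar> * \<bar>F x\<bar> \<le> \<bar>C\<bar> * \<bar>F x\<bar>" by (intro mult_right_mono) auto
      then show ?case by (simp add: abs_mult)
    qed
  qed (use that in auto)
  have simple_sum: "(LINT x|M. s i x * F x) = (\<Sum>y\<in>s i ` space M. y * (LINT x:(s i -` {y} \<inter> space M)|M. F x))"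
    if F: "integrable M F" for i and F :: "'a \<Rightarrow> real"
  proof -
    have fin: "finite (s i ` space M)" using s(1)[of i] by (simp add: simple_function_def)
    have E: "s i -` {y} \<inter> space M \<in> sets M" for y using simple_functionD(2)[OF s(1)] .
    have "(LINT x|M. s i x * F x) =
      (LINT x|M. (\<Sum>y\<in>s i ` space M. y * (indicator (s i -` {y} \<inter> space M) x *\<^sub>R F x)))"
    proof (rule Bochner_Integration.integral_cong[OF refl])
      fix x assume x: "x \<in> space M"
      have "(\<Sum>y\<in>s i ` space M. y * (indicator (s i -` {y} \<inter> space M) x *\<^sub>R F x)) =
        (\<Sum>y\<in>s i ` space M. if y = s i x then s i x * F x else 0)"
        by (rule sum.cong) (use x in \<open>auto simp: indicator_def\<close>)
      also have "\<dots> = s i x * F x" using fin x by simp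
      finally show "s i x * F x = (\<Sum>y\<in>s i ` space M. y * (indicator (s i -` {y} \<inter> space M) x *\<^sub>R F x))" by simp
    qed
    also have "\<dots> = (\<Sum>y\<in>s i ` space M. LINT x|M. y * (indicator (s i -` {y} \<inter> space M) x *\<^sub>R F x))"
      by (intro Bochner_Integration.integral_sum Bochner_Integration.integrable_mult_right integrable_mult_indicator E F)
    finally show ?thesis by (simp add: set_lebesgue_integral_def)
  qed
  let ?\<epsilon> = "\<lambda>i. LINT x|M. \<bar>w x - s i x\<bar> * (\<bar>g x\<bar> + \<bar>h x\<bar>)"
  have int_diff: "integrable M (\<lambda>x. \<bar>w x - s i x\<bar> * (\<bar>g x\<bar> + \<bar>h x\<bar>))" for i
  proof (rule int_bdd[where C = "3 * c"])
    show "AE x in M. \<bar>\<bar>w x - s i x\<bar>\<bar> \<le> 3 * c" using bw bs[of i] by eventually_elim auto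
  qed (use g h in auto)
  have close: "\<bar>(LINT x|M. w x * F x) - (LINT x|M. s i x * F x)\<bar> \<le> ?\<epsilon> i"
    if F: "integrable M F" "AE x in M. \<bar>F x\<bar> \<le> \<bar>g x\<bar> + \<bar>h x\<bar>" for F i
  proof -
    have I: "integrable M (\<lambda>x. w x * F x)" "integrable M (\<lambda>x. s i x * F x)"
      using int_bdd[OF w bw F(1)] int_bdd[OF sm bs F(1)] by blast+
    have "(LINT x|M. w x * F x) - (LINT x|M. s i x * F x) = (LINT x|M. (w x - s i x) * F x)"
      using I by (simp add: left_diff_distrib)
    also have "norm \<dots> \<le> ?\<epsilon> i"
    proof (rule norm_integral_le_AE[OF _ int_diff])
      show "integrable M (\<lambda>x. (w x - s i x) * F x)"
        using Bochner_Integration.integrable_diff[OF I] by (simp add: left_diff_distrib)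
      have "AE x in M. norm ((w x - s i x) * F x) \<le> \<bar>w x - s i x\<bar> * (\<bar>g x\<bar> + \<bar>h x\<bar>)"
        using F(2) by eventually_elim (simp add: abs_mult mult_left_mono)
      then show "AE x in M. norm ((w x - s i x) * F x) \<le> \<bar>w x - s i x\<bar> * (\<bar>g x\<bar> + \<bar>h x\<bar>)" .
    qed
    finally show ?thesis by simp
  qed
  have "?\<epsilon> \<longlonglongrightarrow> (LINT x|M. 0)"
  proof (rule integral_dominated_convergence[where w = "\<lambda>x. 3 * c * (\<bar>g x\<bar> + \<bar>h x\<bar>)"])
    show "AE x in M. (\<lambda>i. \<bar>w x - s i x\<bar> * (\<bar>g x\<bar> + \<bar>h x\<bar>)) \<longlonglongrightarrow> 0"
    proof (rule AE_I2)
      fix x assume "x \<in> space M"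
      have "(\<lambda>i. \<bar>w x - s i x\<bar> * (\<bar>g x\<bar> + \<bar>h x\<bar>)) \<longlonglongrightarrow> \<bar>w x - w x\<bar> * (\<bar>g x\<bar> + \<bar>h x\<bar>)"
        by (intro tendsto_intros s(2)[OF \<open>x \<in> space M\<close>])
      then show "(\<lambda>i. \<bar>w x - s i x\<bar> * (\<bar>g x\<bar> + \<bar>h x\<bar>)) \<longlonglongrightarrow> 0" by simp
    qed
    show "AE x in M. norm (\<bar>w x - s i x\<bar> * (\<bar>g x\<bar> + \<bar>h x\<bar>)) \<le> 3 * c * (\<bar>g x\<bar> + \<bar>h x\<bar>)" for i
      using bw bs[of i]
    proof eventually_elim
      case (elim x)
      then have "\<bar>w x - s i x\<bar> \<le> 3 * c" by linarith
      then have "\<bar>w x - s i x\<bar> * (\<bar>g x\<bar> + \<bar>h x\<bar>) \<le> 3 * c * (\<bar>g x\<bar> + \<bar>h x\<bar>)"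
        by (rule mult_right_mono) simp
      then show ?case by simp
    qed
    show "(\<lambda>x. \<bar>w x - s i x\<bar> * (\<bar>g x\<bar> + \<bar>h x\<bar>)) \<in> borel_measurable M" for i
      by (rule borel_measurable_integrable[OF int_diff])
    show "integrable M (\<lambda>x. 3 * c * (\<bar>g x\<bar> + \<bar>h x\<bar>))" using g h by simp
  qed simp
  then have \<epsilon>: "?\<epsilon> \<longlonglongrightarrow> 0" by simp
  show ?thesis
  proof (rule tendsto_uniform_approx[OF _ _ _ \<epsilon>])
    fix n
    show "(\<lambda>k. LINT x|M. s n x * f k x) \<longlonglongrightarrow> (LINT x|M. s n x * h x)"
      unfolding simple_sum[OF f] simple_sum[OF h]
      by (intro tendsto_sum tendsto_mult_left conv simple_functionD(2)[OF s(1)])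
    show "\<bar>(LINT x|M. w x * h x) - (LINT x|M. s n x * h x)\<bar> \<le> ?\<epsilon> n" by (rule close[OF h]) auto
    show "\<bar>(LINT x|M. w x * f k x) - (LINT x|M. s n x * f k x)\<bar> \<le> ?\<epsilon> n" for k
      by (rule close[OF f]) (use dom[of k] in \<open>auto elim!: eventually_mono\<close>)
  qed
qed

lemma lebesgue_on_borel_core:
  assumes "E \<in> sets (lebesgue_on {a..b::real})"
  obtains S where "S \<in> sets borel" "AE x in lebesgue_on {a..b}. x \<in> E \<longleftrightarrow> x \<in> {a..b} \<inter> S"
proof -
  have "E \<in> sets lebesgue" "E \<subseteq> {a..b}"
    using assms by (auto simp: sets_restrict_space)
  then obtain S N N' where S: "E = S \<union> N" "N \<subseteq> N'" "N' \<in> null_sets lborel" "S \<in> sets lborel"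
    by (elim sets_completionE)
  have "N' \<in> null_sets lebesgue" using S(3) by (rule null_sets_completionI)
  then have "AE x in lebesgue. x \<notin> N'" by (rule AE_not_in)
  then have "AE x in lebesgue. x \<in> {a..b} \<longrightarrow> x \<notin> N'" by (rule eventually_mono) blast
  then have AEN: "AE x in lebesgue_on {a..b}. x \<notin> N'" by (subst AE_restrict_space_iff) auto
  have "AE x in lebesgue_on {a..b}. x \<in> E \<longleftrightarrow> x \<in> {a..b} \<inter> S"
    using AEN AE_space[of "lebesgue_on {a..b}"]
  proof eventually_elim
    case (elim x)
    then show ?case using S(1,2) by auto
  qed
  then show thesis using S(4) that by simp
qed

text \<open>The sets on which the integrals converge form a Dynkin system, by domination for disjoint unions, and the
intervals with left end \<open>a\<close> generate the Borel sets of \<open>{a..b}\<close> and are stable under intersection. Null sets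
account for the remaining Lebesgue sets.\<close>

lemma convergent_set_integral_of_primitives:
  fixes f :: "nat \<Rightarrow> real \<Rightarrow> real"
  assumes ab: "a \<le> b" and g: "integrable (lebesgue_on {a..b}) g"
    and f: "\<And>k. integrable (lebesgue_on {a..b}) (f k)"
    and dom: "\<And>k. AE x in lebesgue_on {a..b}. \<bar>f k x\<bar> \<le> g x"
    and conv: "\<And>t. t \<in> {a..b} \<Longrightarrow> convergent (\<lambda>k. LINT x:{a..t}|lebesgue_on {a..b}. f k x)"
    and E: "E \<in> sets (lebesgue_on {a..b})"
  shows "convergent (\<lambda>k. LINT x:E|lebesgue_on {a..b}. f k x)"
proof -
  let ?M = "lebesgue_on {a..b}"
  let ?G = "(\<inter>) {a..b} ` range (\<lambda>t. {..t::real})"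
  have sets_G: "sigma_sets {a..b} ?G = (\<inter>) {a..b} ` sets borel"
  proof -
    have b: "sets borel = sigma_sets UNIV (range (\<lambda>t. {..t::real}))"
      by (subst borel_eq_atMost) simp
    have "{a..b} \<in> sets borel" by simp
    then show ?thesis unfolding b by (rule sigma_sets_Int[symmetric]) simp
  qed
  have sub: "E' \<in> sets ?M" if "E' \<in> sigma_sets {a..b} ?G" for E'
  proof -
    have "E' \<in> (\<inter>) {a..b} ` sets borel" using that unfolding sets_G .
    then obtain S where "E' = {a..b} \<inter> S" "S \<in> sets borel" by (rule imageE)
    then show ?thesis unfolding sets_restrict_space by (intro image_eqI[of _ _ S]) simp_all
  qed
  have cg: "convergent (\<lambda>k. LINT x:E'|?M. f k x)" if E': "E' \<in> sigma_sets {a..b} ?G" for E'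
  proof (rule sigma_sets_induct_disjoint[OF _ _ E'])
    show "Int_stable ?G"
    proof (rule Int_stableI)
      fix A B assume "A \<in> ?G" "B \<in> ?G"
      then obtain s t where "A = {a..b} \<inter> {..s}" "B = {a..b} \<inter> {..t}" by blast
      then have "A \<inter> B = {a..b} \<inter> {..min s t}" by auto
      then show "A \<inter> B \<in> ?G" by blast
    qed
    show "?G \<subseteq> Pow {a..b}" by auto
    show "convergent (\<lambda>k. LINT x:A|?M. f k x)" if "A \<in> ?G" for A
    proof -
      obtain t where A: "A = {a..b} \<inter> {..t}" using \<open>A \<in> ?G\<close> by blast
      show ?thesis
      proof (cases "t < a")
        case True
        then have "A = {}" using A by auto
        then show ?thesis by (simp add: set_lebesgue_integral_def convergent_const)
      next
        case False
        then have "A = {a..min b t}" "min b t \<in> {a..b}" using A ab by auto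
        then show ?thesis using conv by simp
      qed
    qed
    show "convergent (\<lambda>k. LINT x:{}|?M. f k x)"
      by (simp add: set_lebesgue_integral_def convergent_const)
    show "convergent (\<lambda>k. LINT x:({a..b} - A)|?M. f k x)"
      if A: "A \<in> sigma_sets {a..b} ?G" "convergent (\<lambda>k. LINT x:A|?M. f k x)" for A
    proof -
      have A': "A \<subseteq> {a..b}" "A \<in> sets ?M" "{a..b} - A \<in> sets ?M"
      proof -
        show *: "A \<in> sets ?M" by (rule sub[OF A(1)])
        show "A \<subseteq> {a..b}" using sets.sets_into_space[OF *] by simp
        show "{a..b} - A \<in> sets ?M" using sets.compl_sets[OF *] by simp
      qed
      have "(LINT x:{a..b}|?M. f k x) = (LINT x:A|?M. f k x) + (LINT x:({a..b} - A)|?M. f k x)" for k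
      proof -
        have "A \<union> ({a..b} - A) = {a..b}" using A'(1) by blast
        moreover have "(LINT x:(A \<union> ({a..b} - A))|?M. f k x) =
          (LINT x:A|?M. f k x) + (LINT x:({a..b} - A)|?M. f k x)"
          by (rule set_integral_Un[OF _ set_integrable_of_integrable[OF f A'(2)]
                set_integrable_of_integrable[OF f A'(3)]]) blast
        ultimately show ?thesis by (simp only:)
      qed
      then have "(\<lambda>k. LINT x:({a..b} - A)|?M. f k x) =
        (\<lambda>k. (LINT x:{a..b}|?M. f k x) - (LINT x:A|?M. f k x))"
        by (intro ext) (simp only: add_diff_cancel_left')
      moreover have "convergent (\<lambda>k. (LINT x:{a..b}|?M. f k x) - (LINT x:A|?M. f k x))"
        using convergent_diff[OF conv[of b] A(2)] ab by simp
      ultimately show ?thesis by (simp only:)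
    qed
    show "convergent (\<lambda>k. LINT x:(\<Union>i::nat. A i)|?M. f k x)"
      if A: "disjoint_family A" "range A \<subseteq> sigma_sets {a..b} ?G"
        "\<And>i. convergent (\<lambda>k. LINT x:A i|?M. f k x)" for A
    proof -
      have rA: "range A \<subseteq> sets ?M" using A(2) sub by blast
      then have R: "(\<Union>i. A i) - (\<Union>i<n. A i) \<in> sets ?M" for n
        by (intro sets.Diff sets.countable_UN' sets.countable_UN) auto
      show ?thesis
      proof (rule convergent_uniform_approx[OF _ _ tail_integral_tendsto_0[OF g rA]])
        show "convergent (\<lambda>k. \<Sum>i<n. LINT x:A i|?M. f k x)" for n
          by (intro convergent_sum A(3))
        fix n k
        show "\<bar>(LINT x:(\<Union>i. A i)|?M. f k x) - (\<Sum>i<n. LINT x:A i|?M. f k x)\<bar>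
          \<le> (LINT x:((\<Union>i. A i) - (\<Union>i<n. A i))|?M. g x)"
          using abs_set_integral_le[OF f g dom R[of n], of k] set_integral_UN_tail[OF f rA A(1), of k n]
          by simp
      qed
    qed
  qed
  obtain S where S: "S \<in> sets borel" "AE x in ?M. x \<in> E \<longleftrightarrow> x \<in> {a..b} \<inter> S"
    using lebesgue_on_borel_core[OF E] .
  have Sg: "{a..b} \<inter> S \<in> sigma_sets {a..b} ?G" unfolding sets_G using S(1) by blast
  have eq: "(LINT x:E|?M. f k x) = (LINT x:({a..b} \<inter> S)|?M. f k x)" for k
    unfolding set_lebesgue_integral_def
  proof (rule integral_cong_AE)
    show "(\<lambda>x. indicator E x *\<^sub>R f k x) \<in> borel_measurable ?M"
      by (rule borel_measurable_integrable[OF integrable_mult_indicator[OF E f]])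
    show "(\<lambda>x. indicator ({a..b} \<inter> S) x *\<^sub>R f k x) \<in> borel_measurable ?M"
      by (rule borel_measurable_integrable[OF integrable_mult_indicator[OF sub[OF Sg] f]])
    show "AE x in ?M. indicator E x *\<^sub>R f k x = indicator ({a..b} \<inter> S) x *\<^sub>R f k x"
      using S(2) by (rule eventually_mono) (simp add: indicator_def)
  qed
  show ?thesis unfolding eq by (rule cg[OF Sg])
qed

lemma integral_prefix_eq:
  fixes f :: "real \<Rightarrow> 'a::euclidean_space"
  assumes "t \<le> b"
  shows "(LINT x|lebesgue_on {a..t}. f x) = (LINT x:{a..t}|lebesgue_on {a..b}. f x)"
proof -
  have "(LINT x:{a..t}|lebesgue_on {a..b}. f x) =
    (LINT x|lebesgue. indicator {a..b} x *\<^sub>R (indicator {a..t} x *\<^sub>R f x))"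
    unfolding set_lebesgue_integral_def by (subst integral_restrict_space) auto
  also have "\<dots> = (LINT x|lebesgue. indicator {a..t} x *\<^sub>R f x)"
    using assms by (intro Bochner_Integration.integral_cong) (auto simp: indicator_def)
  also have "\<dots> = (LINT x|lebesgue_on {a..t}. f x)" by (subst integral_restrict_space) auto
  finally show ?thesis by simp
qed

lemma prefix_integral_diff_eq:
  fixes h :: "real \<Rightarrow> 'a::euclidean_space"
  assumes h: "integrable (lebesgue_on {a..b}) h" and st: "a \<le> s" "s \<le> t" "t \<le> b"
  shows "(LINT x|lebesgue_on {a..t}. h x) - (LINT x|lebesgue_on {a..s}. h x) =
    (LINT x:{s<..t}|lebesgue_on {a..b}. h x)"
proof -
  let ?M = "lebesgue_on {a..b}"
  have sets: "{a..s} \<in> sets ?M" "{s<..t} \<in> sets ?M"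
    using st by (auto simp: sets_restrict_space_iff)
  have "{a..t} = {a..s} \<union> {s<..t}" using st by auto
  moreover have "(LINT x:({a..s} \<union> {s<..t})|?M. h x) = (LINT x:{a..s}|?M. h x) + (LINT x:{s<..t}|?M. h x)"
    by (rule set_integral_Un[OF _ set_integrable_of_integrable[OF h sets(1)]
          set_integrable_of_integrable[OF h sets(2)]]) auto
  ultimately have *: "(LINT x:{a..t}|?M. h x) = (LINT x:{a..s}|?M. h x) + (LINT x:{s<..t}|?M. h x)"
    by (simp only:)
  have "s \<le> b" using st by simp
  then have 1: "(LINT x|lebesgue_on {a..s}. h x) = (LINT x:{a..s}|?M. h x)" by (rule integral_prefix_eq)
  have 2: "(LINT x|lebesgue_on {a..t}. h x) = (LINT x:{a..t}|?M. h x)" by (rule integral_prefix_eq[OF st(3)])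
  show ?thesis unfolding 1 2 * by (rule add_diff_cancel_left')
qed

lemma prefix_integral_diff_le:
  fixes f :: "real \<Rightarrow> 'a::euclidean_space"
  assumes f: "integrable (lebesgue_on {a..b}) f" and g: "integrable (lebesgue_on {a..b}) g"
    and dom: "AE x in lebesgue_on {a..b}. norm (f x) \<le> g x"
    and st: "a \<le> s" "s \<le> t" "t \<le> b"
  shows "norm ((LINT x|lebesgue_on {a..t}. f x) - (LINT x|lebesgue_on {a..s}. f x))
    \<le> (LINT x|lebesgue_on {a..t}. g x) - (LINT x|lebesgue_on {a..s}. g x)"
proof -
  let ?M = "lebesgue_on {a..b}"
  have sets: "{s<..t} \<in> sets ?M" using st by (auto simp: sets_restrict_space_iff)
  show ?thesis
    unfolding prefix_integral_diff_eq[OF f st] prefix_integral_diff_eq[OF g st] set_lebesgue_integral_def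
  proof (rule norm_integral_le_AE[OF integrable_mult_indicator[OF sets f] integrable_mult_indicator[OF sets g]])
    show "AE x in ?M. norm (indicator {s<..t} x *\<^sub>R f x) \<le> indicator {s<..t} x *\<^sub>R g x"
      using dom by (rule eventually_mono) (simp add: indicator_def)
  qed
qed

lemma integral_lebesgue_on_singleton:
  fixes h :: "real \<Rightarrow> 'a::euclidean_space"
  shows "(LINT t|lebesgue_on {a}. h t) = 0"
proof -
  have "{a} \<in> null_sets lebesgue" using negligible_iff_null_sets negligible_sing by blast
  then have "AE t in lebesgue. t \<notin> {a}" by (rule AE_not_in)
  then have "AE t in lebesgue. t \<in> {a} \<longrightarrow> h t = 0" by (rule eventually_mono) blast
  then have "AE t in lebesgue_on {a}. h t = 0" by (subst AE_restrict_space_iff) simp_all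
  then show ?thesis by (simp add: integral_eq_zero_AE)
qed

text \<open>The case of the Dunford-Pettis theorem in which one integrable function bounds all terms. The primitives are
equicontinuous with the modulus of continuity of the primitive of \<open>g\<close>, so Arzela-Ascoli gives a subsequence along which they
converge uniformly. Their convergence determines the weak limit by the preceding
lemmas, one coordinate at a time. The uniform convergence of the primitives is recorded because
adjoint arcs are such primitives.\<close>

theorem dominated_weakly_sequentially_compact:
  fixes v :: "nat \<Rightarrow> real \<Rightarrow> 'a::euclidean_space"
  assumes ab: "a \<le> b" and v: "\<And>k. v k \<in> L1 a b" and g: "integrable (lebesgue_on {a..b}) g"
    and dom: "\<And>k. AE t in lebesgue_on {a..b}. norm (v k t) \<le> g t"
  obtains s V where "strict_mono (s::nat\<Rightarrow>nat)" "V \<in> L1 a b" "weak_L1 a b (\<lambda>k. v (s k)) V"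
    "uniform_limit {a..b} (\<lambda>k t. LINT \<tau>|lebesgue_on {a..t}. v (s k) \<tau>)
       (\<lambda>t. LINT \<tau>|lebesgue_on {a..t}. V \<tau>) sequentially"
proof -
  let ?M = "lebesgue_on {a..b}"
  define F where "F k t = (LINT \<tau>|lebesgue_on {a..t}. v k \<tau>)" for k t
  define G where "G t = (LINT \<tau>|lebesgue_on {a..t}. g \<tau>)" for t
  have vi: "integrable ?M (v k)" for k using v by simp
  have diff: "norm (F k y - F k x) \<le> \<bar>G y - G x\<bar>" if "x \<in> {a..b}" "y \<in> {a..b}" for k x y
  proof -
    have *: "norm (F k y - F k x) \<le> G y - G x" if "x \<in> {a..b}" "y \<in> {a..b}" "x \<le> y" for x y
      unfolding F_def G_def by (rule prefix_integral_diff_le[OF vi g dom]) (use that in auto)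
    show ?thesis using *[of x y] *[of y x] that by (cases "x \<le> y") (auto simp: norm_minus_commute)
  qed
  have Gc: "continuous_on {a..b} G" unfolding G_def by (rule indefinite_integral_continuous_real[OF g])
  have Fbd: "norm (F k t) \<le> \<bar>G t\<bar>" if "t \<in> {a..b}" for k t
  proof -
    have "F k a = 0" "G a = 0" by (simp_all add: F_def G_def integral_lebesgue_on_singleton)
    then show ?thesis using diff[of a t k] that ab by simp
  qed
  have "bounded (G ` {a..b})"
    using compact_imp_bounded[OF compact_continuous_image[OF Gc compact_Icc]] .
  then obtain C where "\<forall>y\<in>G ` {a..b}. norm y \<le> C" unfolding bounded_iff by blast
  then have C: "\<bar>G t\<bar> \<le> C" if "t \<in> {a..b}" for t using that by simp
  obtain \<Phi> s where s: "strict_mono (s::nat\<Rightarrow>nat)"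
    "\<And>e. 0 < e \<Longrightarrow> \<exists>N. \<forall>n x. n \<ge> N \<and> x \<in> {a..b} \<longrightarrow> norm (F (s n) x - \<Phi> x) < e"
  proof (rule Arzela_Ascoli[of "{a..b}" F C])
    show "compact {a..b}" by (rule compact_Icc)
    show "norm (F n x) \<le> C" if "x \<in> {a..b}" for n x using Fbd[OF that] C[OF that] by (rule order_trans)
    fix x e :: real assume x: "x \<in> {a..b}" and "0 < e"
    then obtain d where d: "d > 0" "\<And>y. y \<in> {a..b} \<Longrightarrow> dist y x < d \<Longrightarrow> dist (G y) (G x) < e"
      using Gc[unfolded continuous_on_iff] by blast
    show "\<exists>d>0. \<forall>n y. y \<in> {a..b} \<and> norm (x - y) < d \<longrightarrow> norm (F n x - F n y) < e"
    proof (intro exI[of _ d] conjI allI impI d(1), elim conjE)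
      fix n y assume y: "y \<in> {a..b}" "norm (x - y) < d"
      then have "\<bar>G y - G x\<bar> < e" using d(2)[of y] by (auto simp: dist_real_def)
      then show "norm (F n x - F n y) < e" using diff[OF x y(1), of n] by (simp add: norm_minus_commute)
    qed
  qed (use that in blast)
  have lim\<Phi>: "(\<lambda>k. F (s k) t) \<longlonglongrightarrow> \<Phi> t" if "t \<in> {a..b}" for t
    using s(2) that by (intro LIMSEQ_I) blast
  have comp: "\<exists>h. integrable ?M h \<and> (\<forall>E\<in>sets ?M. (\<lambda>k. LINT x:E|?M. v (s k) x \<bullet> i) \<longlonglongrightarrow> (LINT x:E|?M. h x))"
    if i: "i \<in> Basis" for i
  proof -
    have int: "integrable ?M (\<lambda>x. v (s k) x \<bullet> i)" for k by (rule integrable_inner_left[OF vi])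
    have dm: "AE x in ?M. \<bar>v (s k) x \<bullet> i\<bar> \<le> g x" for k
      using dom[of "s k"] by (rule eventually_mono) (rule order_trans[OF Basis_le_norm[OF i]])
    have cv: "convergent (\<lambda>k. LINT x:{a..t}|?M. v (s k) x \<bullet> i)" if t: "t \<in> {a..b}" for t
    proof -
      have "(LINT x:{a..t}|?M. v (s k) x \<bullet> i) = F (s k) t \<bullet> i" for k
      proof -
        have "{a..t} \<in> sets ?M" using t by (auto simp: sets_restrict_space_iff)
        then have "integrable ?M (\<lambda>x. indicator {a..t} x *\<^sub>R v (s k) x)"
          by (rule integrable_mult_indicator[OF _ vi])
        from integral_inner_left[OF this, of i] show ?thesis
          using t by (simp add: F_def integral_prefix_eq[of t b] set_lebesgue_integral_def)
      qed
      then show ?thesis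
        using tendsto_inner[OF lim\<Phi>[OF t] tendsto_const[of i]] by (auto simp: convergent_def)
    qed
    obtain h where "integrable ?M h"
      "\<And>E. E \<in> sets ?M \<Longrightarrow> (\<lambda>k. LINT x:E|?M. v (s k) x \<bullet> i) \<longlonglongrightarrow> (LINT x:E|?M. h x)"
      by (rule dominated_set_limit_has_density[OF finite_measure_lebesgue_on[OF lmeasurable_interval(1)]
            g int dm convergent_set_integral_of_primitives[OF ab g int dm cv]]) (assumption, assumption, rule that)
    then show ?thesis by blast
  qed
  then obtain H where H: "\<And>i. i \<in> Basis \<Longrightarrow> integrable ?M (H i)"
    "\<And>i E. i \<in> Basis \<Longrightarrow> E \<in> sets ?M \<Longrightarrow> (\<lambda>k. LINT x:E|?M. v (s k) x \<bullet> i) \<longlonglongrightarrow> (LINT x:E|?M. H i x)"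
    by metis
  define V where "V x = (\<Sum>i\<in>Basis. H i x *\<^sub>R i)" for x
  have V: "integrable ?M V" unfolding V_def using H(1) by auto
  have Vi: "V x \<bullet> i = H i x" if "i \<in> Basis" for x i
    using that by (simp add: V_def inner_sum_left inner_Basis if_distrib cong: if_cong)
  have weak: "weak_L1 a b (\<lambda>k. v (s k)) V"
    unfolding weak_L1_def
  proof
    fix w :: "real \<Rightarrow> 'a" assume "w \<in> Linf a b"
    then obtain c where w: "w \<in> borel_measurable ?M" "AE t in ?M. norm (w t) \<le> c" by (auto simp: Linf_def)
    have wi: "(\<lambda>t. w t \<bullet> i) \<in> borel_measurable ?M" "AE t in ?M. \<bar>w t \<bullet> i\<bar> \<le> c" if "i \<in> Basis" for i
    proof -
      show "(\<lambda>t. w t \<bullet> i) \<in> borel_measurable ?M" using w(1) by measurable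
      show "AE t in ?M. \<bar>w t \<bullet> i\<bar> \<le> c"
        using w(2) by (rule eventually_mono) (rule order_trans[OF Basis_le_norm[OF that]])
    qed
    have split: "(LINT t|?M. w t \<bullet> F t) = (\<Sum>i\<in>Basis. LINT t|?M. (w t \<bullet> i) * (F t \<bullet> i))"
      if F: "integrable ?M F" for F
    proof -
      have "integrable ?M (\<lambda>t. (w t \<bullet> i) * (F t \<bullet> i))" if i: "i \<in> Basis" for i
      proof (rule Bochner_Integration.integrable_bound[of _ "\<lambda>t. c * (F t \<bullet> i)"])
        show "AE t in ?M. norm ((w t \<bullet> i) * (F t \<bullet> i)) \<le> norm (c * (F t \<bullet> i))"
          using wi(2)[OF i]
        proof eventually_elim
          case (elim t)
          then have "\<bar>w t \<bullet> i\<bar> * \<bar>F t \<bullet> i\<bar> \<le> \<bar>c\<bar> * \<bar>F t \<bullet> i\<bar>" by (intro mult_right_mono) auto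
          then show ?case by (simp add: abs_mult)
        qed
        show "integrable ?M (\<lambda>t. c * (F t \<bullet> i))"
          by (rule Bochner_Integration.integrable_mult_right[OF integrable_inner_left[OF F]])
        show "(\<lambda>t. (w t \<bullet> i) * (F t \<bullet> i)) \<in> borel_measurable ?M"
          by (rule borel_measurable_times[OF wi(1)[OF i] borel_measurable_integrable[OF integrable_inner_left[OF F]]])
      qed
      then show ?thesis by (subst euclidean_inner) (rule Bochner_Integration.integral_sum)
    qed
    show "(\<lambda>k. LINT t|?M. w t \<bullet> v (s k) t) \<longlonglongrightarrow> (LINT t|?M. w t \<bullet> V t)"
      unfolding split[OF vi] split[OF V]
    proof (rule tendsto_sum)
      fix i :: 'a assume i: "i \<in> Basis"
      show "(\<lambda>k. LINT t|?M. (w t \<bullet> i) * (v (s k) t \<bullet> i)) \<longlonglongrightarrow> (LINT t|?M. (w t \<bullet> i) * (V t \<bullet> i))"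
        unfolding Vi[OF i]
      proof (rule set_limit_imp_bounded_test[OF g _ H(1)[OF i] _ H(2)[OF i] wi(1)[OF i] wi(2)[OF i]])
        show "integrable ?M (\<lambda>x. v (s k) x \<bullet> i)" for k by (rule integrable_inner_left[OF vi])
        show "AE x in ?M. \<bar>v (s k) x \<bullet> i\<bar> \<le> g x" for k
          using dom[of "s k"] by (rule eventually_mono) (rule order_trans[OF Basis_le_norm[OF i]])
      qed
    qed
  qed
  have \<Phi>: "\<Phi> t = (LINT \<tau>|lebesgue_on {a..t}. V \<tau>)" if t: "t \<in> {a..b}" for t
  proof (rule euclidean_eqI)
    fix i :: 'a assume i: "i \<in> Basis"
    have E: "{a..t} \<in> sets ?M" using t by (auto simp: sets_restrict_space_iff)
    have comp: "(LINT x:{a..t}|?M. h x \<bullet> i) = (LINT \<tau>|lebesgue_on {a..t}. h \<tau>) \<bullet> i" if "integrable ?M h" for h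
    proof -
      have "t \<le> b" using t by simp
      then show ?thesis
        using integral_inner_left[OF integrable_mult_indicator[OF E that], of i]
        by (simp add: integral_prefix_eq[of t b a] set_lebesgue_integral_def)
    qed
    have "(\<lambda>k. F (s k) t \<bullet> i) \<longlonglongrightarrow> (LINT \<tau>|lebesgue_on {a..t}. V \<tau>) \<bullet> i"
    proof -
      have 1: "(LINT x:{a..t}|?M. v (s k) x \<bullet> i) = F (s k) t \<bullet> i" for k
        using comp[OF vi] by (simp only: F_def)
      have 2: "(LINT x:{a..t}|?M. H i x) = (LINT \<tau>|lebesgue_on {a..t}. V \<tau>) \<bullet> i"
        using comp[OF V] by (simp only: Vi[OF i])
      show ?thesis using H(2)[OF i E] by (simp only: 1 2)
    qed
    moreover have "(\<lambda>k. F (s k) t \<bullet> i) \<longlonglongrightarrow> \<Phi> t \<bullet> i"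
      by (intro tendsto_inner lim\<Phi> t tendsto_const)
    ultimately show "\<Phi> t \<bullet> i = (LINT \<tau>|lebesgue_on {a..t}. V \<tau>) \<bullet> i"
      by (rule LIMSEQ_unique[symmetric])
  qed
  have "uniform_limit {a..b} (\<lambda>k. F (s k)) (\<lambda>t. LINT \<tau>|lebesgue_on {a..t}. V \<tau>) sequentially"
  proof (rule uniform_limitI)
    fix e :: real assume "e > 0"
    from s(2)[OF this] obtain N where "\<And>n x. n \<ge> N \<Longrightarrow> x \<in> {a..b} \<Longrightarrow> norm (F (s n) x - \<Phi> x) < e" by blast
    then show "\<forall>\<^sub>F n in sequentially. \<forall>x\<in>{a..b}.
      dist (F (s n) x) (LINT \<tau>|lebesgue_on {a..x}. V \<tau>) < e"
      by (intro eventually_sequentiallyI[of N] ballI) (simp add: dist_norm \<Phi>)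
  qed
  then have u: "uniform_limit {a..b} (\<lambda>k t. LINT \<tau>|lebesgue_on {a..t}. v (s k) \<tau>)
    (\<lambda>t. LINT \<tau>|lebesgue_on {a..t}. V \<tau>) sequentially" by (simp only: F_def[abs_def])
  show thesis by (rule that[OF s(1) _ weak u]) (simp add: V)
qed

section \<open>Weak limits and closed convex hulls\<close>

lemma Linf_inner_integrable:
  assumes w: "w \<in> Linf a b" and f: "f \<in> L1 a b"
  shows "integrable (lebesgue_on {a..b}) (\<lambda>t. w t \<bullet> f t)"
proof -
  let ?M = "lebesgue_on {a..b}"
  obtain c where c: "w \<in> borel_measurable ?M" "AE t in ?M. norm (w t) \<le> c"
    using w by (auto simp: Linf_def)
  have fi: "integrable ?M f" using f by simp
  show ?thesis
  proof (rule Bochner_Integration.integrable_bound[of _ "\<lambda>t. c * norm (f t)"])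
    show "integrable ?M (\<lambda>t. c * norm (f t))"
      by (rule Bochner_Integration.integrable_mult_right[OF integrable_norm[OF fi]])
    show "(\<lambda>t. w t \<bullet> f t) \<in> borel_measurable ?M"
      by (rule borel_measurable_inner[OF c(1) borel_measurable_integrable[OF fi]])
    show "AE t in ?M. norm (w t \<bullet> f t) \<le> norm (c * norm (f t))"
    proof (rule eventually_mono[OF c(2)])
      fix t assume "norm (w t) \<le> c"
      then have "norm (w t) * norm (f t) \<le> c * norm (f t)" by (rule mult_right_mono) simp
      moreover have "\<bar>w t \<bullet> f t\<bar> \<le> norm (w t) * norm (f t)" by (rule Cauchy_Schwarz_ineq2)
      ultimately show "norm (w t \<bullet> f t) \<le> norm (c * norm (f t))"
        unfolding real_norm_def by linarith
    qed
  qed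
qed

lemma integrable_Pair_fun:
  fixes f :: "'z \<Rightarrow> 'c::euclidean_space" and g :: "'z \<Rightarrow> 'd::euclidean_space"
  assumes "integrable M f" "integrable M g"
  shows "integrable M (\<lambda>t. (f t, g t))"
proof -
  have b: "bounded_linear (\<lambda>x::'c. (x, 0::'d))" "bounded_linear (\<lambda>y::'d. (0::'c, y))"
    by (intro bounded_linear_Pair bounded_linear_ident bounded_linear_zero)+
  from Bochner_Integration.integrable_add[OF integrable_bounded_linear[OF b(1) assms(1)]
      integrable_bounded_linear[OF b(2) assms(2)]]
  show ?thesis by simp
qed

lemma weak_L1_subseq:
  assumes "weak_L1 a b us u" "strict_mono s"
  shows "weak_L1 a b (\<lambda>k. us (s k)) u"
  unfolding weak_L1_def
proof
  fix w :: "real \<Rightarrow> 'a" assume w: "w \<in> Linf a b"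
  from LIMSEQ_subseq_LIMSEQ[OF bspec[OF assms(1)[unfolded weak_L1_def] w] assms(2)]
  show "(\<lambda>k. LINT t|lebesgue_on {a..b}. w t \<bullet> us (s k) t) \<longlonglongrightarrow> (LINT t|lebesgue_on {a..b}. w t \<bullet> u t)"
    unfolding o_def .
qed

text \<open>The adjoint of \<open>L\<close> moves the linear map to the test function.\<close>

lemma weak_L1_linear_image:
  fixes L :: "'a::euclidean_space \<Rightarrow> 'b::euclidean_space"
  assumes weak: "weak_L1 a b us u" and L: "linear L"
  shows "weak_L1 a b (\<lambda>k t. L (us k t)) (\<lambda>t. L (u t))"
  unfolding weak_L1_def
proof
  fix w :: "real \<Rightarrow> 'b" assume "w \<in> Linf a b"
  then obtain c where c: "w \<in> borel_measurable (lebesgue_on {a..b})"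
    "AE t in lebesgue_on {a..b}. norm (w t) \<le> c"
    by (auto simp: Linf_def)
  have lin: "bounded_linear (adjoint L)"
    by (rule linear_conv_bounded_linear[THEN iffD1, OF adjoint_linear[OF L]])
  then obtain B where B: "B > 0" "\<And>y. norm (adjoint L y) \<le> norm y * B"
    using bounded_linear.pos_bounded by blast
  have "(\<lambda>t. adjoint L (w t)) \<in> Linf a b"
    unfolding Linf_def
  proof (intro CollectI conjI exI)
    show "(\<lambda>t. adjoint L (w t)) \<in> borel_measurable (lebesgue_on {a..b})"
      by (rule borel_measurable_continuous_on[OF linear_continuous_on[OF lin] c(1)])
    show "AE t in lebesgue_on {a..b}. norm (adjoint L (w t)) \<le> c * B"
      using c(2)
    proof (rule eventually_mono)
      fix t assume "norm (w t) \<le> c"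
      then have "norm (w t) * B \<le> c * B" using B(1) by simp
      then show "norm (adjoint L (w t)) \<le> c * B" using B(2)[of "w t"] by linarith
    qed
  qed
  then have "(\<lambda>k. LINT t|lebesgue_on {a..b}. adjoint L (w t) \<bullet> us k t)
    \<longlonglongrightarrow> (LINT t|lebesgue_on {a..b}. adjoint L (w t) \<bullet> u t)"
    by (rule bspec[OF weak[unfolded weak_L1_def]])
  moreover have "adjoint L y \<bullet> x = y \<bullet> L x" for x y
    using adjoint_works[OF L, of x y] by (simp add: inner_commute)
  ultimately show "(\<lambda>k. LINT t|lebesgue_on {a..b}. w t \<bullet> L (us k t))
    \<longlonglongrightarrow> (LINT t|lebesgue_on {a..b}. w t \<bullet> L (u t))"
    by simp
qed

lemma weak_L1_diff:
  assumes us: "\<And>k. us k \<in> L1 a b" "u \<in> L1 a b" "weak_L1 a b us u"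
    and vs: "\<And>k. vs k \<in> L1 a b" "v \<in> L1 a b" "weak_L1 a b vs v"
  shows "weak_L1 a b (\<lambda>k t. us k t - vs k t) (\<lambda>t. u t - v t)"
  unfolding weak_L1_def
proof
  fix w :: "real \<Rightarrow> 'a" assume w: "w \<in> Linf a b"
  have eq: "(LINT t|lebesgue_on {a..b}. w t \<bullet> (f t - g t)) =
    (LINT t|lebesgue_on {a..b}. w t \<bullet> f t) - (LINT t|lebesgue_on {a..b}. w t \<bullet> g t)"
    if "f \<in> L1 a b" "g \<in> L1 a b" for f g
    unfolding inner_diff_right
    by (rule Bochner_Integration.integral_diff[OF Linf_inner_integrable[OF w that(1)] Linf_inner_integrable[OF w that(2)]])
  show "(\<lambda>k. LINT t|lebesgue_on {a..b}. w t \<bullet> (us k t - vs k t))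
    \<longlonglongrightarrow> (LINT t|lebesgue_on {a..b}. w t \<bullet> (u t - v t))"
    unfolding eq[OF us(1) vs(1)] eq[OF us(2) vs(2)]
    by (rule tendsto_diff[OF bspec[OF us(3)[unfolded weak_L1_def] w] bspec[OF vs(3)[unfolded weak_L1_def] w]])
qed

text \<open>Testing with \<open>w\<close> times the indicator of the set where the implication fails shows that the integral of a
function which is positive on that set is not positive.\<close>

lemma weak_L1_AE_halfspace:
  fixes us :: "nat \<Rightarrow> real \<Rightarrow> 'a::euclidean_space"
  assumes us: "\<And>k. us k \<in> L1 a b" and u: "u \<in> L1 a b" and weak: "weak_L1 a b us u"
  shows "AE t in lebesgue_on {a..b}. (\<forall>k\<ge>N. c \<le> w \<bullet> us k t) \<longrightarrow> c \<le> w \<bullet> u t"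
proof -
  let ?M = "lebesgue_on {a..b}"
  interpret finite_measure ?M by (rule finite_measure_lebesgue_on[OF lmeasurable_interval(1)])
  have [measurable]: "us k \<in> borel_measurable ?M" "u \<in> borel_measurable ?M" for k
    using us[of k] u by (auto intro: borel_measurable_integrable)
  \<comment> \<open>The set on which the claim fails.\<close>
  define E where "E = {t \<in> space ?M. (\<forall>k\<in>{N..}. c \<le> w \<bullet> us k t) \<and> w \<bullet> u t < c}"
  have E[measurable]: "E \<in> sets ?M" unfolding E_def by measurable
  have wE: "(\<lambda>t. indicator E t *\<^sub>R w) \<in> Linf a b"
    unfolding Linf_def
    by (intro CollectI conjI exI[of _ "norm w"] AE_I2) (measurable, simp add: indicator_def)
  have intE: "integrable ?M (\<lambda>t. indicator E t * c)"
    using integrable_mult_indicator[OF E integrable_const[of c]] by simp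
  have lim: "(\<lambda>k. LINT t|?M. (indicator E t *\<^sub>R w) \<bullet> us k t) \<longlonglongrightarrow> (LINT t|?M. (indicator E t *\<^sub>R w) \<bullet> u t)"
    by (rule bspec[OF weak[unfolded weak_L1_def] wE])
  have "(LINT t|?M. indicator E t * c) \<le> (LINT t|?M. (indicator E t *\<^sub>R w) \<bullet> us k t)" if "k \<ge> N" for k
    by (rule integral_mono[OF intE Linf_inner_integrable[OF wE us]])
      (use that in \<open>simp add: indicator_def E_def\<close>)
  then have le: "(LINT t|?M. indicator E t * c) \<le> (LINT t|?M. (indicator E t *\<^sub>R w) \<bullet> u t)"
    by (intro tendsto_lowerbound[OF lim] eventually_sequentiallyI[of N]) auto
  let ?d = "\<lambda>t. indicator E t * c - (indicator E t *\<^sub>R w) \<bullet> u t"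
  have d: "integrable ?M ?d"
    by (rule Bochner_Integration.integrable_diff[OF intE Linf_inner_integrable[OF wE u]])
  have nonneg: "0 \<le> ?d t" for t by (simp add: indicator_def E_def)
  have "(LINT t|?M. ?d t) \<le> 0"
    using le Bochner_Integration.integral_diff[OF intE Linf_inner_integrable[OF wE u]] by linarith
  moreover have "0 \<le> (LINT t|?M. ?d t)" by (rule Bochner_Integration.integral_nonneg) (rule nonneg)
  ultimately have "(LINT t|?M. ?d t) = 0" by linarith
  then have "AE t in ?M. ?d t = 0"
    using integral_nonneg_eq_0_iff_AE[OF d AE_I2[OF nonneg]] by blast
  then show ?thesis
    using AE_space[of ?M]
  proof eventually_elim
    case (elim t)
    have "t \<notin> E"
    proof
      assume "t \<in> E"
      then have "c - w \<bullet> u t = 0" "w \<bullet> u t < c" using elim(1) by (simp_all add: E_def)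
      then show False by simp
    qed
    then show ?case using elim(2) unfolding E_def by (auto simp: not_less)
  qed
qed

text \<open>A pointwise form of Mazur's lemma. Half-spaces with normal in a countable dense set and rational offset
suffice: a strict separation at a time \<open>t\<close> survives a small change of the normal, since the vectors \<open>us k t\<close> are
bounded in \<open>k\<close>. Hence one null set serves for all half-spaces and all tails.\<close>

lemma weak_L1_AE_in_closed_hull:
  fixes us :: "nat \<Rightarrow> real \<Rightarrow> 'a::euclidean_space"
  assumes us: "\<And>k. us k \<in> L1 a b" and u: "u \<in> L1 a b" and weak: "weak_L1 a b us u"
    and dom: "\<And>k. AE t in lebesgue_on {a..b}. norm (us k t) \<le> g t"
  shows "AE t in lebesgue_on {a..b}. \<forall>N. u t \<in> closure (convex hull ((\<lambda>k. us k t) ` {N..}))"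
proof -
  let ?M = "lebesgue_on {a..b}"
  obtain D :: "'a set" where D: "countable D" "\<And>X. open X \<Longrightarrow> X \<noteq> {} \<Longrightarrow> \<exists>d\<in>D. d \<in> X"
    using countable_dense_exists by blast
  have "AE t in ?M. \<forall>w\<in>D. \<forall>c\<in>\<rat>. \<forall>N::nat. (\<forall>k\<ge>N. c \<le> w \<bullet> us k t) \<longrightarrow> c \<le> w \<bullet> u t"
    using weak_L1_AE_halfspace[OF us u weak]
    by (simp only: AE_ball_countable[OF D(1)] AE_ball_countable[OF countable_rat] AE_all_countable) blast
  moreover have "AE t in ?M. \<forall>k. norm (us k t) \<le> g t"
    using dom by (simp add: AE_all_countable)
  ultimately show ?thesis
  proof eventually_elim
    case (elim t)
    show ?case
    proof (rule allI, rule ccontr)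
      fix N assume "u t \<notin> closure (convex hull ((\<lambda>k. us k t) ` {N..}))"
      then obtain w0 \<beta> where w0: "w0 \<bullet> u t < \<beta>"
        "\<And>x. x \<in> closure (convex hull ((\<lambda>k. us k t) ` {N..})) \<Longrightarrow> \<beta> < w0 \<bullet> x"
        using separating_hyperplane_closed_point[OF convex_closure[OF convex_convex_hull] closed_closure] by blast
      have sep: "\<beta> < w0 \<bullet> us k t" if "k \<ge> N" for k
        by (rule w0(2)[OF subsetD[OF closure_subset]], rule hull_inc) (use that in simp)
      \<comment> \<open>A third of the gap: one third each for the two changes of normal, and one for the rational offset between them.\<close>
      define e where "e = (\<beta> - w0 \<bullet> u t) / 3"
      have e: "e > 0" using w0(1) by (simp add: e_def)
      define R where "R = \<bar>g t\<bar> + norm (u t) + 1"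
      have R: "R > 0" by (simp add: R_def add_nonneg_pos)
      obtain w where w: "w \<in> D" "norm (w0 - w) < e / R"
      proof -
        have "e / R > 0" using e R by simp
        then have "\<exists>d\<in>D. d \<in> ball w0 (e / R)" by (intro D(2)) simp_all
        then show thesis using that by (auto simp: dist_norm)
      qed
      have close: "\<bar>w0 \<bullet> x - w \<bullet> x\<bar> < e" if "norm x \<le> R" for x
      proof -
        have "\<bar>w0 \<bullet> x - w \<bullet> x\<bar> \<le> norm (w0 - w) * norm x"
          unfolding inner_diff_left[symmetric] by (rule Cauchy_Schwarz_ineq2)
        also have "\<dots> \<le> norm (w0 - w) * R" using that by (rule mult_left_mono) simp
        also have "\<dots> < e / R * R" by (rule mult_strict_right_mono[OF w(2) R])
        finally show ?thesis using R by simp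
      qed
      have "w0 \<bullet> u t + e < \<beta> - e" using w0(1) unfolding e_def by argo
      then obtain c where c: "c \<in> \<rat>" "w0 \<bullet> u t + e < c" "c < \<beta> - e"
        using Rats_dense_in_real by blast
      have "c \<le> w \<bullet> us k t" if "k \<ge> N" for k
      proof -
        have "norm (us k t) \<le> g t" using elim(2) by simp
        then have "norm (us k t) \<le> R" using norm_ge_zero[of "u t"] abs_ge_self[of "g t"]
          unfolding R_def by linarith
        from close[OF this] sep[OF that] c(3) show ?thesis by linarith
      qed
      then have "c \<le> w \<bullet> u t" using elim(1) w(1) c(1) by blast
      moreover have "norm (u t) \<le> R" by (simp add: R_def)
      from close[OF this] have "\<bar>w0 \<bullet> u t - w \<bullet> u t\<bar> < e" .
      ultimately show False using c(2) by linarith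
    qed
  qed
qed

text \<open>If \<open>u\<close> were separated from the hull of \<open>A0\<close>, then by compactness the sets \<open>A k\<close> with large \<open>k\<close> would lie on the
side of \<open>A0\<close>, and so would the closed hull of a tail, which contains \<open>u\<close>.\<close>

lemma closed_hull_tails_imp_hull_limit:
  fixes us :: "nat \<Rightarrow> 'a::euclidean_space"
  assumes us: "\<And>k. us k \<in> convex hull (A k)" and bdd: "\<And>k v. v \<in> A k \<Longrightarrow> norm v \<le> R"
    and lim: "\<And>r vs v. strict_mono r \<Longrightarrow> (\<And>j. vs j \<in> A (r j)) \<Longrightarrow> vs \<longlonglongrightarrow> v \<Longrightarrow> v \<in> A0"
    and A0: "compact A0" and u: "\<And>N. u \<in> closure (convex hull (us ` {N..}))"
  shows "u \<in> convex hull A0"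
proof (rule ccontr)
  assume "u \<notin> convex hull A0"
  moreover have "closed (convex hull A0)"
    by (rule compact_imp_closed[OF compact_convex_hull[OF A0]])
  ultimately have "\<exists>w \<beta>. w \<bullet> u < \<beta> \<and> (\<forall>x\<in>convex hull A0. \<beta> < w \<bullet> x)"
    by (intro separating_hyperplane_closed_point convex_convex_hull)
  then obtain w \<beta> where w: "w \<bullet> u < \<beta>" "\<And>x. x \<in> convex hull A0 \<Longrightarrow> \<beta> < w \<bullet> x"
    by blast
  have "\<exists>N. \<forall>k\<ge>N. \<forall>v\<in>A k. \<beta> \<le> w \<bullet> v"
  proof (rule ccontr)
    assume "\<nexists>N. \<forall>k\<ge>N. \<forall>v\<in>A k. \<beta> \<le> w \<bullet> v"
    then have "infinite {k. \<exists>v\<in>A k. w \<bullet> v < \<beta>}"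
      unfolding infinite_nat_iff_unbounded_le by (simp add: not_le)
    from infinite_enumerate[OF this] obtain r :: "nat \<Rightarrow> nat"
      where r: "strict_mono r" "\<forall>j. r j \<in> {k. \<exists>v\<in>A k. w \<bullet> v < \<beta>}" by blast
    define vs where "vs j = (SOME v. v \<in> A (r j) \<and> w \<bullet> v < \<beta>)" for j
    have "vs j \<in> A (r j) \<and> w \<bullet> vs j < \<beta>" for j
    proof -
      have "\<exists>v. v \<in> A (r j) \<and> w \<bullet> v < \<beta>" using r(2) by auto
      then show ?thesis unfolding vs_def by (rule someI_ex)
    qed
    then have vs: "\<And>j. vs j \<in> A (r j)" "\<And>j. w \<bullet> vs j < \<beta>" by simp_all
    have "bounded (range vs)" unfolding bounded_iff by (rule exI[of _ R]) (use bdd[OF vs(1)] in simp)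
    then obtain l r' where l: "strict_mono (r'::nat\<Rightarrow>nat)" "(vs \<circ> r') \<longlonglongrightarrow> l"
      using bounded_imp_convergent_subsequence by blast
    have "l \<in> A0"
      by (rule lim[OF strict_mono_o[OF r(1) l(1)] _ l(2)]) (simp add: vs(1))
    then have "\<beta> < w \<bullet> l" by (intro w(2) hull_inc)
    moreover have "(\<lambda>j. w \<bullet> (vs \<circ> r') j) \<longlonglongrightarrow> w \<bullet> l" by (intro tendsto_inner tendsto_const l(2))
    then have "w \<bullet> l \<le> \<beta>"
      by (rule LIMSEQ_le_const2) (use vs(2) in \<open>simp add: less_imp_le\<close>)
    ultimately show False by simp
  qed
  then obtain N where N: "\<And>k v. k \<ge> N \<Longrightarrow> v \<in> A k \<Longrightarrow> \<beta> \<le> w \<bullet> v" by blast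
  let ?H = "{x. \<beta> \<le> w \<bullet> x}"
  have H: "convex ?H" "closed ?H"
    using convex_halfspace_ge[of \<beta> w] closed_halfspace_ge[of \<beta> w] by simp_all
  have "us k \<in> ?H" if "k \<ge> N" for k
  proof (rule subsetD[OF hull_minimal us[of k]])
    show "A k \<subseteq> ?H" using N[OF that] by (intro subsetI CollectI)
  qed (rule H(1))
  then have "us ` {N..} \<subseteq> ?H" by (intro image_subsetI) simp
  then have "convex hull (us ` {N..}) \<subseteq> ?H" by (rule hull_minimal) (rule H(1))
  then have "closure (convex hull (us ` {N..})) \<subseteq> ?H" by (rule closure_minimal[OF _ H(2)])
  from subsetD[OF this u[of N]] w(1) show False by simp
qed

section \<open>Measurability and bounds along trajectories\<close>

lemma lebesgue_on_measurable_cong_AE: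
  fixes f g :: "real \<Rightarrow> 'a::euclidean_space"
  assumes f: "f \<in> borel_measurable (lebesgue_on S)" and S: "S \<in> sets lebesgue"
    and eq: "AE t in lebesgue_on S. f t = g t"
  shows "g \<in> borel_measurable (lebesgue_on S)"
proof -
  have S': "S \<inter> space lebesgue \<in> sets lebesgue" using S by simp
  have "(\<lambda>t. indicator S t *\<^sub>R f t) \<in> borel_measurable lebesgue"
    using f unfolding borel_measurable_restrict_space_iff[OF S'] .
  moreover have "AE t in lebesgue. t \<in> S \<longrightarrow> f t = g t"
    using eq unfolding AE_restrict_space_iff[OF S'] .
  then have "AE t in lebesgue. indicator S t *\<^sub>R f t = indicator S t *\<^sub>R g t"
    by (rule eventually_mono) (auto simp: indicator_def)
  ultimately have "(\<lambda>t. indicator S t *\<^sub>R g t) \<in> borel_measurable lebesgue"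
    by (rule borel_measurable_AE)
  then show ?thesis unfolding borel_measurable_restrict_space_iff[OF S'] .
qed

lemma lebesgue_on_measurable_AE_limit:
  fixes F :: "nat \<Rightarrow> real \<Rightarrow> 'a::euclidean_space"
  assumes F: "\<And>n. F n \<in> borel_measurable (lebesgue_on S)" and S: "S \<in> sets lebesgue"
    and lim: "AE t in lebesgue_on S. (\<lambda>n. F n t) \<longlonglongrightarrow> f t"
  shows "f \<in> borel_measurable (lebesgue_on S)"
proof (rule lebesgue_on_measurable_cong_AE[OF _ S])
  show "(\<lambda>t. lim (\<lambda>n. F n t)) \<in> borel_measurable (lebesgue_on S)"
    by (rule borel_measurable_lim_metric[OF F])
  show "AE t in lebesgue_on S. lim (\<lambda>n. F n t) = f t"
    using lim by (rule eventually_mono) (rule limI)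
qed

text \<open>The Caratheodory argument with continuity required only at the points \<open>w t\<close> and only for \<open>t\<close> in \<open>A\<close>: the
constraint functions are regular merely on a ball that moves with \<open>t\<close>, so continuity on the whole
space is not available.\<close>

lemma lebesgue_on_measurable_compose_isCont:
  fixes h :: "real \<Rightarrow> 'a::euclidean_space \<Rightarrow> real"
  assumes S: "S \<in> sets lebesgue" and h: "\<And>y. (\<lambda>t. h t y) \<in> borel_measurable (lebesgue_on S)"
    and w: "w \<in> borel_measurable (lebesgue_on S)" and A: "A \<in> sets (lebesgue_on S)"
    and cont: "AE t in lebesgue_on S. t \<in> A \<longrightarrow> isCont (h t) (w t)"
  shows "(\<lambda>t. indicator A t * h t (w t)) \<in> borel_measurable (lebesgue_on S)"
proof -
  let ?M = "lebesgue_on S"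
  obtain F where F: "\<forall>i. simple_function ?M (F i)" "\<forall>t\<in>space ?M. (\<lambda>i. F i t) \<longlonglongrightarrow> w t"
    using borel_measurable_implies_sequence_metric[OF w, of 0] by blast
  show ?thesis
  proof (rule lebesgue_on_measurable_AE_limit[OF _ S])
    show "(\<lambda>t. indicator A t * h t (F i t)) \<in> borel_measurable ?M" for i
    proof -
      have sf: "simple_function ?M (F i)" using F(1) by simp
      have fin: "finite (F i ` space ?M)" using simple_functionD(1)[OF sf] .
      have sets: "F i -` {y} \<inter> space ?M \<in> sets ?M" for y using simple_functionD(2)[OF sf] .
      have "(\<lambda>t. \<Sum>y\<in>F i ` space ?M. indicator (F i -` {y} \<inter> space ?M) t * h t y) \<in> borel_measurable ?M"
        by (intro borel_measurable_sum borel_measurable_times borel_measurable_indicator sets h)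
      moreover have "(\<Sum>y\<in>F i ` space ?M. indicator (F i -` {y} \<inter> space ?M) t * h t y) = h t (F i t)"
        if t: "t \<in> space ?M" for t
      proof -
        have "(\<Sum>y\<in>F i ` space ?M. indicator (F i -` {y} \<inter> space ?M) t * h t y) =
          (\<Sum>y\<in>F i ` space ?M. if y = F i t then h t (F i t) else 0)"
          using t by (intro sum.cong) (simp_all add: indicator_def)
        also have "\<dots> = h t (F i t)" using fin t by simp
        finally show ?thesis .
      qed
      ultimately have "(\<lambda>t. h t (F i t)) \<in> borel_measurable ?M"
        by (subst measurable_cong[of _ _ "\<lambda>t. \<Sum>y\<in>F i ` space ?M. indicator (F i -` {y} \<inter> space ?M) t * h t y"]) simp_all
      then show ?thesis by (intro borel_measurable_times borel_measurable_indicator A)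
    qed
    show "AE t in ?M. (\<lambda>i. indicator A t * h t (F i t)) \<longlonglongrightarrow> indicator A t * h t (w t)"
      using cont AE_space[of ?M]
    proof eventually_elim
      case (elim t)
      show ?case
      proof (cases "t \<in> A")
        case True
        then have "isCont (h t) (w t)" using elim(1) by blast
        moreover have "(\<lambda>i. F i t) \<longlonglongrightarrow> w t" using F(2) elim(2) by blast
        ultimately have "(\<lambda>i. h t (F i t)) \<longlonglongrightarrow> h t (w t)" by (rule isCont_tendsto_compose)
        then show ?thesis by (rule tendsto_mult_left)
      qed simp
    qed
  qed
qed

lemma GDERIV_difference_quotient:
  fixes x e :: "'a::euclidean_space"
  assumes "GDERIV h x :> D"
  shows "(\<lambda>n. (h (x + e /\<^sub>R real (Suc n)) - h x) * real (Suc n)) \<longlonglongrightarrow> D \<bullet> e"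
proof (rule LIMSEQ_I)
  fix \<epsilon> :: real assume "\<epsilon> > 0"
  define c where "c = \<epsilon> / (2 * (norm e + 1))"
  have ne: "norm e + 1 > 0" by (simp add: add_nonneg_pos)
  have c: "c > 0" unfolding c_def using \<open>\<epsilon> > 0\<close> ne by simp
  obtain d where d: "d > 0" "\<And>y. norm (y - x) < d \<Longrightarrow> \<bar>h y - h x - D \<bullet> (y - x)\<bar> \<le> c * norm (y - x)"
    using GDERIV_eps[OF assms c] by blast
  have "(\<lambda>n. norm e * inverse (real (Suc n))) \<longlonglongrightarrow> norm e * 0"
    by (intro tendsto_mult tendsto_const LIMSEQ_inverse_real_of_nat)
  then have "\<forall>\<^sub>F n in sequentially. norm e * inverse (real (Suc n)) < d"
    by (rule order_tendstoD(2)) (use d in simp)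
  then obtain N where N: "\<And>n. n \<ge> N \<Longrightarrow> norm e * inverse (real (Suc n)) < d"
    unfolding eventually_sequentially by blast
  show "\<exists>N. \<forall>n\<ge>N. norm ((h (x + e /\<^sub>R real (Suc n)) - h x) * real (Suc n) - D \<bullet> e) < \<epsilon>"
  proof (intro exI[of _ N] allI impI)
    fix n assume n: "n \<ge> N"
    let ?m = "real (Suc n)"
    have m: "?m > 0" by simp
    let ?y = "x + e /\<^sub>R ?m"
    have ny: "norm (?y - x) = norm e * inverse ?m" by simp
    have "\<bar>h ?y - h x - D \<bullet> (?y - x)\<bar> \<le> c * (norm e * inverse ?m)"
      using d(2)[of ?y] N[OF n] unfolding ny by blast
    then have "\<bar>h ?y - h x - D \<bullet> (?y - x)\<bar> * ?m \<le> c * (norm e * inverse ?m) * ?m"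
      by (rule mult_right_mono) simp
    also have "\<dots> = c * norm e" using m by simp
    also have "c * norm e < \<epsilon>"
    proof -
      have "c * norm e \<le> c * (norm e + 1)" using c by simp
      also have "\<dots> = \<epsilon> / 2" using ne unfolding c_def by (simp add: field_simps)
      finally show ?thesis using \<open>\<epsilon> > 0\<close> by simp
    qed
    finally have "\<bar>h ?y - h x - D \<bullet> (?y - x)\<bar> * ?m < \<epsilon>" .
    moreover have "(h ?y - h x) * ?m - D \<bullet> e = (h ?y - h x - D \<bullet> (?y - x)) * ?m"
      using m by (simp add: left_diff_distrib)
    ultimately show "norm ((h ?y - h x) * ?m - D \<bullet> e) < \<epsilon>"
      using m by (simp add: abs_mult del: of_nat_Suc)
  qed
qed

text \<open>The gradient is a limit of difference quotients. The shifted point \<open>w t + e / n\<close> may leave the ball for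
small \<open>n\<close>; the sets \<open>A n\<close> cut out the times at which it has not, and every time belongs to \<open>A n\<close> for
large \<open>n\<close>.\<close>

lemma lebesgue_on_measurable_grad:
  fixes h :: "real \<Rightarrow> 'a::euclidean_space \<Rightarrow> real"
  assumes S: "S \<in> sets lebesgue" and h: "\<And>y. (\<lambda>t. h t y) \<in> borel_measurable (lebesgue_on S)"
    and w: "w \<in> borel_measurable (lebesgue_on S)" and c: "c \<in> borel_measurable (lebesgue_on S)"
    and ball: "AE t in lebesgue_on S. dist (w t) (c t) < \<delta>"
    and diff: "AE t in lebesgue_on S. \<forall>z\<in>ball (c t) \<delta>. h t differentiable (at z)"
  shows "(\<lambda>t. grad (h t) (w t)) \<in> borel_measurable (lebesgue_on S)"
proof -
  let ?M = "lebesgue_on S"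
  have comp: "(\<lambda>t. grad (h t) (w t) \<bullet> e) \<in> borel_measurable ?M" for e
  proof -
    define A where "A n = {t \<in> space ?M. dist (w t + e /\<^sub>R real (Suc n)) (c t) < \<delta>}" for n
    have we: "(\<lambda>t. w t + e /\<^sub>R real (Suc n)) \<in> borel_measurable ?M" for n
      by (intro borel_measurable_add w borel_measurable_const)
    have A: "A n \<in> sets ?M" for n
      unfolding A_def by (intro borel_measurable_less borel_measurable_dist we c borel_measurable_const)
    have m1: "(\<lambda>t. indicator (A n) t * h t (w t + e /\<^sub>R real (Suc n))) \<in> borel_measurable ?M" for n
    proof (rule lebesgue_on_measurable_compose_isCont[OF S h we A])
      show "AE t in ?M. t \<in> A n \<longrightarrow> isCont (h t) (w t + e /\<^sub>R real (Suc n))"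
        using diff
      proof (rule eventually_mono, intro impI)
        fix t assume *: "\<forall>z\<in>ball (c t) \<delta>. h t differentiable (at z)" "t \<in> A n"
        then have "w t + e /\<^sub>R real (Suc n) \<in> ball (c t) \<delta>" by (simp add: A_def dist_commute)
        with *(1) show "isCont (h t) (w t + e /\<^sub>R real (Suc n))"
          by (blast intro: differentiable_imp_continuous_within)
      qed
    qed
    have m2: "(\<lambda>t. indicator S t * h t (w t)) \<in> borel_measurable ?M"
    proof (rule lebesgue_on_measurable_compose_isCont[OF S h w])
      show "S \<in> sets ?M" by (rule sets_lebesgue_on_refl)
      show "AE t in ?M. t \<in> S \<longrightarrow> isCont (h t) (w t)"
        using diff ball
      proof eventually_elim
        case (elim t)
        then have "w t \<in> ball (c t) \<delta>" by (simp add: dist_commute)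
        with elim(1) show ?case by (blast intro: differentiable_imp_continuous_within)
      qed
    qed
    show ?thesis
    proof (rule lebesgue_on_measurable_AE_limit[OF _ S])
      show "(\<lambda>t. (indicator (A n) t * h t (w t + e /\<^sub>R real (Suc n)) - indicator S t * h t (w t)) * real (Suc n))
        \<in> borel_measurable ?M" for n
        by (intro borel_measurable_times borel_measurable_diff m1 m2 borel_measurable_const)
      show "AE t in ?M. (\<lambda>n. (indicator (A n) t * h t (w t + e /\<^sub>R real (Suc n)) - indicator S t * h t (w t)) * real (Suc n))
        \<longlonglongrightarrow> grad (h t) (w t) \<bullet> e"
        using diff ball AE_space[of ?M]
      proof eventually_elim
        case (elim t)
        have "h t differentiable (at (w t))" using elim(1,2) by (simp add: dist_commute)
        then have q: "(\<lambda>n. (h t (w t + e /\<^sub>R real (Suc n)) - h t (w t)) * real (Suc n)) \<longlonglongrightarrow> grad (h t) (w t) \<bullet> e"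
          by (rule GDERIV_difference_quotient[OF GDERIV_grad])
        have "(\<lambda>n. dist (w t + inverse (real (Suc n)) *\<^sub>R e) (c t)) \<longlonglongrightarrow> dist (w t + 0 *\<^sub>R e) (c t)"
          by (intro tendsto_dist tendsto_add tendsto_scaleR tendsto_const LIMSEQ_inverse_real_of_nat)
        then have "\<forall>\<^sub>F n in sequentially. dist (w t + inverse (real (Suc n)) *\<^sub>R e) (c t) < \<delta>"
          by (rule order_tendstoD(2)) (use elim(2) in simp)
        then have ev: "\<forall>\<^sub>F n in sequentially. t \<in> A n"
          by (rule eventually_mono) (use elim(3) in \<open>simp add: A_def\<close>)
        have tS: "t \<in> S" using elim(3) by simp
        show ?case
          by (rule Lim_transform_eventually[OF q])
            (rule eventually_mono[OF ev], use tS in simp)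
      qed
    qed
  qed
  show ?thesis
    using comp by (subst borel_measurable_euclidean_space) blast
qed

lemma W11_deriv_continuous_on: "W11_deriv a b x v \<Longrightarrow> continuous_on {a..b} x"
proof -
  assume x: "W11_deriv a b x v"
  then have "integrable (lebesgue_on {a..b}) v" by (simp add: W11_deriv_def)
  from indefinite_integral_continuous_real[OF this]
  have "continuous_on {a..b} (\<lambda>t. x a + (LINT s|lebesgue_on {a..t}. v s))"
    by (rule continuous_on_add[OF continuous_on_const])
  then show ?thesis
  proof (rule continuous_on_eq)
    fix t assume "t \<in> {a..b}"
    then show "x a + (LINT s|lebesgue_on {a..t}. v s) = x t"
      using x unfolding W11_deriv_def by (intro sym[of "x t"]) blast
  qed
qed

lemma W11_continuous_on: "x \<in> W11 a b \<Longrightarrow> continuous_on {a..b} x"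
  unfolding W11_def using W11_deriv_continuous_on by blast

lemma W11_measurable: "x \<in> W11 a b \<Longrightarrow> x \<in> borel_measurable (lebesgue_on {a..b})"
  by (rule continuous_imp_measurable_on_sets_lebesgue[OF W11_continuous_on]) simp_all

lemma W11_bounded:
  assumes "x \<in> W11 a b"
  obtains C where "\<And>t. t \<in> {a..b} \<Longrightarrow> norm (x t) \<le> C"
proof -
  have "bounded (x ` {a..b})"
    by (rule compact_imp_bounded[OF compact_continuous_image[OF W11_continuous_on[OF assms] compact_Icc]])
  then obtain C where "\<forall>y\<in>x ` {a..b}. norm y \<le> C" unfolding bounded_iff by blast
  then show thesis using that by blast
qed

lemma not_AE_False_interval:
  fixes a b :: real
  assumes "a < b" shows "\<not> (AE t in lebesgue_on {a..b}. False)"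
proof
  have S: "{a..b} \<inter> space lebesgue \<in> sets lebesgue" "{a..b} \<in> sets lebesgue" by simp_all
  assume "AE t in lebesgue_on {a..b}. False"
  then have "AE t in lebesgue. t \<in> {a..b} \<longrightarrow> False" unfolding AE_restrict_space_iff[OF S(1)] .
  then have "AE t in lebesgue. t \<notin> {a..b}" by (rule eventually_mono) blast
  then have "{a..b} \<in> null_sets lebesgue" by (rule iffD2[OF AE_iff_null_sets[OF S(2)]])
  then have "negligible (cbox a b)" by (simp only: negligible_iff_null_sets cbox_interval)
  from iffD1[OF negligible_interval(1) this] show False using assms by simp
qed

text \<open>The essential bound \<open>C\<close> makes the essential supremum finite, so that its conversion to a real number keeps its
meaning; the interval has positive measure, so that it is not negative.\<close>

lemma Linf_norm_props:
  fixes p :: "real \<Rightarrow> 'a::euclidean_space"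
  assumes ab: "a < b" and p: "p \<in> borel_measurable (lebesgue_on {a..b})"
    and C: "AE t in lebesgue_on {a..b}. norm (p t) \<le> C"
  shows "AE t in lebesgue_on {a..b}. norm (p t) \<le> Linf_norm a b p"
    and "0 \<le> Linf_norm a b p" and "Linf_norm a b p \<le> C"
proof -
  let ?M = "lebesgue_on {a..b}"
  let ?s = "esssup ?M (\<lambda>t. ereal (norm (p t)))"
  have "(\<lambda>t. ereal (norm (p t))) \<in> borel_measurable ?M"
    using p by measurable
  then have up: "?s \<le> ereal C" by (rule esssup_I) (use C in simp)
  have AE: "AE t in ?M. ereal (norm (p t)) \<le> ?s" by (rule esssup_AE)
  have low: "0 \<le> ?s"
  proof (rule ccontr)
    assume "\<not> 0 \<le> ?s"
    have "AE t in ?M. False" using AE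
    proof (rule eventually_mono)
      fix t assume le: "ereal (norm (p t)) \<le> ?s"
      have "0 \<le> ereal (norm (p t))" by simp
      from order_trans[OF this le] show False using \<open>\<not> 0 \<le> ?s\<close> by contradiction
    qed
    then show False using not_AE_False_interval[OF ab] by blast
  qed
  obtain s where s: "?s = ereal s" using up low by (cases ?s) auto
  show "AE t in ?M. norm (p t) \<le> Linf_norm a b p"
    using AE unfolding Linf_norm_def s by simp
  show "0 \<le> Linf_norm a b p" "Linf_norm a b p \<le> C"
    using up low unfolding Linf_norm_def s by simp_all
qed

section \<open>The adjoint inclusion\<close>

lemma GDERIV_weighted_sum:
  fixes f :: "'i \<Rightarrow> 'a::euclidean_space \<Rightarrow> real"
  assumes "\<And>i. GDERIV (f i) z :> D i"
  shows "GDERIV (\<lambda>z. \<Sum>i\<in>I. c i * f i z) z :> (\<Sum>i\<in>I. c i *\<^sub>R D i)"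
proof -
  have "((\<lambda>z. \<Sum>i\<in>I. c i * f i z) has_derivative (\<lambda>h. \<Sum>i\<in>I. c i * (h \<bullet> D i))) (at z)"
    by (intro has_derivative_sum has_derivative_mult_right assms[unfolded gderiv_def])
  then show ?thesis unfolding gderiv_def by (simp add: inner_sum_right)
qed

lemma grad_partial_fst:
  fixes h :: "'a::euclidean_space \<times> 'b::euclidean_space \<Rightarrow> real"
  assumes "h differentiable (at (x, u))"
  shows "grad (\<lambda>y. h (y, u)) x = fst (grad h (x, u))"
proof (rule grad_eqI)
  have "(h has_derivative (\<lambda>d. d \<bullet> grad h (x, u))) (at (x, u))"
    using GDERIV_grad[OF assms] by (simp only: gderiv_def)
  moreover have "((\<lambda>y. (y, u)) has_derivative (\<lambda>d. (d, 0))) (at x)"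
    by (intro has_derivative_Pair has_derivative_ident has_derivative_const)
  ultimately have "((\<lambda>y. h (y, u)) has_derivative (\<lambda>d. (d, 0) \<bullet> grad h (x, u))) (at x)"
    by (rule has_derivative_compose[rotated])
  then show "GDERIV (\<lambda>y. h (y, u)) x :> fst (grad h (x, u))"
    unfolding gderiv_def by (simp add: inner_prod_def)
qed

definition constraint_grad ::
  "('n::finite, 'm::finite, 'b::finite, 'g::finite) ocp
     \<Rightarrow> real \<Rightarrow> real^'b \<Rightarrow> real^'g \<Rightarrow> (real^'n) \<times> (real^'m) \<Rightarrow> (real^'n) \<times> (real^'m)" where
  "constraint_grad P t q r w =
     (\<Sum>i\<in>UNIV. q $ i *\<^sub>R grad (\<lambda>(y, z). eqc P t y z $ i) w) +
     (\<Sum>j\<in>UNIV. r $ j *\<^sub>R grad (\<lambda>(y, z). ineqc P t y z $ j) w)"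

lemma Omega_t_eq_cball: "Omega_t xbar ubar \<delta> t = cball (xbar t, ubar t) \<delta>"
proof -
  have "norm (w - (xbar t, ubar t)) = dist (xbar t, ubar t) w" for w
    unfolding dist_norm by (rule norm_minus_commute)
  then show ?thesis unfolding Omega_t_def cball_def by simp
qed

lemma C1_on_cball_interior:
  assumes "C1_on (cball c \<delta>) h" "w \<in> ball c \<delta>"
  shows "h differentiable (at w)" "isCont (grad h) w"
proof -
  show "h differentiable (at w)" using assms unfolding C1_on_def by auto
  have "w \<in> interior (cball c \<delta>)" using assms(2) by simp
  then show "isCont (grad h) w"
    using assms(1) unfolding C1_on_def by (intro continuous_on_interior) auto
qed

text \<open>Inside the ball the constraint part of the Hamiltonian is continuously differentiable, so the multipliers \<open>q\<close> and
\<open>r\<close> enter the subdifferential only through a translation. This is what allows them to be exchanged when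
passing to the limit: what remains depends on \<open>p\<close> and the dynamics alone.\<close>

lemma subdiff_Ham_eq_translate:
  fixes P :: "('n::finite, 'm::finite, 'b::finite, 'g::finite) ocp"
  assumes b: "\<And>i. C1_on (Omega_t xbar ubar \<delta> t) (\<lambda>(y, z). eqc P t y z $ i)"
    and g: "\<And>j. C1_on (Omega_t xbar ubar \<delta> t) (\<lambda>(y, z). ineqc P t y z $ j)"
    and w: "(x, u) \<in> ball (xbar t, ubar t) \<delta>"
  shows "subdiff_Ham P t x p q r u =
    (\<lambda>v. constraint_grad P t q r (x, u) + v) ` limiting_subdiff (\<lambda>w. p \<bullet> (case w of (y, z) \<Rightarrow> dyn P t y z)) (x, u)"
proof -
  note b' = C1_on_cball_interior[OF b[unfolded Omega_t_eq_cball]]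
  note g' = C1_on_cball_interior[OF g[unfolded Omega_t_eq_cball]]
  let ?s = "\<lambda>w. (\<Sum>i\<in>UNIV. q $ i * (case w of (y, z) \<Rightarrow> eqc P t y z $ i)) +
    (\<Sum>j\<in>UNIV. r $ j * (case w of (y, z) \<Rightarrow> ineqc P t y z $ j))"
  have "(\<lambda>(y, z). Ham P t y p q r z) = (\<lambda>w. p \<bullet> (case w of (y, z) \<Rightarrow> dyn P t y z) + ?s w)"
    by (auto simp: Ham_def inner_vec_def[of q] inner_vec_def[of r] fun_eq_iff)
  moreover have "limiting_subdiff (\<lambda>w. p \<bullet> (case w of (y, z) \<Rightarrow> dyn P t y z) + ?s w) (x, u) =
    (\<lambda>v. constraint_grad P t q r (x, u) + v) ` limiting_subdiff (\<lambda>w. p \<bullet> (case w of (y, z) \<Rightarrow> dyn P t y z)) (x, u)"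
  proof (rule limiting_subdiff_add_smooth[OF open_ball w])
    fix w assume w: "w \<in> ball (xbar t, ubar t) \<delta>"
    show "GDERIV ?s w :> constraint_grad P t q r w"
      unfolding constraint_grad_def
      by (intro GDERIV_add GDERIV_weighted_sum GDERIV_grad b'(1)[OF w] g'(1)[OF w])
  next
    show "isCont (constraint_grad P t q r) (x, u)"
      unfolding constraint_grad_def[abs_def]
      by (intro continuous_add continuous_sum continuous_scaleR continuous_const b'(2)[OF w] g'(2)[OF w])
  qed
  ultimately show ?thesis unfolding subdiff_Ham_def by (simp only:)
qed

lemma lipschitz_on_inner_left:
  fixes F :: "'a::metric_space \<Rightarrow> 'b::real_inner"
  assumes "K-lipschitz_on S F"
  shows "(norm p * K)-lipschitz_on S (\<lambda>w. p \<bullet> F w)"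
proof (rule lipschitz_onI)
  fix x y assume "x \<in> S" "y \<in> S"
  have "dist (p \<bullet> F x) (p \<bullet> F y) = \<bar>p \<bullet> (F x - F y)\<bar>" by (simp add: dist_real_def inner_diff_right)
  also have "\<dots> \<le> norm p * norm (F x - F y)" by (rule Cauchy_Schwarz_ineq2)
  also have "\<dots> \<le> norm p * (K * dist x y)"
    using lipschitz_onD[OF assms \<open>x \<in> S\<close> \<open>y \<in> S\<close>] by (intro mult_left_mono) (simp_all add: dist_norm)
  finally show "dist (p \<bullet> F x) (p \<bullet> F y) \<le> norm p * K * dist x y" by (simp add: mult.assoc)
qed (use lipschitz_on_nonneg[OF assms] in simp)

text \<open>The function \<open>p k \<bullet> F\<close> differs from \<open>p0 \<bullet> F\<close> by a function with Lipschitz constant \<open>norm (p0 - p k) * K\<close>, so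
the closed graph property applies. The same property with constant sequences shows that the limit set is
closed.\<close>

lemma hull_subdiff_limit:
  fixes F :: "'a::euclidean_space \<Rightarrow> 'b::euclidean_space"
  assumes lip: "K-lipschitz_on (ball c \<delta>) F" and \<delta>: "\<delta> > 0"
    and y: "\<And>k. y k \<in> ball c \<delta>" "y \<longlonglongrightarrow> c" and p: "p \<longlonglongrightarrow> p0" "\<And>k. norm (p k) \<le> B"
    and \<alpha>: "\<And>k. \<alpha> k \<in> convex hull (limiting_subdiff (\<lambda>w. p k \<bullet> F w) (y k))"
    and \<alpha>0: "\<And>N. \<alpha>0 \<in> closure (convex hull (\<alpha> ` {N..}))"
  shows "\<alpha>0 \<in> convex hull (limiting_subdiff (\<lambda>w. p0 \<bullet> F w) c)"
proof -
  have K: "K \<ge> 0" by (rule lipschitz_on_nonneg[OF lip])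
  have c: "c \<in> ball c \<delta>" using \<delta> by simp
  have cont: "continuous_on (ball c \<delta>) (\<lambda>w. p0 \<bullet> F w)"
    by (rule lipschitz_on_continuous_on[OF lipschitz_on_inner_left[OF lip]])
  have cg: "v \<in> limiting_subdiff (\<lambda>w. p0 \<bullet> F w) c"
    if vs: "\<And>j. vs j \<in> limiting_subdiff (\<lambda>w. pp j \<bullet> F w) (ys j)" "vs \<longlonglongrightarrow> v"
      and ys: "ys \<longlonglongrightarrow> c" and pp: "pp \<longlonglongrightarrow> p0" for vs v ys pp
  proof (rule limiting_subdiff_closed_graph[OF vs(1) ys vs(2) \<delta> cont])
    fix j z z' assume z: "z \<in> ball c \<delta>" "z' \<in> ball c \<delta>"
    have "dist ((p0 - pp j) \<bullet> F z) ((p0 - pp j) \<bullet> F z') \<le> norm (p0 - pp j) * K * dist z z'"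
      by (rule lipschitz_onD[OF lipschitz_on_inner_left[OF lip] z])
    then show "\<bar>p0 \<bullet> F z - pp j \<bullet> F z - (p0 \<bullet> F z' - pp j \<bullet> F z')\<bar> \<le> norm (p0 - pp j) * K * norm (z - z')"
      by (simp add: dist_norm inner_diff_left)
  next
    have "(\<lambda>j. norm (p0 - pp j) * K) \<longlonglongrightarrow> norm (p0 - p0) * K"
      by (intro tendsto_mult tendsto_norm tendsto_diff tendsto_const pp)
    then show "(\<lambda>j. norm (p0 - pp j) * K) \<longlonglongrightarrow> 0" by simp
  qed
  show ?thesis
  proof (rule closed_hull_tails_imp_hull_limit[OF \<alpha> _ _ _ \<alpha>0])
    fix k v assume "v \<in> limiting_subdiff (\<lambda>w. p k \<bullet> F w) (y k)"
    then have "norm v \<le> norm (p k) * K"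
      by (rule norm_limiting_subdiff_le[OF _ open_ball y(1) lipschitz_on_inner_left[OF lip]])
    also have "\<dots> \<le> B * K" by (rule mult_right_mono[OF p(2) K])
    finally show "norm v \<le> B * K" .
  next
    fix r vs v
    assume r: "strict_mono (r :: nat \<Rightarrow> nat)" and vs: "vs \<longlonglongrightarrow> v"
      "\<And>j. vs j \<in> limiting_subdiff (\<lambda>w. p (r j) \<bullet> F w) (y (r j))"
    have "(\<lambda>j. y (r j)) \<longlonglongrightarrow> c" "(\<lambda>j. p (r j)) \<longlonglongrightarrow> p0"
      using LIMSEQ_subseq_LIMSEQ[OF y(2) r] LIMSEQ_subseq_LIMSEQ[OF p(1) r] by (simp_all only: o_def)
    then show "v \<in> limiting_subdiff (\<lambda>w. p0 \<bullet> F w) c" by (rule cg[OF vs(2,1)])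
  next
    show "compact (limiting_subdiff (\<lambda>w. p0 \<bullet> F w) c)"
      unfolding compact_eq_bounded_closed
    proof
      show "bounded (limiting_subdiff (\<lambda>w. p0 \<bullet> F w) c)"
        unfolding bounded_iff
        using norm_limiting_subdiff_le[OF _ open_ball c lipschitz_on_inner_left[OF lip]] by blast
      show "closed (limiting_subdiff (\<lambda>w. p0 \<bullet> F w) c)"
        unfolding closed_sequential_limits
      proof (intro allI impI, elim conjE)
        fix vs v assume "\<forall>n. vs n \<in> limiting_subdiff (\<lambda>w. p0 \<bullet> F w) c" "vs \<longlonglongrightarrow> v"
        then show "v \<in> limiting_subdiff (\<lambda>w. p0 \<bullet> F w) c"
          using cg[of vs "\<lambda>_. p0" "\<lambda>_. c" v] by simp
      qed
    qed
  qed
qed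

lemma M_bdE:
  assumes "(\<phi>, \<psi>, \<gamma>, \<xi>) \<in> M_bd P xbar ubar \<delta> kpsi x u \<theta>"
  obtains q r \<zeta> where "q \<in> L1 (t_ini P) (t_fin P)" "r \<in> L1 (t_ini P) (t_fin P)" "\<zeta> \<in> L1 (t_ini P) (t_fin P)"
    "AE t in ival P. (\<phi> t, \<psi> t) = constraint_grad P t (q t) (r t) (x t, u t) + (0, - \<zeta> t) \<and>
       \<zeta> t \<in> limiting_normal (U_loc P ubar \<delta> t) (u t) \<and>
       (\<forall>j. r t $ j * ineq_minus P j t (x t) (u t) = \<theta> j t \<and> r t $ j \<le> 0)"
    "(\<gamma>, \<xi>) \<in> limiting_normal (endpts P) (x (t_ini P), x (t_fin P))"
proof -
  note * = assms[unfolded M_bd_def, THEN CollectD, unfolded prod.case constraint_grad_def[symmetric],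
      THEN conjunct2, THEN conjunct2, THEN conjunct2, THEN conjunct2]
  from *[THEN conjunct1] obtain q r \<zeta> where c: "q \<in> L1 (t_ini P) (t_fin P) \<and> r \<in> L1 (t_ini P) (t_fin P) \<and>
     \<zeta> \<in> L1 (t_ini P) (t_fin P) \<and>
     (AE t in ival P. (\<phi> t, \<psi> t) = constraint_grad P t (q t) (r t) (x t, u t) + (0, - \<zeta> t) \<and>
       \<zeta> t \<in> limiting_normal (U_loc P ubar \<delta> t) (u t) \<and>
       (\<forall>j. r t $ j * ineq_minus P j t (x t) (u t) = \<theta> j t \<and> r t $ j \<le> 0) \<and> norm (\<psi> t) \<le> kpsi t)"
    by (elim exE) (rule that)
  show thesis
  proof (rule that[OF c[THEN conjunct1] c[THEN conjunct2, THEN conjunct1]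
        c[THEN conjunct2, THEN conjunct2, THEN conjunct1] _ *[THEN conjunct2]])
    show "AE t in ival P. (\<phi> t, \<psi> t) = constraint_grad P t (q t) (r t) (x t, u t) + (0, - \<zeta> t) \<and>
       \<zeta> t \<in> limiting_normal (U_loc P ubar \<delta> t) (u t) \<and>
       (\<forall>j. r t $ j * ineq_minus P j t (x t) (u t) = \<theta> j t \<and> r t $ j \<le> 0)"
      using c[THEN conjunct2, THEN conjunct2, THEN conjunct2] by (rule eventually_mono) (elim conjE, intro conjI)
  qed
qed

text \<open>The bounds for one term of the sequence. Removing the gradient of the constraints from the adjoint
inclusion leaves a vector in the hull of the subdifferential of \<open>p t \<bullet> dyn\<close>, whose norm is at most \<open>\<bar>kf t\<bar>\<close>
because \<open>norm (p t) \<le> 1\<close>. The bound on \<open>\<phi>\<close> is assumed; those on \<open>\<psi>\<close> and on \<open>dp\<close> follow from the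
two components of this vector. Bounds that are independent of the term are what weak compactness
requires.\<close>

lemma awmp_term_decomposition:
  fixes P :: "('n::finite, 'm::finite, 'b::finite, 'g::finite) ocp"
  defines "a \<equiv> t_ini P" and "b \<equiv> t_fin P"
  assumes ab: "a < b" and xbar: "xbar \<in> W11 a b" and ubar: "ubar \<in> L1 a b"
    and x: "x \<in> W11 a b" and u: "u \<in> L1 a b" and \<zeta>: "\<zeta> \<in> L1 a b" and p: "p \<in> W11 a b"
    and q: "q \<in> L1 a b" and r: "r \<in> L1 a b"
    and p1: "Linf_norm a b p \<le> 1"
    and inc: "AE t in ival P. (- dp t, \<zeta> t) - (eps t, eta t) \<in> convex hull (subdiff_Ham P t (x t) (p t) (q t) (r t) (u t))"
    and inside: "AE t in ival P. (x t, u t) \<in> interior (Omega_t xbar ubar \<delta> t)"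
    and lip: "AE t in ival P. \<bar>kf t\<bar>-lipschitz_on (ball (xbar t, ubar t) \<delta>) (\<lambda>(y, z). dyn P t y z)"
    and h4: "H4 P" and h5: "H5 P xbar ubar \<delta>"
    and kf: "integrable (ival P) kf" and ceps: "integrable (ival P) ceps"
    and ceta: "integrable (ival P) ceta" and cphi: "integrable (ival P) cphi"
    and h8: "AE t in ival P. norm (eps t) \<le> ceps t \<and> norm (eta t) \<le> ceta t"
    and h9: "AE t in ival P. norm ((\<Sum>i\<in>UNIV. q t $ i *\<^sub>R grad (\<lambda>y. eqc P t y (u t) $ i) (x t)) +
                        (\<Sum>j\<in>UNIV. r t $ j *\<^sub>R grad (\<lambda>y. ineqc P t y (u t) $ j) (x t))) \<le> cphi t"
  defines "\<phi> \<equiv> \<lambda>t. fst (constraint_grad P t (q t) (r t) (x t, u t))"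
    and "\<psi> \<equiv> \<lambda>t. snd (constraint_grad P t (q t) (r t) (x t, u t)) - \<zeta> t"
  shows "AE t in ival P. (x t, u t) \<in> ball (xbar t, ubar t) \<delta>"
    and "AE t in ival P. (- dp t - eps t - \<phi> t, - eta t - \<psi> t) \<in>
      convex hull (limiting_subdiff (\<lambda>w. p t \<bullet> (case w of (y, z) \<Rightarrow> dyn P t y z)) (x t, u t))"
    and "AE t in ival P. norm (p t) \<le> 1"
    and "AE t in ival P. norm (- dp t - eps t - \<phi> t, - eta t - \<psi> t) \<le> \<bar>kf t\<bar>"
    and "AE t in ival P. norm (\<phi> t) \<le> cphi t"
    and "AE t in ival P. norm (\<psi> t) \<le> ceta t + \<bar>kf t\<bar>"
    and "AE t in ival P. norm (dp t) \<le> ceps t + cphi t + \<bar>kf t\<bar>"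
    and "\<phi> \<in> L1 a b" and "\<psi> \<in> L1 a b"
proof -
  let ?M = "ival P"
  have M: "?M = lebesgue_on {a..b}" by (simp add: a_def b_def)
  note [simp] = M
  show ball: "AE t in ?M. (x t, u t) \<in> ball (xbar t, ubar t) \<delta>"
    using inside by (simp add: Omega_t_eq_cball)
  have C1: "AE t in ?M. (\<forall>i. C1_on (Omega_t xbar ubar \<delta> t) (\<lambda>(x, u). eqc P t x u $ i)) \<and>
        (\<forall>j. C1_on (Omega_t xbar ubar \<delta> t) (\<lambda>(x, u). ineqc P t x u $ j))"
    using h5 unfolding H5_def by blast
  show inc': "AE t in ?M. (- dp t - eps t - \<phi> t, - eta t - \<psi> t) \<in>
      convex hull (limiting_subdiff (\<lambda>w. p t \<bullet> (case w of (y, z) \<Rightarrow> dyn P t y z)) (x t, u t))"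
    using inc ball C1
  proof eventually_elim
    case (elim t)
    let ?G = "constraint_grad P t (q t) (r t) (x t, u t)"
    let ?S = "limiting_subdiff (\<lambda>w. p t \<bullet> (case w of (y, z) \<Rightarrow> dyn P t y z)) (x t, u t)"
    have "(- dp t, \<zeta> t) - (eps t, eta t) \<in> convex hull ((\<lambda>v. ?G + v) ` ?S)"
    proof -
      have "subdiff_Ham P t (x t) (p t) (q t) (r t) (u t) = (\<lambda>v. ?G + v) ` ?S"
        by (rule subdiff_Ham_eq_translate[where xbar = xbar and ubar = ubar and \<delta> = \<delta>])
          (use elim(2,3) in blast)+
      then show ?thesis using elim(1) by (simp only:)
    qed
    then have "(- dp t, \<zeta> t) - (eps t, eta t) \<in> (\<lambda>v. ?G + v) ` (convex hull ?S)"
      by (simp only: convex_hull_translation)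
    then obtain v where v: "v \<in> convex hull ?S" "(- dp t, \<zeta> t) - (eps t, eta t) = ?G + v" by blast
    have "(- dp t - eps t - \<phi> t, - eta t - \<psi> t) = (- dp t, \<zeta> t) - (eps t, eta t) - ?G"
      by (simp add: \<phi>_def \<psi>_def prod_eq_iff)
    also have "\<dots> = v" using v(2) by simp
    finally show ?case using v(1) by simp
  qed
  show pbd: "AE t in ?M. norm (p t) \<le> 1"
  proof -
    obtain C where C: "\<And>t. t \<in> {a..b} \<Longrightarrow> norm (p t) \<le> C" using W11_bounded[OF p] by blast
    have "AE t in lebesgue_on {a..b}. norm (p t) \<le> Linf_norm a b p"
      by (rule Linf_norm_props(1)[OF ab W11_measurable[OF p]], rule AE_I2) (use C in simp)
    then show ?thesis unfolding M by (rule eventually_mono) (use p1 in simp)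
  qed
  show abd: "AE t in ?M. norm (- dp t - eps t - \<phi> t, - eta t - \<psi> t) \<le> \<bar>kf t\<bar>"
    using inc' ball lip pbd
  proof eventually_elim
    case (elim t)
    let ?S = "limiting_subdiff (\<lambda>w. p t \<bullet> (case w of (y, z) \<Rightarrow> dyn P t y z)) (x t, u t)"
    have "?S \<subseteq> cball 0 \<bar>kf t\<bar>"
    proof
      fix v assume "v \<in> ?S"
      then have "norm v \<le> norm (p t) * \<bar>kf t\<bar>"
        by (rule norm_limiting_subdiff_le[OF _ open_ball elim(2) lipschitz_on_inner_left[OF elim(3)]])
      also have "\<dots> \<le> 1 * \<bar>kf t\<bar>" by (rule mult_right_mono[OF elim(4)]) simp
      finally show "v \<in> cball 0 \<bar>kf t\<bar>" by simp
    qed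
    then have "convex hull ?S \<subseteq> cball 0 \<bar>kf t\<bar>" by (rule hull_minimal) (rule convex_cball)
    from subsetD[OF this elim(1)] show ?case by simp
  qed
  show phibd: "AE t in ?M. norm (\<phi> t) \<le> cphi t"
    using h9 ball C1
  proof eventually_elim
    case (elim t)
    have "grad (\<lambda>y. eqc P t y (u t) $ i) (x t) = fst (grad (\<lambda>(y, z). eqc P t y z $ i) (x t, u t))" for i
      using grad_partial_fst[of "\<lambda>(y, z). eqc P t y z $ i" "x t" "u t"]
        C1_on_cball_interior(1)[OF _ elim(2), of "\<lambda>(y, z). eqc P t y z $ i"] elim(3)
      by (simp add: Omega_t_eq_cball)
    moreover have "grad (\<lambda>y. ineqc P t y (u t) $ j) (x t) = fst (grad (\<lambda>(y, z). ineqc P t y z $ j) (x t, u t))" for j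
      using grad_partial_fst[of "\<lambda>(y, z). ineqc P t y z $ j" "x t" "u t"]
        C1_on_cball_interior(1)[OF _ elim(2), of "\<lambda>(y, z). ineqc P t y z $ j"] elim(3)
      by (simp add: Omega_t_eq_cball)
    ultimately show ?case
      using elim(1) by (simp add: \<phi>_def constraint_grad_def fst_sum)
  qed
  show psibd: "AE t in ?M. norm (\<psi> t) \<le> ceta t + \<bar>kf t\<bar>"
    using abd h8
  proof eventually_elim
    case (elim t)
    have "norm (- eta t - \<psi> t) \<le> \<bar>kf t\<bar>"
      using norm_snd_le[of "- eta t - \<psi> t" "- dp t - eps t - \<phi> t"] elim(1) by linarith
    moreover have "norm (\<psi> t) \<le> norm (- eta t - \<psi> t) + norm (eta t)"
      using norm_triangle_ineq[of "- eta t - \<psi> t" "eta t"] by simp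
    ultimately show ?case using elim(2) by linarith
  qed
  show "AE t in ?M. norm (dp t) \<le> ceps t + cphi t + \<bar>kf t\<bar>"
    using abd h8 phibd
  proof eventually_elim
    case (elim t)
    have "norm (- dp t - eps t - \<phi> t) \<le> \<bar>kf t\<bar>"
      using norm_fst_le[of "- dp t - eps t - \<phi> t" "- eta t - \<psi> t"] elim(1) by linarith
    moreover have "norm (dp t) \<le> norm (- dp t - eps t - \<phi> t) + norm (eps t + \<phi> t)"
      using norm_triangle_ineq[of "- dp t - eps t - \<phi> t" "eps t + \<phi> t"] by simp
    moreover have "norm (eps t + \<phi> t) \<le> norm (eps t) + norm (\<phi> t)" by (rule norm_triangle_ineq)
    ultimately show ?case using elim(2,3) by linarith
  qed
  have S: "{a..b} \<in> sets lebesgue" by simp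
  have mw: "(\<lambda>t. (x t, u t)) \<in> borel_measurable (lebesgue_on {a..b})"
    using u by (intro borel_measurable_Pair W11_measurable[OF x] borel_measurable_integrable) simp
  have mc: "(\<lambda>t. (xbar t, ubar t)) \<in> borel_measurable (lebesgue_on {a..b})"
    using ubar by (intro borel_measurable_Pair W11_measurable[OF xbar] borel_measurable_integrable) simp
  have dist: "AE t in lebesgue_on {a..b}. dist (x t, u t) (xbar t, ubar t) < \<delta>"
    using ball unfolding M by (simp add: dist_commute)
  have meq: "(\<lambda>t. eqc P t y z $ i) \<in> borel_measurable (lebesgue_on {a..b})" for y z i
  proof -
    have "(\<lambda>t. (eqc P t y z, ineqc P t y z)) \<in> borel_measurable (lebesgue_on {a..b})"
      using h4 unfolding H4_def M by blast
    from borel_measurable_continuous_on[OF linear_continuous_on[OF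
          bounded_linear_compose[OF bounded_linear_vec_nth bounded_linear_fst]] this]
    show ?thesis by (simp only: fst_conv)
  qed
  have mineq: "(\<lambda>t. ineqc P t y z $ j) \<in> borel_measurable (lebesgue_on {a..b})" for y z j
  proof -
    have "(\<lambda>t. (eqc P t y z, ineqc P t y z)) \<in> borel_measurable (lebesgue_on {a..b})"
      using h4 unfolding H4_def M by blast
    from borel_measurable_continuous_on[OF linear_continuous_on[OF
          bounded_linear_compose[OF bounded_linear_vec_nth bounded_linear_snd]] this]
    show ?thesis by (simp only: snd_conv)
  qed
  have mg1: "(\<lambda>t. grad (\<lambda>(y, z). eqc P t y z $ i) (x t, u t)) \<in> borel_measurable (lebesgue_on {a..b})" for i
  proof (rule lebesgue_on_measurable_grad[OF S _ mw mc dist])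
    show "(\<lambda>t. case w of (y, z) \<Rightarrow> eqc P t y z $ i) \<in> borel_measurable (lebesgue_on {a..b})" for w
      using meq by (cases w) simp
    show "AE t in lebesgue_on {a..b}. \<forall>w\<in>ball (xbar t, ubar t) \<delta>. (\<lambda>(y, z). eqc P t y z $ i) differentiable (at w)"
      using C1 unfolding M
      by (rule eventually_mono) (simp add: Omega_t_eq_cball C1_on_def)
  qed
  have mg2: "(\<lambda>t. grad (\<lambda>(y, z). ineqc P t y z $ j) (x t, u t)) \<in> borel_measurable (lebesgue_on {a..b})" for j
  proof (rule lebesgue_on_measurable_grad[OF S _ mw mc dist])
    show "(\<lambda>t. case w of (y, z) \<Rightarrow> ineqc P t y z $ j) \<in> borel_measurable (lebesgue_on {a..b})" for w
      using mineq by (cases w) simp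
    show "AE t in lebesgue_on {a..b}. \<forall>w\<in>ball (xbar t, ubar t) \<delta>. (\<lambda>(y, z). ineqc P t y z $ j) differentiable (at w)"
      using C1 unfolding M
      by (rule eventually_mono) (simp add: Omega_t_eq_cball C1_on_def)
  qed
  have mv: "(\<lambda>t. f t $ i) \<in> borel_measurable (lebesgue_on {a..b})"
    if "f \<in> L1 a b" for f :: "real \<Rightarrow> real^'k::finite" and i
  proof -
    have "f \<in> borel_measurable (lebesgue_on {a..b})" using that by (intro borel_measurable_integrable) simp
    then show ?thesis
      by (rule borel_measurable_continuous_on[OF linear_continuous_on[OF bounded_linear_vec_nth]])
  qed
  have mG: "(\<lambda>t. constraint_grad P t (q t) (r t) (x t, u t)) \<in> borel_measurable (lebesgue_on {a..b})"
    unfolding constraint_grad_def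
    by (intro borel_measurable_add borel_measurable_sum borel_measurable_scaleR mv[OF q] mv[OF r] mg1 mg2)
  have m\<phi>: "\<phi> \<in> borel_measurable (lebesgue_on {a..b})"
    unfolding \<phi>_def
    by (rule borel_measurable_continuous_on[OF linear_continuous_on[OF bounded_linear_fst] mG])
  have m\<psi>: "\<psi> \<in> borel_measurable (lebesgue_on {a..b})"
    unfolding \<psi>_def
    by (rule borel_measurable_diff[OF borel_measurable_continuous_on[OF
            linear_continuous_on[OF bounded_linear_snd] mG] borel_measurable_integrable[OF \<zeta>[unfolded mem_Collect_eq]]])
  show "\<phi> \<in> L1 a b"
  proof (rule CollectI, rule Bochner_Integration.integrable_bound[OF _ m\<phi>])
    show "integrable (lebesgue_on {a..b}) cphi" using cphi by simp
    show "AE t in lebesgue_on {a..b}. norm (\<phi> t) \<le> norm (cphi t)"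
      using phibd unfolding M by (rule eventually_mono) simp
  qed
  show "\<psi> \<in> L1 a b"
  proof (rule CollectI, rule Bochner_Integration.integrable_bound[OF _ m\<psi>])
    show "integrable (lebesgue_on {a..b}) (\<lambda>t. ceta t + \<bar>kf t\<bar>)" using ceta kf by simp
    show "AE t in lebesgue_on {a..b}. norm (\<psi> t) \<le> norm (ceta t + \<bar>kf t\<bar>)"
      using psibd unfolding M by (rule eventually_mono) simp
  qed
qed

section \<open>Passage to the limit\<close>

theorem theorem3p6:
  fixes P :: "('n::finite, 'm::finite, 'b::finite, 'g::finite) ocp"
    and xbar :: "real \<Rightarrow> real^'n" and ubar :: "real \<Rightarrow> real^'m" and \<delta> :: real
    and x :: "nat \<Rightarrow> real \<Rightarrow> real^'n" and u :: "nat \<Rightarrow> real \<Rightarrow> real^'m"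
    and \<zeta> :: "nat \<Rightarrow> real \<Rightarrow> real^'m" and p :: "nat \<Rightarrow> real \<Rightarrow> real^'n"
    and q :: "nat \<Rightarrow> real \<Rightarrow> real^'b" and r :: "nat \<Rightarrow> real \<Rightarrow> real^'g"
    and lam :: "nat \<Rightarrow> real"
    and eps :: "nat \<Rightarrow> real \<Rightarrow> real^'n" and eta :: "nat \<Rightarrow> real \<Rightarrow> real^'m"
    and \<theta> :: "nat \<Rightarrow> 'g \<Rightarrow> real \<Rightarrow> real"
    and vt :: "nat \<Rightarrow> real^'n" and nu :: "nat \<Rightarrow> real^'n"
  assumes data: "ocp_data P"
    and extremal: "asymptotic_extremal P xbar ubar"
    and delta: "\<delta> > 0"
    and seq: "AWMP_seq P ubar \<delta> x u \<zeta> p q r lam eps eta \<theta> vt nu"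
    and x_lim: "uniform_limit {t_ini P..t_fin P} x xbar sequentially"
    and u_lim: "strong_L1 (t_ini P) (t_fin P) u ubar"
    and inside: "\<forall>\<^sub>F k in sequentially.
                   AE t in ival P. (x k t, u k t) \<in> interior (Omega_t xbar ubar \<delta> t)"
    and h1: "H1 P xbar ubar \<delta>"
    and h2: "H2 P ubar \<delta>"
    and h3: "H3 P xbar"
    and h4: "H4 P"
    and h5: "H5 P xbar ubar \<delta>"
    and h6: "H6 P xbar ubar"
    and h7: "H7 P xbar ubar \<delta>"
    and h8: "\<exists>ceps ceta. integrable (ival P) ceps \<and> integrable (ival P) ceta \<and>
               (\<forall>k. AE t in ival P. norm (eps k t) \<le> ceps t \<and> norm (eta k t) \<le> ceta t)"
    and h9: "\<exists>cphi. integrable (ival P) cphi \<and>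
               (\<forall>k. AE t in ival P.
                  norm ((\<Sum>i\<in>UNIV. q k t $ i *\<^sub>R grad (\<lambda>y. eqc P t y (u k t) $ i) (x k t)) +
                        (\<Sum>j\<in>UNIV. r k t $ j *\<^sub>R grad (\<lambda>y. ineqc P t y (u k t) $ j) (x k t)))
                    \<le> cphi t)"
    and regular: "AWMP_regular_with P xbar ubar \<delta>"
  shows "\<exists>(l::real) (pp::real \<Rightarrow> real^'n) (dp::real \<Rightarrow> real^'n) (qq::real \<Rightarrow> real^'b)
            (rr::real \<Rightarrow> real^'g) (z::real \<Rightarrow> real^'m).
           l \<ge> 0 \<and> W11_deriv (t_ini P) (t_fin P) pp dp \<and>
           qq \<in> L1 (t_ini P) (t_fin P) \<and> rr \<in> L1 (t_ini P) (t_fin P) \<and>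
           z \<in> L1 (t_ini P) (t_fin P) \<and>
           l + Linf_norm (t_ini P) (t_fin P) pp \<noteq> 0 \<and>
           (AE t in ival P.
              (- dp t, z t) \<in> convex hull (subdiff_Ham P t (xbar t) (pp t) (qq t) (rr t) (ubar t))) \<and>
           (AE t in ival P. z t \<in> convex hull (limiting_normal (ctrl P t) (ubar t))) \<and>
           (AE t in ival P.
              rr t \<bullet> ineqc P t (xbar t) (ubar t) = 0 \<and> (\<forall>j. rr t $ j \<le> 0)) \<and>
           (\<exists>s \<in> limiting_subdiff (cost P) (xbar (t_ini P), xbar (t_fin P)).
            \<exists>n \<in> limiting_normal (endpts P) (xbar (t_ini P), xbar (t_fin P)).
              (pp (t_ini P), - pp (t_fin P)) = l *\<^sub>R s + n)"
proof -
  define a where "a = t_ini P"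
  define b where "b = t_fin P"
  let ?M = "ival P"
  have M: "?M = lebesgue_on {a..b}" by (simp only: a_def b_def)
  have ab: "a < b" using data by (simp add: ocp_data_def a_def b_def)
  have feas: "feasible P xbar ubar" using extremal by (simp add: asymptotic_extremal_def)
  have xbar: "xbar \<in> W11 a b" and ubar: "ubar \<in> L1 a b"
    using feas unfolding feasible_def process_def W11_def a_def b_def by blast+
  note S = seq[unfolded AWMP_seq_def, folded a_def b_def]
  have xW: "x k \<in> W11 a b" and uL: "u k \<in> L1 a b" and zL: "\<zeta> k \<in> L1 a b" and pW: "p k \<in> W11 a b"
    and qL: "q k \<in> L1 a b" and rL: "r k \<in> L1 a b" and lam0: "lam k \<ge> 0"
    and epsL: "eps k \<in> L1 a b" and etaL: "eta k \<in> L1 a b" and thC: "\<theta> k j \<in> Ccone P" for k j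
    using S by blast+
  have nrm: "lam k + Linf_norm a b (p k) = 1" for k using S by blast
  have "\<forall>k. \<exists>dp. W11_deriv a b (p k) dp \<and>
          (AE t in ?M. (- dp t, \<zeta> k t) - (eps k t, eta k t)
             \<in> convex hull (subdiff_Ham P t (x k t) (p k t) (q k t) (r k t) (u k t)))"
    using S unfolding M by blast
  from choice[OF this] obtain dp where dp': "\<forall>k. W11_deriv a b (p k) (dp k) \<and>
      (AE t in ?M. (- dp k t, \<zeta> k t) - (eps k t, eta k t)
             \<in> convex hull (subdiff_Ham P t (x k t) (p k t) (q k t) (r k t) (u k t)))" ..
  have dp: "W11_deriv a b (p k) (dp k)"
    "AE t in ?M. (- dp k t, \<zeta> k t) - (eps k t, eta k t)
             \<in> convex hull (subdiff_Ham P t (x k t) (p k t) (q k t) (r k t) (u k t))" for k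
    using dp' by blast+
  have zN: "AE t in ?M. \<zeta> k t \<in> limiting_normal (U_loc P ubar \<delta> t) (u k t)" for k
    using S unfolding M by blast
  have rth: "AE t in ?M. \<forall>j. r k t $ j * ineq_minus P j t (x k t) (u k t) = \<theta> k j t \<and> r k t $ j \<le> 0" for k
    using S unfolding M by blast
  have "\<forall>k. \<exists>s n. s \<in> limiting_subdiff (cost P) (x k a, x k b) \<and> n \<in> limiting_normal (endpts P) (x k a, x k b) \<and>
            (p k a, - p k b) - (vt k, nu k) = lam k *\<^sub>R s + n"
    using S by blast
  then obtain sg n where sg: "\<And>k. sg k \<in> limiting_subdiff (cost P) (x k a, x k b)"
    and n: "\<And>k. n k \<in> limiting_normal (endpts P) (x k a, x k b)"
    and trans: "\<And>k. (p k a, - p k b) - (vt k, nu k) = lam k *\<^sub>R sg k + n k"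
    by metis
  have epsw: "weak_L1 a b (\<lambda>k t. (eps k t, eta k t)) (\<lambda>t. (0, 0))" using S by blast
  have th0: "AE t in ?M. (\<lambda>k. \<theta> k j t) \<longlonglongrightarrow> 0" for j using S unfolding M by blast
  have vtnu: "(\<lambda>k. (vt k, nu k)) \<longlonglongrightarrow> (0, 0)" using S by blast
  have xu: "uniform_limit {a..b} x xbar sequentially" using x_lim by (simp only: a_def b_def)
  have xpt: "(\<lambda>k. x k t) \<longlonglongrightarrow> xbar t" if "t \<in> {a..b}" for t
    by (rule tendsto_uniform_limitI[OF xu that])

  obtain kf where kf: "integrable ?M kf" "AE t in ?M. \<forall>x u x' u'.
          (x, u) \<in> Omega_t xbar ubar \<delta> t \<longrightarrow> (x', u') \<in> Omega_t xbar ubar \<delta> t \<longrightarrow>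
          norm (dyn P t x u - dyn P t x' u') \<le> kf t * norm ((x, u) - (x', u'))"
    using h1 unfolding H1_def by blast
  have lip: "AE t in ?M. \<bar>kf t\<bar>-lipschitz_on (ball (xbar t, ubar t) \<delta>) (\<lambda>(y, z). dyn P t y z)"
    using kf(2)
  proof (rule eventually_mono)
    fix t assume *: "\<forall>x u x' u'.
          (x, u) \<in> Omega_t xbar ubar \<delta> t \<longrightarrow> (x', u') \<in> Omega_t xbar ubar \<delta> t \<longrightarrow>
          norm (dyn P t x u - dyn P t x' u') \<le> kf t * norm ((x, u) - (x', u'))"
    show "\<bar>kf t\<bar>-lipschitz_on (ball (xbar t, ubar t) \<delta>) (\<lambda>(y, z). dyn P t y z)"
    proof (rule lipschitz_onI)
      fix w w' assume w: "w \<in> ball (xbar t, ubar t) \<delta>" "w' \<in> ball (xbar t, ubar t) \<delta>"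
      obtain y z y' z' where ww: "w = (y, z)" "w' = (y', z')" by (cases w, cases w')
      have "(y, z) \<in> Omega_t xbar ubar \<delta> t" "(y', z') \<in> Omega_t xbar ubar \<delta> t"
        using w unfolding ww Omega_t_eq_cball by simp_all
      then have "norm (dyn P t y z - dyn P t y' z') \<le> kf t * norm ((y, z) - (y', z'))"
        using * by blast
      also have "\<dots> \<le> \<bar>kf t\<bar> * norm ((y, z) - (y', z'))" by (rule mult_right_mono) simp_all
      finally show "dist (case w of (y, z) \<Rightarrow> dyn P t y z) (case w' of (y, z) \<Rightarrow> dyn P t y z) \<le> \<bar>kf t\<bar> * dist w w'"
        unfolding ww dist_norm by simp
    qed simp
  qed
  obtain ceps ceta where c8: "integrable ?M ceps" "integrable ?M ceta"
    "\<And>k. AE t in ?M. norm (eps k t) \<le> ceps t \<and> norm (eta k t) \<le> ceta t"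
    using h8 by blast
  obtain cphi where c9: "integrable ?M cphi" "\<And>k. AE t in ?M.
     norm ((\<Sum>i\<in>UNIV. q k t $ i *\<^sub>R grad (\<lambda>y. eqc P t y (u k t) $ i) (x k t)) +
           (\<Sum>j\<in>UNIV. r k t $ j *\<^sub>R grad (\<lambda>y. ineqc P t y (u k t) $ j) (x k t))) \<le> cphi t"
    using h9 by blast
  obtain \<rho> Kl where \<rho>: "\<rho> > 0" "Kl-lipschitz_on (ball (xbar a, xbar b) \<rho>) (cost P)"
    using h3 unfolding H3_def a_def b_def by blast
  have endlim: "(\<lambda>k. (x k a, x k b)) \<longlonglongrightarrow> (xbar a, xbar b)"
    using ab by (intro tendsto_Pair xpt) simp_all
  have "\<forall>\<^sub>F k in sequentially. (x k a, x k b) \<in> ball (xbar a, xbar b) \<rho>"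
    by (rule topological_tendstoD[OF endlim open_ball]) (use \<rho>(1) in simp)
  then have "\<forall>\<^sub>F k in sequentially. (AE t in ?M. (x k t, u k t) \<in> interior (Omega_t xbar ubar \<delta> t)) \<and>
      (x k a, x k b) \<in> ball (xbar a, xbar b) \<rho>"
    using inside by (intro eventually_conj)
  \<comment> \<open>From index \<open>K\<close> on, the process is interior to the ball and its endpoints lie where the cost is Lipschitz.\<close>
  then obtain K where K: "\<And>k. k \<ge> K \<Longrightarrow> AE t in ?M. (x k t, u k t) \<in> interior (Omega_t xbar ubar \<delta> t)"
    "\<And>k. k \<ge> K \<Longrightarrow> (x k a, x k b) \<in> ball (xbar a, xbar b) \<rho>"
    unfolding eventually_sequentially by blast

  define \<phi> where "\<phi> k t = fst (constraint_grad P t (q k t) (r k t) (x k t, u k t))" for k t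
  define \<psi> where "\<psi> k t = snd (constraint_grad P t (q k t) (r k t) (x k t, u k t)) - \<zeta> k t" for k t
  have pL: "Linf_norm a b (p k) \<le> 1" for k using nrm[of k] lam0[of k] by linarith
  have dec: "AE t in ?M. (x k t, u k t) \<in> ball (xbar t, ubar t) \<delta>"
    "AE t in ?M. (- dp k t - eps k t - \<phi> k t, - eta k t - \<psi> k t) \<in>
      convex hull (limiting_subdiff (\<lambda>w. p k t \<bullet> (case w of (y, z) \<Rightarrow> dyn P t y z)) (x k t, u k t))"
    "AE t in ?M. norm (p k t) \<le> 1"
    "AE t in ?M. norm (- dp k t - eps k t - \<phi> k t, - eta k t - \<psi> k t) \<le> \<bar>kf t\<bar>"
    "AE t in ?M. norm (\<phi> k t) \<le> cphi t"
    "AE t in ?M. norm (\<psi> k t) \<le> ceta t + \<bar>kf t\<bar>"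
    "AE t in ?M. norm (dp k t) \<le> ceps t + cphi t + \<bar>kf t\<bar>"
    "\<phi> k \<in> L1 a b" "\<psi> k \<in> L1 a b" if "k \<ge> K" for k
    unfolding \<phi>_def[abs_def] \<psi>_def[abs_def] a_def b_def
    by (rule awmp_term_decomposition[OF ab[unfolded a_def b_def] xbar[unfolded a_def b_def] ubar[unfolded a_def b_def]
        xW[unfolded a_def b_def] uL[unfolded a_def b_def] zL[unfolded a_def b_def] pW[unfolded a_def b_def]
        qL[unfolded a_def b_def] rL[unfolded a_def b_def] pL[unfolded a_def b_def] dp(2) K(1)[OF that] lip h4 h5
        kf(1) c8(1,2) c9(1) c8(3) c9(2)])+
  have dpL: "dp k \<in> L1 a b" for k using dp(1)[of k] unfolding W11_deriv_def by blast
  have pint: "p k t = p k a + (LINT s|lebesgue_on {a..t}. dp k s)" if "t \<in> {a..b}" for k t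
    using dp(1)[of k] that unfolding W11_deriv_def by blast

  obtain s1 where s1: "strict_mono (s1 :: nat \<Rightarrow> nat)"
    "AE t in lebesgue_on {a..b}. (\<lambda>k. u (s1 k + K) t - ubar t) \<longlonglongrightarrow> 0"
  proof -
    have i: "integrable (lebesgue_on {a..b}) (\<lambda>t. u (k + K) t - ubar t)" for k
      using uL[of "k + K"] ubar by (intro Bochner_Integration.integrable_diff) simp_all
    have "(\<lambda>k. LINT t|lebesgue_on {a..b}. norm (u k t - ubar t)) \<longlonglongrightarrow> 0"
      using u_lim unfolding strong_L1_def M[symmetric] .
    from LIMSEQ_ignore_initial_segment[OF this, of K]
    have "\<exists>r. strict_mono (r::nat\<Rightarrow>nat) \<and> (AE t in lebesgue_on {a..b}. (\<lambda>k. u (r k + K) t - ubar t) \<longlonglongrightarrow> 0)"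
      by (rule tendsto_L1_AE_subseq[OF i])
    then show thesis using that by blast
  qed
  \<comment> \<open>One vector-valued sequence, so that a single subsequence serves for all three components.\<close>
  define V where "V k t = (dp k t, \<phi> k t, \<psi> k t)" for k t
  have VL: "V k \<in> L1 a b" if "k \<ge> K" for k
    unfolding V_def[abs_def] using dpL[of k] dec(8,9)[OF that]
    by (simp add: integrable_Pair_fun)
  define gV where "gV t = ceps t + cphi t + \<bar>kf t\<bar> + (cphi t + (ceta t + \<bar>kf t\<bar>))" for t
  have gV: "integrable (lebesgue_on {a..b}) gV"
    using kf(1) c8(1,2) c9(1) unfolding M gV_def[abs_def] by simp
  have Vdom: "AE t in lebesgue_on {a..b}. norm (V k t) \<le> gV t" if "k \<ge> K" for k
    using dec(5,6,7)[OF that] unfolding M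
  proof eventually_elim
    case (elim t)
    have "norm (V k t) \<le> norm (dp k t) + norm (\<phi> k t, \<psi> k t)" unfolding V_def by (rule norm_Pair_le)
    moreover have "norm (\<phi> k t, \<psi> k t) \<le> norm (\<phi> k t) + norm (\<psi> k t)" by (rule norm_Pair_le)
    ultimately show ?case using elim unfolding gV_def by linarith
  qed
  obtain s2 Vl where s2: "strict_mono (s2 :: nat \<Rightarrow> nat)" "Vl \<in> L1 a b"
    "weak_L1 a b (\<lambda>k. V (s1 (s2 k) + K)) Vl"
    "uniform_limit {a..b} (\<lambda>k t. LINT \<tau>|lebesgue_on {a..t}. V (s1 (s2 k) + K) \<tau>)
       (\<lambda>t. LINT \<tau>|lebesgue_on {a..t}. Vl \<tau>) sequentially"
    by (rule dominated_weakly_sequentially_compact[OF less_imp_le[OF ab] VL gV Vdom, of "\<lambda>k. s1 k + K"])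
      simp_all
  have GV: "(LINT s|lebesgue_on {a..t}. gV s) \<le> (LINT s|lebesgue_on {a..b}. gV s)" if "t \<in> {a..b}" for t
  proof -
    have "integrable (lebesgue_on {a..b}) (V K)" using VL[OF order_refl] by simp
    from prefix_integral_diff_le[OF this gV Vdom[OF order_refl] _ _ order_refl, of t] that
    have "norm ((LINT x|lebesgue_on {a..b}. V K x) - (LINT x|lebesgue_on {a..t}. V K x))
      \<le> (LINT s|lebesgue_on {a..b}. gV s) - (LINT s|lebesgue_on {a..t}. gV s)" by simp
    from order_trans[OF norm_ge_zero this] show ?thesis by simp
  qed
  \<comment> \<open>The norm of \<open>p k\<close> is at most 1 only almost everywhere, so its value at the endpoint \<open>a\<close> is bounded by way of a time at which the bound holds.\<close>
  define B where "B = 1 + (LINT s|lebesgue_on {a..b}. gV s)"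
  have paB: "norm (p k a) \<le> B" if k: "k \<ge> K" for k
  proof -
    have "\<exists>t\<in>{a..b}. norm (p k t) \<le> 1"
    proof (rule ccontr)
      assume none: "\<not> (\<exists>t\<in>{a..b}. norm (p k t) \<le> 1)"
      have "AE t in lebesgue_on {a..b}. False"
        using dec(3)[OF k] AE_space[of "lebesgue_on {a..b}"] unfolding M
      proof eventually_elim
        case (elim t) then show ?case using none by simp
      qed
      then show False using not_AE_False_interval[OF ab] by contradiction
    qed
    then obtain t where t: "t \<in> {a..b}" "norm (p k t) \<le> 1" by blast
    have di: "integrable (lebesgue_on {a..b}) (dp k)" using dpL[of k] by simp
    have "AE t in lebesgue_on {a..b}. norm (dp k t) \<le> gV t"
      using Vdom[OF k]
    proof (rule eventually_mono)
      fix t assume "norm (V k t) \<le> gV t"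
      then show "norm (dp k t) \<le> gV t" using norm_fst_le[of "dp k t" "(\<phi> k t, \<psi> k t)"] unfolding V_def by linarith
    qed
    from prefix_integral_diff_le[OF di gV this order_refl, of t] t(1)
    have "norm (LINT s|lebesgue_on {a..t}. dp k s) \<le> (LINT s|lebesgue_on {a..t}. gV s)"
      by (simp add: integral_lebesgue_on_singleton)
    moreover have "p k a = p k t - (LINT s|lebesgue_on {a..t}. dp k s)" using pint[OF t(1), of k] by simp
    then have "norm (p k a) \<le> norm (p k t) + norm (LINT s|lebesgue_on {a..t}. dp k s)"
      by (simp only: norm_triangle_ineq4)
    ultimately show ?thesis using t(2) GV[OF t(1)] unfolding B_def by linarith
  qed
  have sgB: "norm (sg k) \<le> Kl" if "k \<ge> K" for k
    by (rule norm_limiting_subdiff_le[OF sg open_ball K(2)[OF that] \<rho>(2)])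

  \<comment> \<open>The finite-dimensional data, made convergent by compactness.\<close>
  define Z where "Z k = (lam (s1 (s2 k) + K), p (s1 (s2 k) + K) a, sg (s1 (s2 k) + K))" for k
  have "norm (Z k) \<le> 1 + (B + Kl)" for k
  proof -
    let ?j = "s1 (s2 k) + K"
    have "norm (Z k) \<le> norm (lam ?j) + norm (p ?j a, sg ?j)" unfolding Z_def by (rule norm_Pair_le)
    moreover have "norm (p ?j a, sg ?j) \<le> norm (p ?j a) + norm (sg ?j)" by (rule norm_Pair_le)
    moreover have "0 \<le> Linf_norm a b (p ?j)"
    proof -
      obtain C where C: "\<And>t. t \<in> {a..b} \<Longrightarrow> norm (p ?j t) \<le> C" using W11_bounded[OF pW] by blast
      show ?thesis by (rule Linf_norm_props(2)[OF ab W11_measurable[OF pW], of _ C], rule AE_I2) (use C in simp)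
    qed
    then have "norm (lam ?j) \<le> 1" using nrm[of ?j] lam0[of ?j] by simp
    ultimately show ?thesis using paB[of ?j] sgB[of ?j] by simp
  qed
  then have "bounded (range Z)" unfolding bounded_iff by (intro exI[of _ "1 + (B + Kl)"]) simp
  then obtain Zl s3 where s3: "strict_mono (s3 :: nat \<Rightarrow> nat)" "(Z \<circ> s3) \<longlonglongrightarrow> Zl"
    using bounded_imp_convergent_subsequence by blast
  define \<sigma> where "\<sigma> k = s1 (s2 (s3 k)) + K" for k
  have s23: "strict_mono (\<lambda>k. s2 (s3 k))" using strict_mono_o[OF s2(1) s3(1)] by (simp only: o_def)
  have s123: "strict_mono (\<lambda>k. s1 (s2 (s3 k)))" using strict_mono_o[OF s1(1) s23] by (simp only: o_def)
  have \<sigma>: "strict_mono \<sigma>" using s123 unfolding strict_mono_def \<sigma>_def by simp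
  have \<sigma>K: "\<sigma> k \<ge> K" for k unfolding \<sigma>_def by simp
  have sub: "(\<lambda>k. f (\<sigma> k)) \<longlonglongrightarrow> c" if "f \<longlonglongrightarrow> c" for f :: "nat \<Rightarrow> 'z::topological_space" and c
    using LIMSEQ_subseq_LIMSEQ[OF that \<sigma>] by (simp only: o_def)
  define l where "l = fst Zl"
  define pa where "pa = fst (snd Zl)"
  define sl where "sl = snd (snd Zl)"
  have Zs: "(\<lambda>k. (lam (\<sigma> k), p (\<sigma> k) a, sg (\<sigma> k))) \<longlonglongrightarrow> Zl"
    using s3(2) unfolding o_def Z_def \<sigma>_def .
  have liml: "(\<lambda>k. lam (\<sigma> k)) \<longlonglongrightarrow> l" using tendsto_fst[OF Zs] unfolding l_def by simp
  have limpa: "(\<lambda>k. p (\<sigma> k) a) \<longlonglongrightarrow> pa" using tendsto_fst[OF tendsto_snd[OF Zs]] unfolding pa_def by simp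
  have limsg: "(\<lambda>k. sg (\<sigma> k)) \<longlonglongrightarrow> sl" using tendsto_snd[OF tendsto_snd[OF Zs]] unfolding sl_def by simp
  have l0: "l \<ge> 0" by (rule LIMSEQ_le_const[OF liml]) (use lam0 in blast)

  have weakV: "weak_L1 a b (\<lambda>k. V (\<sigma> k)) Vl"
    using weak_L1_subseq[OF s2(3) s3(1)] unfolding \<sigma>_def .
  have uniV: "uniform_limit {a..b} (\<lambda>k t. LINT \<tau>|lebesgue_on {a..t}. V (\<sigma> k) \<tau>)
       (\<lambda>t. LINT \<tau>|lebesgue_on {a..t}. Vl \<tau>) sequentially"
    using filterlim_compose[OF s2(4) filterlim_subseq[OF s3(1)]] unfolding \<sigma>_def .
  define dpl where "dpl t = fst (Vl t)" for t
  define \<phi>l where "\<phi>l t = fst (snd (Vl t))" for t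
  define \<psi>l where "\<psi>l t = snd (snd (Vl t))" for t
  have Vli: "integrable (lebesgue_on {a..b}) Vl" using s2(2) by simp
  have dplL: "dpl \<in> L1 a b" unfolding dpl_def[abs_def]
    using integrable_bounded_linear[OF bounded_linear_fst Vli] by simp
  have \<phi>lL: "\<phi>l \<in> L1 a b" unfolding \<phi>l_def[abs_def]
    using integrable_bounded_linear[OF bounded_linear_compose[OF bounded_linear_fst bounded_linear_snd] Vli] by simp
  have \<psi>lL: "\<psi>l \<in> L1 a b" unfolding \<psi>l_def[abs_def]
    using integrable_bounded_linear[OF bounded_linear_compose[OF bounded_linear_snd bounded_linear_snd] Vli] by simp
  define pp where "pp t = pa + (LINT s|lebesgue_on {a..t}. dpl s)" for t
  have ppa: "pp a = pa" unfolding pp_def by (simp add: integral_lebesgue_on_singleton)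
  have ppW: "W11_deriv a b pp dpl"
    unfolding W11_deriv_def ppa using dplL by (simp add: pp_def)
  have fst_int: "(LINT s|lebesgue_on {a..t}. fst (W s)) = fst (LINT s|lebesgue_on {a..t}. W s)"
    if "W \<in> L1 a b" "t \<in> {a..b}" for t and W :: "real \<Rightarrow> (real^'n) \<times> (real^'n) \<times> (real^'m)"
  proof (rule integral_bounded_linear[OF bounded_linear_fst])
    show "integrable (lebesgue_on {a..t}) W"
      by (rule integrable_subinterval[of a b]) (use that in simp_all)
  qed
  have punif: "\<exists>N. \<forall>k\<ge>N. \<forall>t\<in>{a..b}. norm (p (\<sigma> k) t - pp t) < e" if "e > 0" for e
  proof -
    have e2: "e/2 > 0" using that by simp
    have "\<forall>\<^sub>F k in sequentially. (\<forall>t\<in>{a..b}. dist (LINT \<tau>|lebesgue_on {a..t}. V (\<sigma> k) \<tau>)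
        (LINT \<tau>|lebesgue_on {a..t}. Vl \<tau>) < e/2) \<and> dist (p (\<sigma> k) a) pa < e/2"
      by (intro eventually_conj uniform_limitD[OF uniV e2] tendstoD[OF limpa e2])
    then obtain N where N: "\<And>k t. k \<ge> N \<Longrightarrow> t \<in> {a..b} \<Longrightarrow> dist (LINT \<tau>|lebesgue_on {a..t}. V (\<sigma> k) \<tau>)
        (LINT \<tau>|lebesgue_on {a..t}. Vl \<tau>) < e/2" "\<And>k. k \<ge> N \<Longrightarrow> dist (p (\<sigma> k) a) pa < e/2"
      unfolding eventually_sequentially by blast
    show ?thesis
    proof (intro exI[of _ N] allI impI ballI)
      fix k t assume k: "k \<ge> N" and t: "t \<in> {a..b}"
      let ?X = "LINT \<tau>|lebesgue_on {a..t}. V (\<sigma> k) \<tau>" and ?Y = "LINT \<tau>|lebesgue_on {a..t}. Vl \<tau>"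
      have "p (\<sigma> k) t = p (\<sigma> k) a + fst ?X"
        using pint[OF t, of "\<sigma> k"] fst_int[OF VL[OF \<sigma>K[of k]] t] by (simp add: V_def)
      moreover have "pp t = pa + fst ?Y"
        unfolding pp_def dpl_def fst_int[OF s2(2) t] ..
      ultimately have "p (\<sigma> k) t - pp t = (p (\<sigma> k) a - pa) + fst (?X - ?Y)" by simp
      then have "norm (p (\<sigma> k) t - pp t) \<le> norm (p (\<sigma> k) a - pa) + norm (fst (?X - ?Y))"
        by (simp only: norm_triangle_ineq)
      moreover have "norm (fst (?X - ?Y)) \<le> norm (?X - ?Y)"
        using norm_fst_le[of "fst (?X - ?Y)" "snd (?X - ?Y)"] unfolding prod.collapse .
      ultimately show "norm (p (\<sigma> k) t - pp t) < e"
        using N(1)[OF k t] N(2)[OF k] unfolding dist_norm by linarith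
    qed
  qed
  have ppt: "(\<lambda>k. p (\<sigma> k) t) \<longlonglongrightarrow> pp t" if "t \<in> {a..b}" for t
    by (rule LIMSEQ_I) (use punif that in blast)
  have npW: "pp \<in> W11 a b" using ppW unfolding W11_def by blast

  \<comment> \<open>If the limit vanished, then \<open>lam\<close> and, by uniform convergence, the norm of \<open>p\<close> would tend to 0, although their sum is 1.\<close>
  have nontriv: "l + Linf_norm a b pp \<noteq> 0"
  proof
    assume zero: "l + Linf_norm a b pp = 0"
    obtain C where C: "\<And>t. t \<in> {a..b} \<Longrightarrow> norm (pp t) \<le> C" using W11_bounded[OF npW] by blast
    have ae: "AE t in lebesgue_on {a..b}. norm (pp t) \<le> C" by (rule AE_I2) (use C in simp)
    note pr = Linf_norm_props[OF ab W11_measurable[OF npW] ae]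
    have l0': "l = 0" "Linf_norm a b pp = 0" using zero l0 pr(2) by linarith+
    have "\<forall>\<^sub>F k in sequentially. lam (\<sigma> k) < 1/2"
      by (rule order_tendstoD(2)[OF liml]) (simp add: l0')
    then obtain N1 where N1: "\<And>k. k \<ge> N1 \<Longrightarrow> lam (\<sigma> k) < 1/2" unfolding eventually_sequentially by blast
    obtain N2 where N2: "\<And>k t. k \<ge> N2 \<Longrightarrow> t \<in> {a..b} \<Longrightarrow> norm (p (\<sigma> k) t - pp t) < 1/4"
    proof -
      have "(0::real) < 1/4" by simp
      from punif[OF this] show thesis using that by blast
    qed
    define k where "k = max N1 N2"
    have "AE t in lebesgue_on {a..b}. norm (p (\<sigma> k) t) \<le> 1/4"
      using pr(1) AE_space[of "lebesgue_on {a..b}"]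
    proof eventually_elim
      case (elim t)
      then have "pp t = 0" using l0' by simp
      then show ?case using N2[of k t] elim(2) by (simp add: k_def)
    qed
    from Linf_norm_props(3)[OF ab W11_measurable[OF pW] this] have "Linf_norm a b (p (\<sigma> k)) \<le> 1/4" .
    moreover have "lam (\<sigma> k) < 1/2" using N1[of k] by (simp add: k_def)
    ultimately show False using nrm[of "\<sigma> k"] by linarith
  qed

  have bB: "b \<in> {a..b}" and aB: "a \<in> {a..b}" using ab by simp_all
  have neq: "n k = (p k a, - p k b) - (vt k, nu k) - lam k *\<^sub>R sg k" for k using trans[of k] by simp
  \<comment> \<open>The normal vector is determined by the other terms of the transversality condition, so it converges with them.\<close>
  define nl where "nl = (pp a, - pp b) - (0, 0) - l *\<^sub>R sl"
  have limn: "(\<lambda>k. n (\<sigma> k)) \<longlonglongrightarrow> nl"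
    unfolding neq nl_def
    by (intro tendsto_diff tendsto_Pair tendsto_minus tendsto_scaleR ppt aB bB sub[OF vtnu] liml limsg)
  have sll: "sl \<in> limiting_subdiff (cost P) (xbar a, xbar b)"
  proof (rule limiting_subdiff_closed_graph[where hs = "\<lambda>_. cost P" and L = "\<lambda>_. 0"])
    show "sg (\<sigma> k) \<in> limiting_subdiff (cost P) (x (\<sigma> k) a, x (\<sigma> k) b)" for k by (rule sg)
    show "(\<lambda>k. (x (\<sigma> k) a, x (\<sigma> k) b)) \<longlonglongrightarrow> (xbar a, xbar b)" by (rule sub[OF endlim])
    show "continuous_on (ball (xbar a, xbar b) \<rho>) (cost P)" by (rule lipschitz_on_continuous_on[OF \<rho>(2)])
  qed (use limsg \<rho>(1) in simp_all)

  have u1: "AE t in lebesgue_on {a..b}. (\<lambda>k. u (\<sigma> k) t) \<longlonglongrightarrow> ubar t"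
    using s1(2)
  proof (rule eventually_mono)
    fix t assume "(\<lambda>k. u (s1 k + K) t - ubar t) \<longlonglongrightarrow> 0"
    from LIMSEQ_subseq_LIMSEQ[OF this s23] have "(\<lambda>k. u (\<sigma> k) t - ubar t) \<longlonglongrightarrow> 0"
      unfolding o_def \<sigma>_def .
    then show "(\<lambda>k. u (\<sigma> k) t) \<longlonglongrightarrow> ubar t" by (rule LIM_zero_cancel)
  qed

  have weak\<phi>: "weak_L1 a b (\<lambda>k t. (\<phi> (\<sigma> k) t, \<psi> (\<sigma> k) t)) (\<lambda>t. (\<phi>l t, \<psi>l t))"
    using weak_L1_linear_image[OF weakV bounded_linear.linear[OF bounded_linear_snd]]
    by (simp add: V_def \<phi>l_def \<psi>l_def)
  have "(\<phi>l, \<psi>l, fst nl, snd nl) \<in> wlimsup_M P xbar ubar \<delta>"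
    unfolding wlimsup_M_def
  proof (rule CollectI, intro case_prodI conjI)
    show "\<phi>l \<in> L1 (t_ini P) (t_fin P)" "\<psi>l \<in> L1 (t_ini P) (t_fin P)" using \<phi>lL \<psi>lL by (simp_all only: a_def b_def)
    have kp: "(\<lambda>t. ceta t + \<bar>kf t\<bar>) \<in> L1 (t_ini P) (t_fin P)" using kf(1) c8(2) by simp
    have mem: "(\<phi> (\<sigma> k), \<psi> (\<sigma> k), fst (n (\<sigma> k)), snd (n (\<sigma> k))) \<in>
        M_bd P xbar ubar \<delta> (\<lambda>t. ceta t + \<bar>kf t\<bar>) (x (\<sigma> k)) (u (\<sigma> k)) (\<theta> (\<sigma> k))" for k
      unfolding M_bd_def
    proof (rule CollectI, intro case_prodI conjI allI exI)
      have "AE t in ?M. (x (\<sigma> k) t, u (\<sigma> k) t) \<in> Omega_t xbar ubar \<delta> t"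
        using dec(1)[OF \<sigma>K[of k]] by (rule eventually_mono) (simp add: Omega_t_eq_cball)
      then show "(x (\<sigma> k), u (\<sigma> k)) \<in> Omega P xbar ubar \<delta>"
        unfolding Omega_def using xW[of "\<sigma> k"] uL[of "\<sigma> k"] by (simp add: a_def b_def)
      show "\<theta> (\<sigma> k) j \<in> Ccone P" for j by (rule thC)
      show "\<phi> (\<sigma> k) \<in> L1 (t_ini P) (t_fin P)" "\<psi> (\<sigma> k) \<in> L1 (t_ini P) (t_fin P)"
        using dec(8,9)[OF \<sigma>K[of k]] by (simp_all only: a_def b_def)
      show "q (\<sigma> k) \<in> L1 (t_ini P) (t_fin P)" "r (\<sigma> k) \<in> L1 (t_ini P) (t_fin P)" "\<zeta> (\<sigma> k) \<in> L1 (t_ini P) (t_fin P)"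
        using qL rL zL by (simp_all only: a_def b_def)
      show "AE t in ?M.
              (\<phi> (\<sigma> k) t, \<psi> (\<sigma> k) t) =
                (\<Sum>i\<in>UNIV. q (\<sigma> k) t $ i *\<^sub>R grad (\<lambda>(y, z). eqc P t y z $ i) (x (\<sigma> k) t, u (\<sigma> k) t)) +
                (\<Sum>j\<in>UNIV. r (\<sigma> k) t $ j *\<^sub>R grad (\<lambda>(y, z). ineqc P t y z $ j) (x (\<sigma> k) t, u (\<sigma> k) t)) +
                (0, - \<zeta> (\<sigma> k) t) \<and>
              \<zeta> (\<sigma> k) t \<in> limiting_normal (U_loc P ubar \<delta> t) (u (\<sigma> k) t) \<and>
              (\<forall>j. r (\<sigma> k) t $ j * ineq_minus P j t (x (\<sigma> k) t) (u (\<sigma> k) t) = \<theta> (\<sigma> k) j t \<and> r (\<sigma> k) t $ j \<le> 0) \<and>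
              norm (\<psi> (\<sigma> k) t) \<le> ceta t + \<bar>kf t\<bar>"
        using zN[of "\<sigma> k"] rth[of "\<sigma> k"] dec(6)[OF \<sigma>K[of k]]
      proof eventually_elim
        case (elim t)
        show ?case
        proof (intro conjI)
          show "(\<phi> (\<sigma> k) t, \<psi> (\<sigma> k) t) =
                (\<Sum>i\<in>UNIV. q (\<sigma> k) t $ i *\<^sub>R grad (\<lambda>(y, z). eqc P t y z $ i) (x (\<sigma> k) t, u (\<sigma> k) t)) +
                (\<Sum>j\<in>UNIV. r (\<sigma> k) t $ j *\<^sub>R grad (\<lambda>(y, z). ineqc P t y z $ j) (x (\<sigma> k) t, u (\<sigma> k) t)) +
                (0, - \<zeta> (\<sigma> k) t)"
            unfolding constraint_grad_def[symmetric] \<phi>_def \<psi>_def by (simp add: prod_eq_iff)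
        qed (use elim in blast)+
      qed
      show "(fst (n (\<sigma> k)), snd (n (\<sigma> k))) \<in> limiting_normal (endpts P) (x (\<sigma> k) (t_ini P), x (\<sigma> k) (t_fin P))"
        using n[of "\<sigma> k"] unfolding prod.collapse a_def b_def .
    qed
    show "\<exists>kpsi\<in>L1 (t_ini P) (t_fin P). \<exists>x u \<theta> \<phi>s \<psi>s \<gamma>s \<xi>s.
           (\<forall>k. x k \<in> W11 (t_ini P) (t_fin P) \<and> u k \<in> L1 (t_ini P) (t_fin P) \<and>
                (\<forall>j. \<theta> k j \<in> Ccone P) \<and>
                (\<phi>s k, \<psi>s k, \<gamma>s k, \<xi>s k) \<in> M_bd P xbar ubar \<delta> kpsi (x k) (u k) (\<theta> k)) \<and>
           uniform_limit {t_ini P..t_fin P} x xbar sequentially \<and>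
           strong_L1 (t_ini P) (t_fin P) u ubar \<and>
           (\<forall>j. AE t in ival P. (\<lambda>k. \<theta> k j t) \<longlonglongrightarrow> 0) \<and>
           weak_L1 (t_ini P) (t_fin P) (\<lambda>k t. (\<phi>s k t, \<psi>s k t)) (\<lambda>t. (\<phi>l t, \<psi>l t)) \<and>
           (\<lambda>k. (\<gamma>s k, \<xi>s k)) \<longlonglongrightarrow> (fst nl, snd nl)"
    proof (rule bexI[OF _ kp], intro exI conjI allI)
      show "x (\<sigma> k) \<in> W11 (t_ini P) (t_fin P)" "u (\<sigma> k) \<in> L1 (t_ini P) (t_fin P)" "\<theta> (\<sigma> k) j \<in> Ccone P" for k j
        using xW uL thC by (simp_all only: a_def b_def)
      show "(\<phi> (\<sigma> k), \<psi> (\<sigma> k), fst (n (\<sigma> k)), snd (n (\<sigma> k))) \<in>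
        M_bd P xbar ubar \<delta> (\<lambda>t. ceta t + \<bar>kf t\<bar>) (x (\<sigma> k)) (u (\<sigma> k)) (\<theta> (\<sigma> k))" for k by (rule mem)
      show "uniform_limit {t_ini P..t_fin P} (\<lambda>k. x (\<sigma> k)) xbar sequentially"
        by (rule filterlim_compose[OF x_lim filterlim_subseq[OF \<sigma>]])
      show "strong_L1 (t_ini P) (t_fin P) (\<lambda>k. u (\<sigma> k)) ubar"
        using sub[OF u_lim[unfolded strong_L1_def]] unfolding strong_L1_def .
      show "AE t in ival P. (\<lambda>k. \<theta> (\<sigma> k) j t) \<longlonglongrightarrow> 0" for j
        using th0[of j] by (rule eventually_mono) (rule sub)
      show "weak_L1 (t_ini P) (t_fin P) (\<lambda>k t. (\<phi> (\<sigma> k) t, \<psi> (\<sigma> k) t)) (\<lambda>t. (\<phi>l t, \<psi>l t))"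
        using weak\<phi> unfolding a_def b_def .
      show "(\<lambda>k. (fst (n (\<sigma> k)), snd (n (\<sigma> k)))) \<longlonglongrightarrow> (fst nl, snd nl)"
        using limn unfolding prod.collapse .
    qed
  qed
  then have "(\<phi>l, \<psi>l, fst nl, snd nl) \<in> M_set P xbar ubar \<delta> xbar ubar (\<lambda>j t. 0)"
    using regular unfolding AWMP_regular_with_def by (elim conjE) (rule subsetD)
  then obtain qq rr z where qq: "qq \<in> L1 a b" and rr: "rr \<in> L1 a b" and z: "z \<in> L1 a b"
    and fin: "AE t in ?M. (\<phi>l t, \<psi>l t) = constraint_grad P t (qq t) (rr t) (xbar t, ubar t) + (0, - z t) \<and>
        z t \<in> limiting_normal (U_loc P ubar \<delta> t) (ubar t) \<and>
        (\<forall>j. rr t $ j * ineq_minus P j t (xbar t) (ubar t) = 0 \<and> rr t $ j \<le> 0)"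
    and nC: "nl \<in> limiting_normal (endpts P) (xbar a, xbar b)"
  proof -
    assume "(\<phi>l, \<psi>l, fst nl, snd nl) \<in> M_set P xbar ubar \<delta> xbar ubar (\<lambda>j t. 0)"
    then obtain kpsi where "(\<phi>l, \<psi>l, fst nl, snd nl) \<in> M_bd P xbar ubar \<delta> kpsi xbar ubar (\<lambda>j t. 0)"
      unfolding M_set_def by (rule UN_E)
    then show thesis
    proof (rule M_bdE)
      fix qq rr z
      assume "qq \<in> L1 (t_ini P) (t_fin P)" "rr \<in> L1 (t_ini P) (t_fin P)" "z \<in> L1 (t_ini P) (t_fin P)"
        and ae: "AE t in ?M. (\<phi>l t, \<psi>l t) = constraint_grad P t (qq t) (rr t) (xbar t, ubar t) + (0, - z t) \<and>
          z t \<in> limiting_normal (U_loc P ubar \<delta> t) (ubar t) \<and>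
          (\<forall>j. rr t $ j * ineq_minus P j t (xbar t) (ubar t) = 0 \<and> rr t $ j \<le> 0)"
        and "(fst nl, snd nl) \<in> limiting_normal (endpts P) (xbar (t_ini P), xbar (t_fin P))"
      then show thesis unfolding a_def[symmetric] b_def[symmetric] prod.collapse by (intro that[unfolded M])
    qed
  qed

  \<comment> \<open>The sequence \<open>\<alpha>\<close> is a linear image of \<open>V\<close> minus a perturbation that tends weakly to 0.\<close>
  let ?L = "\<lambda>v :: (real^'n) \<times> (real^'n) \<times> (real^'m). (- fst v - fst (snd v), - snd (snd v))"
  define \<alpha> where "\<alpha> k t = ?L (V k t) - (eps k t, eta k t)" for k t
  define \<alpha>l where "\<alpha>l t = ?L (Vl t)" for t
  have bL: "bounded_linear ?L"
    by (intro bounded_linear_Pair bounded_linear_sub bounded_linear_minus bounded_linear_fst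
        bounded_linear_compose[OF bounded_linear_fst bounded_linear_snd]
        bounded_linear_compose[OF bounded_linear_snd bounded_linear_snd])
  have \<alpha>eq: "\<alpha> k t = (- dp k t - eps k t - \<phi> k t, - eta k t - \<psi> k t)" for k t
    by (simp add: \<alpha>_def V_def)
  have LV: "(\<lambda>t. ?L (V (\<sigma> k) t)) \<in> L1 a b" for k
    using integrable_bounded_linear[OF bL] VL[OF \<sigma>K[of k]] by blast
  have epsi: "(\<lambda>t. (eps k t, eta k t)) \<in> L1 a b" for k
    using integrable_Pair_fun[of "lebesgue_on {a..b}" "eps k" "eta k"] epsL[of k] etaL[of k] by simp
  have \<alpha>L: "\<alpha> (\<sigma> k) \<in> L1 a b" for k
    unfolding \<alpha>_def[abs_def]
    by (rule CollectI, rule Bochner_Integration.integrable_diff)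
      (use LV[of k] epsi[of "\<sigma> k"] in blast)+
  have \<alpha>lL: "\<alpha>l \<in> L1 a b"
    unfolding \<alpha>l_def[abs_def] using integrable_bounded_linear[OF bL Vli] by blast
  have weak\<alpha>: "weak_L1 a b (\<lambda>k. \<alpha> (\<sigma> k)) \<alpha>l"
  proof -
    have w1: "weak_L1 a b (\<lambda>k t. ?L (V (\<sigma> k) t)) \<alpha>l"
      using weak_L1_linear_image[OF weakV bounded_linear.linear[OF bL]] unfolding \<alpha>l_def .
    have w2: "weak_L1 a b (\<lambda>k t. (eps (\<sigma> k) t, eta (\<sigma> k) t)) (\<lambda>t. (0, 0))"
      by (rule weak_L1_subseq[OF epsw \<sigma>])
    have "(\<lambda>t. (0, 0)) \<in> (L1 a b :: (real \<Rightarrow> (real^'n) \<times> (real^'m)) set)"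
      by (simp flip: zero_prod_def)
    from weak_L1_diff[OF LV \<alpha>lL w1 epsi this w2] show ?thesis
      unfolding \<alpha>_def[abs_def] by (simp flip: zero_prod_def)
  qed
  have "AE t in lebesgue_on {a..b}. norm (\<alpha> (\<sigma> k) t) \<le> \<bar>kf t\<bar>" for k
    using dec(4)[OF \<sigma>K[of k]] unfolding M \<alpha>eq .
  note hull = weak_L1_AE_in_closed_hull[OF \<alpha>L \<alpha>lL weak\<alpha> this]
  have balls: "AE t in ?M. \<forall>k. (x (\<sigma> k) t, u (\<sigma> k) t) \<in> ball (xbar t, ubar t) \<delta>"
    using dec(1)[OF \<sigma>K] by (simp only: AE_all_countable) blast
  have incs: "AE t in ?M. \<forall>k. \<alpha> (\<sigma> k) t \<in>
      convex hull (limiting_subdiff (\<lambda>w. p (\<sigma> k) t \<bullet> (case w of (y, z) \<Rightarrow> dyn P t y z)) (x (\<sigma> k) t, u (\<sigma> k) t))"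
    unfolding \<alpha>eq using dec(2)[OF \<sigma>K] by (simp only: AE_all_countable) blast
  have p1s: "AE t in ?M. \<forall>k. norm (p (\<sigma> k) t) \<le> 1"
    using dec(3)[OF \<sigma>K] by (simp only: AE_all_countable) blast
  have C1: "AE t in ?M. (\<forall>i. C1_on (Omega_t xbar ubar \<delta> t) (\<lambda>(x, u). eqc P t x u $ i)) \<and>
        (\<forall>j. C1_on (Omega_t xbar ubar \<delta> t) (\<lambda>(x, u). ineqc P t x u $ j))"
    using h5 unfolding H5_def by blast
  have adj: "AE t in ?M. (- dpl t, z t) \<in> convex hull (subdiff_Ham P t (xbar t) (pp t) (qq t) (rr t) (ubar t))"
    using hull[folded M] balls incs p1s u1[folded M] lip fin C1 AE_space[of ?M]
  proof eventually_elim
    case (elim t)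
    have t: "t \<in> {a..b}" using elim(9) by (simp add: a_def b_def)
    let ?S = "limiting_subdiff (\<lambda>w. pp t \<bullet> (case w of (y, z) \<Rightarrow> dyn P t y z)) (xbar t, ubar t)"
    let ?G = "constraint_grad P t (qq t) (rr t) (xbar t, ubar t)"
    have \<alpha>in: "\<alpha>l t \<in> convex hull ?S"
    proof (rule hull_subdiff_limit[OF elim(6) delta, where B = 1])
      show "(x (\<sigma> k) t, u (\<sigma> k) t) \<in> ball (xbar t, ubar t) \<delta>" for k using elim(2) by blast
      show "(\<lambda>k. (x (\<sigma> k) t, u (\<sigma> k) t)) \<longlonglongrightarrow> (xbar t, ubar t)"
        by (intro tendsto_Pair sub[OF xpt[OF t]] elim(5))
      show "(\<lambda>k. p (\<sigma> k) t) \<longlonglongrightarrow> pp t" by (rule ppt[OF t])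
      show "norm (p (\<sigma> k) t) \<le> 1" for k using elim(4) by blast
      show "\<alpha> (\<sigma> k) t \<in> convex hull (limiting_subdiff (\<lambda>w. p (\<sigma> k) t \<bullet> (case w of (y, z) \<Rightarrow> dyn P t y z)) (x (\<sigma> k) t, u (\<sigma> k) t))" for k
        using elim(3) by blast
      show "\<alpha>l t \<in> closure (convex hull ((\<lambda>k. \<alpha> (\<sigma> k) t) ` {N..}))" for N using elim(1) by blast
    qed
    have ctr: "(xbar t, ubar t) \<in> ball (xbar t, ubar t) \<delta>" using delta by simp
    have "subdiff_Ham P t (xbar t) (pp t) (qq t) (rr t) (ubar t) = (\<lambda>v. ?G + v) ` ?S"
      by (rule subdiff_Ham_eq_translate[where xbar = xbar and ubar = ubar and \<delta> = \<delta>])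
        (use elim(8) ctr in blast)+
    then have "convex hull (subdiff_Ham P t (xbar t) (pp t) (qq t) (rr t) (ubar t)) = (\<lambda>v. ?G + v) ` (convex hull ?S)"
      by (simp only: convex_hull_translation)
    moreover have "(- dpl t, z t) = ?G + \<alpha>l t"
    proof -
      have "(\<phi>l t, \<psi>l t) = ?G + (0, - z t)" using elim(7) by blast
      then have "fst ?G = \<phi>l t" "snd ?G = \<psi>l t + z t" by (simp_all add: prod_eq_iff)
      then show ?thesis by (simp add: \<alpha>l_def dpl_def \<phi>l_def \<psi>l_def prod_eq_iff)
    qed
    ultimately show ?case using \<alpha>in by (simp only: image_eqI)
  qed
  have normal: "AE t in ?M. z t \<in> convex hull (limiting_normal (ctrl P t) (ubar t))"
    using fin
  proof (rule eventually_mono, elim conjE)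
    fix t assume "z t \<in> limiting_normal (U_loc P ubar \<delta> t) (ubar t)"
    moreover have "limiting_normal (U_loc P ubar \<delta> t) (ubar t) \<subseteq> limiting_normal (ctrl P t) (ubar t)"
      by (rule limiting_normal_local[OF open_ball[of "ubar t" \<delta>]]) (use delta in \<open>auto simp: U_loc_def\<close>)
    ultimately show "z t \<in> convex hull (limiting_normal (ctrl P t) (ubar t))" by (intro hull_inc) (rule subsetD)
  qed
  have feasg: "AE t in ?M. eqc P t (xbar t) (ubar t) = 0 \<and> (\<forall>j. ineqc P t (xbar t) (ubar t) $ j \<le> 0) \<and> ubar t \<in> ctrl P t"
    using feas unfolding feasible_def by blast
  have compl: "AE t in ?M. rr t \<bullet> ineqc P t (xbar t) (ubar t) = 0 \<and> (\<forall>j. rr t $ j \<le> 0)"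
    using fin feasg
  proof eventually_elim
    case (elim t)
    have "rr t $ j * ineqc P t (xbar t) (ubar t) $ j = 0" for j
    proof -
      have "ineqc P t (xbar t) (ubar t) $ j \<le> 0" using elim(2) by blast
      then have "ineq_minus P j t (xbar t) (ubar t) = - (ineqc P t (xbar t) (ubar t) $ j)"
        unfolding ineq_minus_def by simp
      moreover have "rr t $ j * ineq_minus P j t (xbar t) (ubar t) = 0" using elim(1) by blast
      ultimately show ?thesis by simp
    qed
    then have "rr t \<bullet> ineqc P t (xbar t) (ubar t) = 0"
      unfolding inner_vec_def inner_real_def by (intro sum.neutral ballI)
    then show ?case using elim(1) by blast
  qed
  have trl: "(pp a, - pp b) = l *\<^sub>R sl + nl" unfolding nl_def by (simp add: prod_eq_iff)
  show ?thesis
  proof (rule exI[of _ l], rule exI[of _ pp], rule exI[of _ dpl], rule exI[of _ qq], rule exI[of _ rr],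
      rule exI[of _ z], intro conjI)
    show "l \<ge> 0" by (rule l0)
    show "W11_deriv (t_ini P) (t_fin P) pp dpl" using ppW unfolding a_def b_def .
    show "qq \<in> L1 (t_ini P) (t_fin P)" using qq unfolding a_def b_def .
    show "rr \<in> L1 (t_ini P) (t_fin P)" using rr unfolding a_def b_def .
    show "z \<in> L1 (t_ini P) (t_fin P)" using z unfolding a_def b_def .
    show "l + Linf_norm (t_ini P) (t_fin P) pp \<noteq> 0" using nontriv unfolding a_def b_def .
    show "AE t in ?M. (- dpl t, z t) \<in> convex hull (subdiff_Ham P t (xbar t) (pp t) (qq t) (rr t) (ubar t))"
      by (rule adj)
    show "AE t in ?M. z t \<in> convex hull (limiting_normal (ctrl P t) (ubar t))" by (rule normal)
    show "AE t in ?M. rr t \<bullet> ineqc P t (xbar t) (ubar t) = 0 \<and> (\<forall>j. rr t $ j \<le> 0)" by (rule compl)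
    show "\<exists>s\<in>limiting_subdiff (cost P) (xbar (t_ini P), xbar (t_fin P)).
            \<exists>n\<in>limiting_normal (endpts P) (xbar (t_ini P), xbar (t_fin P)).
              (pp (t_ini P), - pp (t_fin P)) = l *\<^sub>R s + n"
    proof (rule bexI[OF _ sll[unfolded a_def b_def]], rule bexI[OF _ nC[unfolded a_def b_def]])
      show "(pp (t_ini P), - pp (t_fin P)) = l *\<^sub>R sl + nl" using trl unfolding a_def b_def .
    qed
  qed
qed

end
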